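(* Let $\vec v\in\mathcal{S}^{n-1}$, $w\in\mathcal{E}'(\mathbb{R}^{n})$, and $\vec{\eta}_{0}\in\vec v^{\perp}$. If $WF(w)\cap(\mathbb{R}^{n}\times\{\vec{\eta}_{0}\})=\emptyset$, then $WF(\mathcal{I}_{\vec v}w)\cap(\mathbb{R}^{n}\times\{\vec{\eta}_{0}\})=\emptyset$.
   Context: $WF$ denotes the (Hörmander) wavefront set, a subset of $\mathbb{R}^n\times(\mathbb{R}^n\setminus\{0\})$. For $\phi\in\mathscr{S}(\mathbb{R}^n)$, $\mathcal{X}_{\vec v}\phi(\vec u)=\int_{\mathbb{R}}\phi(\vec u+s\vec v)\,ds$ for $\vec u\in\vec v^\perp$. For a distribution $w$ with $t_{\min}=\inf_{\vec x\in\mathrm{supp}\,w}\vec x\cdot\vec v>-\infty$ (e.g. $w\in\mathcal{E}'$), choose $\psi_0\in\mathcal{C}_0^\infty(\mathbb{R})$ with $\int\psi_0=1$ and $\mathrm{supp}\,\psi_0\subseteq(-\infty,t_{\min})$, set $\mathcal{I}_{\vec v}\phi(\vec u+t\vec v)=\int_{-\infty}^{t}\big(\phi(\vec u+s\vec v)-\mathcal{X}_{\vec v}\phi(\vec u)\psi_0(s)\big)\,ds$ ($\vec u\in\vec v^\perp$, $t\in\mathbb{R}$), and define the distributional directional antiderivative by $\langle\mathcal{I}_{\vec v}w,\phi\rangle=-\langle w,\mathcal{I}_{\vec v}\phi\rangle$; it is independent of the choice of $\psi_0$. For $\mathcal{L}^1$ functions it is $\mathcal{I}_{\vec v}f(\vec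 u+s\vec v)=\int_{-\infty}^s f(\vec u+t\vec v)\,dt$. *)

theory Defs
  imports "HOL-Analysis.Analysis"
begin

fun pderivs :: "'a::euclidean_space list \<Rightarrow> ('a \<Rightarrow> 'b::real_normed_vector) \<Rightarrow> 'a \<Rightarrow> 'b" where
  "pderivs [] f = f"
| "pderivs (b # bs) f = (\<lambda>x. frechet_derivative (pderivs bs f) (at x) b)"

definition smooth :: "('a::euclidean_space \<Rightarrow> 'b::real_normed_vector) \<Rightarrow> bool" where
  "smooth f \<longleftrightarrow> (\<forall>bs. set bs \<subseteq> Basis \<longrightarrow> (\<forall>x. pderivs bs f differentiable (at x)))"

definition tsupport :: "('a::real_normed_vector \<Rightarrow> 'b::zero) \<Rightarrow> 'a set" where
  "tsupport f = closure {x. f x \<noteq> 0}"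

definition test_fun :: "('a::euclidean_space \<Rightarrow> complex) \<Rightarrow> bool" where
  "test_fun \<phi> \<longleftrightarrow> smooth \<phi> \<and> compact (tsupport \<phi>)"

definition test_conv :: "(nat \<Rightarrow> 'a::euclidean_space \<Rightarrow> complex) \<Rightarrow> ('a \<Rightarrow> complex) \<Rightarrow> bool" where
  "test_conv \<phi>s \<phi> \<longleftrightarrow> (\<forall>k. test_fun (\<phi>s k)) \<and> test_fun \<phi> \<and>
     (\<exists>K. compact K \<and> tsupport \<phi> \<subseteq> K \<and> (\<forall>k. tsupport (\<phi>s k) \<subseteq> K)) \<and>
     (\<forall>bs. set bs \<subseteq> Basis \<longrightarrow> uniform_limit UNIV (\<lambda>k. pderivs bs (\<phi>s k)) (pderivs bs \<phi>) sequentially)"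

text \<open>Distributions: linear, (sequentially) continuous functionals on test functions.
  Only the values on test functions are meaningful.\<close>
definition distribution :: "(('a::euclidean_space \<Rightarrow> complex) \<Rightarrow> complex) \<Rightarrow> bool" where
  "distribution u \<longleftrightarrow>
     (\<forall>\<phi> \<psi>. test_fun \<phi> \<longrightarrow> test_fun \<psi> \<longrightarrow> u (\<lambda>x. \<phi> x + \<psi> x) = u \<phi> + u \<psi>) \<and>
     (\<forall>c \<phi>. test_fun \<phi> \<longrightarrow> u (\<lambda>x. c * \<phi> x) = c * u \<phi>) \<and>
     (\<forall>\<phi>s \<phi>. test_conv \<phi>s \<phi> \<longrightarrow> (\<lambda>k. u (\<phi>s k)) \<longlonglongrightarrow> u \<phi>)"

definition dsupport :: "(('a::euclidean_space \<Rightarrow> complex) \<Rightarrow> complex) \<Rightarrow> 'a set" where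
  "dsupport u = {x. \<not> (\<exists>U. open U \<and> x \<in> U \<and>
       (\<forall>\<phi>. test_fun \<phi> \<longrightarrow> tsupport \<phi> \<subseteq> U \<longrightarrow> u \<phi> = 0))}"

definition compact_distribution :: "(('a::euclidean_space \<Rightarrow> complex) \<Rightarrow> complex) \<Rightarrow> bool" where
  "compact_distribution u \<longleftrightarrow> distribution u \<and> compact (dsupport u)"

text \<open>Pairing of a compactly supported distribution with a smooth function:
  <w, psi> = <w, chi psi> for a test function chi equal to 1 near supp w.\<close>
definition ext_pair :: "(('a::euclidean_space \<Rightarrow> complex) \<Rightarrow> complex) \<Rightarrow> ('a \<Rightarrow> complex) \<Rightarrow> complex" where
  "ext_pair w \<psi> = (let cf = (SOME cf. test_fun cf \<and>
        (\<exists>U. open U \<and> dsupport w \<subseteq> U \<and> (\<forall>x\<in>U. cf x = 1)))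
      in w (\<lambda>x. cf x * \<psi> x))"

definition open_conic_nbhd :: "'a::real_normed_vector set \<Rightarrow> 'a \<Rightarrow> bool" where
  "open_conic_nbhd \<Gamma> \<xi> \<longleftrightarrow> open \<Gamma> \<and> \<xi> \<in> \<Gamma> \<and> (\<forall>\<eta>\<in>\<Gamma>. \<forall>t>0. t *\<^sub>R \<eta> \<in> \<Gamma>)"

definition loc_fourier :: "(('a::euclidean_space \<Rightarrow> complex) \<Rightarrow> complex) \<Rightarrow> ('a \<Rightarrow> complex) \<Rightarrow> 'a \<Rightarrow> complex" where
  "loc_fourier u \<phi> \<xi> = u (\<lambda>x. \<phi> x * exp (- \<i> * complex_of_real (x \<bullet> \<xi>)))"

definition wavefront :: "(('a::euclidean_space \<Rightarrow> complex) \<Rightarrow> complex) \<Rightarrow> ('a \<times> 'a) set" where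
  "wavefront u = {(x, \<xi>). \<xi> \<noteq> 0 \<and> \<not> (\<exists>\<phi>. test_fun \<phi> \<and> \<phi> x \<noteq> 0 \<and>
      (\<exists>\<Gamma>. open_conic_nbhd \<Gamma> \<xi> \<and>
        (\<forall>N::nat. \<exists>C. \<forall>\<eta>\<in>\<Gamma>. norm (loc_fourier u \<phi> \<eta>) \<le> C * (1 + norm \<eta>) powr (- real N))))}"

definition xray :: "'a::euclidean_space \<Rightarrow> ('a \<Rightarrow> complex) \<Rightarrow> 'a \<Rightarrow> complex" where
  "xray v \<phi> u = integral UNIV (\<lambda>s. \<phi> (u + s *\<^sub>R v))"

text \<open>I_v phi at u + t v (u orthogonal to unit v, t real), with cutoff psi0.\<close>
definition dir_antideriv_fun :: "'a::euclidean_space \<Rightarrow> (real \<Rightarrow> real) \<Rightarrow> ('a \<Rightarrow> complex) \<Rightarrow> 'a \<Rightarrow> complex" where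
  "dir_antideriv_fun v \<psi>0 \<phi> x =
     (let t = x \<bullet> v; u = x - t *\<^sub>R v in
       integral {..t} (\<lambda>s. \<phi> (u + s *\<^sub>R v) - xray v \<phi> u * complex_of_real (\<psi>0 s)))"

definition admissible_cutoff :: "'a::euclidean_space \<Rightarrow> (('a \<Rightarrow> complex) \<Rightarrow> complex) \<Rightarrow> (real \<Rightarrow> real) \<Rightarrow> bool" where
  "admissible_cutoff v w \<psi>0 \<longleftrightarrow> smooth \<psi>0 \<and> compact (tsupport \<psi>0) \<and>
     integral UNIV \<psi>0 = 1 \<and>
     (\<forall>s\<in>tsupport \<psi>0. \<forall>x\<in>dsupport w. s < x \<bullet> v)"

definition dir_antideriv :: "'a::euclidean_space \<Rightarrow> (('a \<Rightarrow> complex) \<Rightarrow> complex) \<Rightarrow> ('a \<Rightarrow> complex) \<Rightarrow> complex" where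
  "dir_antideriv v w = (\<lambda>\<phi>. - ext_pair w (dir_antideriv_fun v (SOME \<psi>0. admissible_cutoff v w \<psi>0) \<phi>))"

end

theory Submission
  imports Defs
begin

text \<open>
  Let \<open>\<phi>\<close> be a test function and \<open>e\<^sub>\<eta>(x) = exp(-i x\<cdot>\<eta>)\<close>. To the right of the cutoff the antiderivative
  of \<open>\<phi> e\<^sub>\<eta>\<close> is minus its integral along the forward ray, so the localised Fourier transform of the
  directional antiderivative of \<open>w\<close> is \<open>\<langle>w, h\<^sub>\<eta> e\<^sub>\<eta>\<rangle>\<close> with \<open>h\<^sub>\<eta>(x) = \<integral> \<phi>(x + s v) exp(-i s v\<cdot>\<eta>) ds\<close> over
  \<open>s \<ge> 0\<close>, times a fixed cutoff. The functions \<open>h\<^sub>\<eta>\<close> have derivatives of every order bounded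
  uniformly in \<open>\<eta>\<close>. Hence it suffices that \<open>\<langle>w, h e\<^sub>\<eta>\<rangle>\<close> decays rapidly in a conic neighbourhood
  of \<open>\<eta>0\<close>, uniformly over bounded families of test functions \<open>h\<close>. A partition of unity reduces this
  to \<open>\<langle>w, \<phi>\<^sub>j h e\<^sub>\<eta>\<rangle>\<close> with \<open>\<phi>\<^sub>j\<close> from the hypothesis on \<open>w\<close>; expanding \<open>h\<close> into a Fourier series
  turns it into a rapidly convergent sum of translates of the Fourier transform of \<open>\<phi>\<^sub>j w\<close>.
\<close>

section \<open>Partial derivatives and smooth functions\<close>

text \<open>Multiplication by \<open>h\<close> shifts frequencies: the Fourier transform of
  \<open>\<phi>_j w\<close> gets evaluated at \<open>\<eta> - \<kappa>\<close>, which may lie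
  outside the cone where decay is known. One weight \<open>W\<close>, built from the distance to the
  complement of the cone, handles all shifts. Outside the cone it is the polynomial growth allowed
  by finite order; on a smaller cone it decays to any prescribed order; a shift by
  \<open>\<kappa>\<close> costs at most a power of \<open>1 + norm \<kappa>\<close>, and the decay
  of the Fourier coefficients pays for that power. The expansion treats one coordinate at a time, so
  one-dimensional series suffice. Since \<open>w\<close> is controlled by finitely many derivatives
  on a compact set, truncated series must converge together with these derivatives, and remainders
  are estimated accordingly. The bounds on \<open>h_\<eta>\<close> are uniform because the
  oscillating factor depends on \<open>s\<close> but not on \<open>x\<close>. The forward ray arises
  because the cutoff in the antiderivative has mass one to the left of the support of
  \<open>w\<close>: the full line integral is subtracted from the backward one.\<close>

definition dpart :: "'a::euclidean_space \<Rightarrow> ('a \<Rightarrow> 'b::real_normed_vector) \<Rightarrow> 'a \<Rightarrow> 'b" where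
  "dpart b f = (\<lambda>x. frechet_derivative f (at x) b)"

lemma dpart_eqI: "(f has_derivative f') (at x) \<Longrightarrow> dpart b f x = f' b"
  by (simp add: dpart_def frechet_derivative_at[symmetric])

lemma pderivs_Cons[simp]: "pderivs (b # bs) f = dpart b (pderivs bs f)"
  by (simp add: dpart_def)

declare pderivs.simps(2)[simp del]

lemma pderivs_append: "pderivs (as @ bs) f = pderivs as (pderivs bs f)"
  by (induction as) auto

text \<open>\<open>smooth\<close> quantifies over all lists of directions at once; a numerical order
  gives something to induct on.\<close>

definition smooth_upto :: "nat \<Rightarrow> ('a::euclidean_space \<Rightarrow> 'b::real_normed_vector) \<Rightarrow> bool" where
  "smooth_upto n f \<longleftrightarrow>
     (\<forall>bs. set bs \<subseteq> Basis \<longrightarrow> length bs < n \<longrightarrow> (\<forall>x. pderivs bs f differentiable (at x)))"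

lemma smooth_iff_upto: "smooth f \<longleftrightarrow> (\<forall>n. smooth_upto n f)"
  unfolding smooth_def smooth_upto_def by blast

lemma smooth_upto_0[simp]: "smooth_upto 0 f"
  by (simp add: smooth_upto_def)

text \<open>\<open>pderivs\<close> adds derivatives on the outside, whereas the closure proofs
  differentiate the given function first. Splitting a list at its last element exchanges the two
  recursions; each closure property then follows by induction on \<open>n\<close> from the formula
  for a single derivative.\<close>

lemma smooth_upto_Suc:
  "smooth_upto (Suc n) f \<longleftrightarrow> (\<forall>x. f differentiable (at x)) \<and> (\<forall>b\<in>Basis. smooth_upto n (dpart b f))"
proof safe
  fix x assume "smooth_upto (Suc n) f"
  then show "f differentiable (at x)"
    unfolding smooth_upto_def by (auto dest: spec[of _ "[]"])
next
  fix b :: 'a assume *: "smooth_upto (Suc n) f" "b \<in> Basis"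
  show "smooth_upto n (dpart b f)"
    unfolding smooth_upto_def
  proof (intro allI impI)
    fix bs :: "'a list" and x assume "set bs \<subseteq> Basis" "length bs < n"
    then have "pderivs (bs @ [b]) f differentiable (at x)"
      using * unfolding smooth_upto_def by auto
    then show "pderivs bs (dpart b f) differentiable (at x)"
      by (simp add: pderivs_append)
  qed
next
  assume *: "\<forall>x. f differentiable (at x)" "\<forall>b\<in>Basis. smooth_upto n (dpart b f)"
  show "smooth_upto (Suc n) f"
    unfolding smooth_upto_def
  proof (intro allI impI)
    fix bs :: "'a list" and x assume bs: "set bs \<subseteq> Basis" "length bs < Suc n"
    show "pderivs bs f differentiable (at x)"
    proof (cases bs rule: rev_cases)
      case Nil
      then show ?thesis using * by simp
    next
      case (snoc cs c)
      then have "pderivs cs (dpart c f) differentiable (at x)"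
        using bs * unfolding smooth_upto_def by auto
      then show ?thesis by (simp add: snoc pderivs_append)
    qed
  qed
qed

lemma smooth_upto_SucD: "smooth_upto (Suc n) f \<Longrightarrow> smooth_upto n f"
  by (simp add: smooth_upto_def)

lemma smooth_upto_SucI:
  assumes "\<And>x. f differentiable (at x)" "\<And>b. b \<in> Basis \<Longrightarrow> smooth_upto n (dpart b f)"
  shows "smooth_upto (Suc n) f"
  using assms by (simp add: smooth_upto_Suc)

lemma smooth_differentiable: "smooth f \<Longrightarrow> f differentiable (at x)"
  unfolding smooth_def by (auto dest: spec[of _ "[]"])

lemma smooth_has_derivative: "smooth f \<Longrightarrow> (f has_derivative (\<lambda>h. dpart h f x)) (at x)"
  using smooth_differentiable frechet_derivative_works unfolding dpart_def by fastforce

lemma smooth_continuous_on: "smooth f \<Longrightarrow> continuous_on A f"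
  by (meson smooth_differentiable continuous_at_imp_continuous_on differentiable_imp_continuous_within)

lemma smooth_dpart: "smooth f \<Longrightarrow> b \<in> Basis \<Longrightarrow> smooth (dpart b f)"
  unfolding smooth_iff_upto using smooth_upto_Suc by blast

lemma smooth_pderivs: "smooth f \<Longrightarrow> set bs \<subseteq> Basis \<Longrightarrow> smooth (pderivs bs f)"
  by (induction bs) (auto simp: smooth_dpart)

lemma dpart_const[simp]: "dpart b (\<lambda>x. c) = (\<lambda>x. 0)"
  by (rule ext) (rule dpart_eqI, rule has_derivative_const)

lemma dpart_add:
  assumes "f differentiable (at x)" "g differentiable (at x)"
  shows "dpart b (\<lambda>x. f x + g x) x = dpart b f x + dpart b g x"
  using has_derivative_add[OF assms[unfolded frechet_derivative_works]]
  by (subst dpart_eqI) (auto simp: dpart_def)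

lemma dpart_mult:
  fixes f g :: "'a::euclidean_space \<Rightarrow> 'b::real_normed_field"
  assumes "f differentiable (at x)" "g differentiable (at x)"
  shows "dpart b (\<lambda>x. f x * g x) x = f x * dpart b g x + dpart b f x * g x"
  using has_derivative_mult[OF assms[unfolded frechet_derivative_works]]
  by (subst dpart_eqI) (auto simp: dpart_def)

lemma dpart_linear:
  assumes "bounded_linear T" "f differentiable (at x)"
  shows "dpart b (\<lambda>x. T (f x)) x = T (dpart b f x)"
  using bounded_linear.has_derivative[OF assms(1) assms(2)[unfolded frechet_derivative_works]]
  by (subst dpart_eqI) (auto simp: dpart_def)

lemma smooth_upto_const[simp]: "smooth_upto n (\<lambda>x. c)"
  by (induction n arbitrary: c) (auto intro!: smooth_upto_SucI)

lemma smooth_upto_add: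
  "smooth_upto n f \<Longrightarrow> smooth_upto n g \<Longrightarrow> smooth_upto n (\<lambda>x. f x + g x)"
proof (induction n arbitrary: f g)
  case (Suc n)
  then have d: "\<And>x. f differentiable (at x)" "\<And>x. g differentiable (at x)"
    by (auto simp: smooth_upto_Suc)
  then have "dpart b (\<lambda>x. f x + g x) = (\<lambda>x. dpart b f x + dpart b g x)" for b
    by (auto simp: dpart_add)
  then show ?case
    using Suc d by (intro smooth_upto_SucI) (auto simp: smooth_upto_Suc)
qed simp

lemma smooth_upto_mult:
  fixes f g :: "'a::euclidean_space \<Rightarrow> 'b::real_normed_field"
  shows "smooth_upto n f \<Longrightarrow> smooth_upto n g \<Longrightarrow> smooth_upto n (\<lambda>x. f x * g x)"
proof (induction n arbitrary: f g)
  case (Suc n)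
  then have d: "\<And>x. f differentiable (at x)" "\<And>x. g differentiable (at x)"
    by (auto simp: smooth_upto_Suc)
  then have "dpart b (\<lambda>x. f x * g x) = (\<lambda>x. f x * dpart b g x + dpart b f x * g x)" for b
    by (auto simp: dpart_mult)
  then show ?case
    using Suc d smooth_upto_SucD[OF Suc.prems(1)] smooth_upto_SucD[OF Suc.prems(2)]
    by (intro smooth_upto_SucI) (auto simp: smooth_upto_Suc intro!: smooth_upto_add)
qed simp

lemma smooth_upto_linear:
  "bounded_linear T \<Longrightarrow> smooth_upto n f \<Longrightarrow> smooth_upto n (\<lambda>x. T (f x))"
proof (induction n arbitrary: f)
  case (Suc n)
  then have d: "\<And>x. f differentiable (at x)" by (auto simp: smooth_upto_Suc)
  then have "dpart b (\<lambda>x. T (f x)) = (\<lambda>x. T (dpart b f x))" for b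
    using Suc by (auto simp: dpart_linear)
  moreover have "(\<lambda>x. T (f x)) differentiable (at x)" for x
    using bounded_linear.has_derivative[OF Suc.prems(1) d[unfolded frechet_derivative_works, of x]]
    unfolding differentiable_def by blast
  ultimately show ?case
    using Suc by (intro smooth_upto_SucI) (auto simp: smooth_upto_Suc)
qed simp

lemma smooth_upto_inverse:
  fixes f :: "'a::euclidean_space \<Rightarrow> 'b::real_normed_field"
  assumes "\<And>x. f x \<noteq> 0"
  shows "smooth_upto n f \<Longrightarrow> smooth_upto n (\<lambda>x. inverse (f x))"
proof (induction n)
  case (Suc n)
  then have d: "(f has_derivative frechet_derivative f (at x)) (at x)" for x
    by (auto simp: smooth_upto_Suc frechet_derivative_works)
  have d': "((\<lambda>x. inverse (f x)) has_derivative
      (\<lambda>h. - (inverse (f x) * frechet_derivative f (at x) h * inverse (f x)))) (at x)" for x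
    by (rule Deriv.has_derivative_inverse[OF assms d])
  have "dpart b (\<lambda>x. inverse (f x)) = (\<lambda>x. (inverse (f x) * dpart b f x) * ((-1) * inverse (f x)))" for b
    by (rule ext, subst dpart_eqI[OF d']) (simp add: dpart_def)
  moreover have "(\<lambda>x. inverse (f x)) differentiable (at x)" for x
    using d' unfolding differentiable_def by blast
  ultimately show ?case
    using Suc smooth_upto_SucD[OF Suc.prems]
    by (intro smooth_upto_SucI) (auto simp: smooth_upto_Suc intro!: smooth_upto_mult
        smooth_upto_linear[OF bounded_linear_minus[OF bounded_linear_ident]])
qed simp

lemma smooth_const[simp]: "smooth (\<lambda>x. c)"
  by (simp add: smooth_iff_upto)

lemma smooth_add: "smooth f \<Longrightarrow> smooth g \<Longrightarrow> smooth (\<lambda>x. f x + g x)"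
  by (simp add: smooth_iff_upto smooth_upto_add)

lemma smooth_mult:
  fixes f g :: "'a::euclidean_space \<Rightarrow> 'b::real_normed_field"
  shows "smooth f \<Longrightarrow> smooth g \<Longrightarrow> smooth (\<lambda>x. f x * g x)"
  by (simp add: smooth_iff_upto smooth_upto_mult)

lemma smooth_linear: "bounded_linear T \<Longrightarrow> smooth f \<Longrightarrow> smooth (\<lambda>x. T (f x))"
  by (simp add: smooth_iff_upto smooth_upto_linear)

lemma smooth_inverse:
  fixes f :: "'a::euclidean_space \<Rightarrow> 'b::real_normed_field"
  shows "smooth f \<Longrightarrow> (\<And>x. f x \<noteq> 0) \<Longrightarrow> smooth (\<lambda>x. inverse (f x))"
  by (simp add: smooth_iff_upto smooth_upto_inverse)

lemma smooth_minus: "smooth f \<Longrightarrow> smooth (\<lambda>x. - f x)"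
  by (rule smooth_linear) (simp add: bounded_linear_minus[OF bounded_linear_ident])

lemma smooth_diff: "smooth f \<Longrightarrow> smooth g \<Longrightarrow> smooth (\<lambda>x. f x - g x)"
  using smooth_add[OF _ smooth_minus, of f g] by simp

lemma smooth_sum: "(\<And>i. i \<in> I \<Longrightarrow> smooth (f i)) \<Longrightarrow> smooth (\<lambda>x. \<Sum>i\<in>I. f i x)"
  by (induction I rule: infinite_finite_induct) (auto intro!: smooth_add)

lemma smooth_bounded_linear:
  assumes "bounded_linear T" shows "smooth T"
proof -
  have T: "(T has_derivative T) (at x)" for x
    by (rule bounded_linear_imp_has_derivative[OF assms])
  then have "dpart b T = (\<lambda>x. T b)" for b
    by (intro ext dpart_eqI)
  moreover have "T differentiable (at x)" for x
    using T unfolding differentiable_def by blast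
  ultimately have "smooth_upto (Suc n) T" for n
    by (intro smooth_upto_SucI) auto
  then show ?thesis
    unfolding smooth_iff_upto using smooth_upto_SucD by blast
qed

text \<open>By the chain rule the derivative is \<open>dpart b q\<close> times the ordinary
  derivative \<open>dpart 1 F\<close> at \<open>q x\<close>, so the induction moves from
  \<open>F\<close> to its derivative and keeps \<open>q\<close> fixed.\<close>

lemma smooth_upto_compose:
  fixes F :: "real \<Rightarrow> 'b::real_normed_field" and q :: "'a::euclidean_space \<Rightarrow> real"
  shows "smooth_upto n F \<Longrightarrow> smooth_upto n q \<Longrightarrow> smooth_upto n (\<lambda>x. F (q x))"
proof (induction n arbitrary: F)
  case (Suc n)
  have F: "(F has_derivative frechet_derivative F (at x)) (at x)" for x
    using Suc.prems by (auto simp: smooth_upto_Suc frechet_derivative_works)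
  have q: "(q has_derivative frechet_derivative q (at x)) (at x)" for x
    using Suc.prems by (auto simp: smooth_upto_Suc frechet_derivative_works)
  have Fq: "((\<lambda>x. F (q x)) has_derivative (\<lambda>h. frechet_derivative F (at (q x)) (frechet_derivative q (at x) h))) (at x)" for x
    using has_derivative_compose[OF q F] by simp
  have lin: "frechet_derivative F (at y) c = of_real c * dpart 1 F y" for y c
    using linear_scale[OF has_derivative_linear[OF F[of y]], of c 1]
    by (simp add: dpart_def scaleR_conv_of_real)
  have "dpart b (\<lambda>x. F (q x)) = (\<lambda>x. of_real (dpart b q x) * dpart 1 F (q x))" for b
    by (rule ext, subst dpart_eqI[OF Fq]) (auto simp: lin dpart_def[of b])
  moreover have "(\<lambda>x. F (q x)) differentiable (at x)" for x
    using Fq unfolding differentiable_def by blast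
  ultimately show ?case
    using Suc smooth_upto_SucD[OF Suc.prems(2)]
    by (intro smooth_upto_SucI)
      (auto simp: smooth_upto_Suc intro!: smooth_upto_mult smooth_upto_linear[OF bounded_linear_of_real])
qed simp

lemma smooth_compose:
  fixes F :: "real \<Rightarrow> 'b::real_normed_field" and q :: "'a::euclidean_space \<Rightarrow> real"
  shows "smooth F \<Longrightarrow> smooth q \<Longrightarrow> smooth (\<lambda>x. F (q x))"
  by (simp add: smooth_iff_upto smooth_upto_compose)

lemma smooth_dpart_add:
  "smooth f \<Longrightarrow> smooth g \<Longrightarrow> dpart b (\<lambda>x. f x + g x) = (\<lambda>x. dpart b f x + dpart b g x)"
  by (auto simp: dpart_add smooth_differentiable)

lemma pderivs_add:
  "smooth f \<Longrightarrow> smooth g \<Longrightarrow> set bs \<subseteq> Basis \<Longrightarrow>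
    pderivs bs (\<lambda>x. f x + g x) = (\<lambda>x. pderivs bs f x + pderivs bs g x)"
  by (induction bs) (auto simp: smooth_dpart_add smooth_pderivs)

lemma pderivs_linear:
  assumes "bounded_linear T" "smooth f" "set bs \<subseteq> Basis"
  shows "pderivs bs (\<lambda>x. T (f x)) = (\<lambda>x. T (pderivs bs f x))"
  using assms(3)
proof (induction bs)
  case (Cons b bs)
  then show ?case
    using assms(1,2) by (auto simp: dpart_linear smooth_differentiable smooth_pderivs)
qed simp

lemma pderivs_zero[simp]: "pderivs bs (\<lambda>x. 0) = (\<lambda>x. 0)"
  by (induction bs) auto

lemma pderivs_sum:
  "(\<And>i. i \<in> I \<Longrightarrow> smooth (f i)) \<Longrightarrow> set bs \<subseteq> Basis \<Longrightarrow>
    pderivs bs (\<lambda>x. \<Sum>i\<in>I. f i x) = (\<lambda>x. \<Sum>i\<in>I. pderivs bs (f i) x)"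
  by (induction I rule: infinite_finite_induct) (auto simp: pderivs_add smooth_sum)

lemma pderivs_diff:
  assumes "smooth f" "smooth g" "set bs \<subseteq> Basis"
  shows "pderivs bs (\<lambda>x. f x - g x) = (\<lambda>x. pderivs bs f x - pderivs bs g x)"
  using pderivs_add[OF assms(1) smooth_minus[OF assms(2)] assms(3)]
    pderivs_linear[OF bounded_linear_minus[OF bounded_linear_ident] assms(2,3)]
  by simp

lemma pderivs_vanish:
  assumes "open U" "\<And>x. x \<in> U \<Longrightarrow> f x = 0" "x \<in> U"
  shows "pderivs bs f x = 0"
  using assms(3)
proof (induction bs arbitrary: x)
  case Nil
  then show ?case using assms by simp
next
  case (Cons b bs)
  have "((\<lambda>x. 0) has_derivative (\<lambda>h. 0)) (at x)" by simp
  then have "(pderivs bs f has_derivative (\<lambda>h. 0)) (at x)"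
    by (rule has_derivative_transform_within_open[OF _ assms(1) Cons.prems]) (simp add: Cons.IH)
  then show ?case by (simp add: dpart_eqI)
qed

section \<open>Uniform bounds on all derivatives up to a given order\<close>

definition deriv_bound :: "'a set \<Rightarrow> nat \<Rightarrow> ('a::euclidean_space \<Rightarrow> 'b::real_normed_vector) \<Rightarrow> real \<Rightarrow> bool" where
  "deriv_bound X n f A \<longleftrightarrow>
     (\<forall>bs. set bs \<subseteq> Basis \<longrightarrow> length bs \<le> n \<longrightarrow> (\<forall>x\<in>X. norm (pderivs bs f x) \<le> A))"

lemma deriv_boundD:
  "deriv_bound X n f A \<Longrightarrow> set bs \<subseteq> Basis \<Longrightarrow> length bs \<le> n \<Longrightarrow> x \<in> X \<Longrightarrow> norm (pderivs bs f x) \<le> A"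
  by (simp add: deriv_bound_def)

lemma deriv_bound_0: "deriv_bound X 0 f A \<longleftrightarrow> (\<forall>x\<in>X. norm (f x) \<le> A)"
  by (auto simp: deriv_bound_def)

lemma deriv_bound_Suc:
  "deriv_bound X (Suc n) f A \<longleftrightarrow> (\<forall>x\<in>X. norm (f x) \<le> A) \<and> (\<forall>b\<in>Basis. deriv_bound X n (dpart b f) A)"
proof safe
  fix x assume "deriv_bound X (Suc n) f A" "x \<in> X"
  then show "norm (f x) \<le> A"
    using deriv_boundD[of X "Suc n" f A "[]"] by auto
next
  fix b :: 'a assume *: "deriv_bound X (Suc n) f A" "b \<in> Basis"
  show "deriv_bound X n (dpart b f) A"
    unfolding deriv_bound_def
  proof (intro allI impI ballI)
    fix bs :: "'a list" and x assume "set bs \<subseteq> Basis" "length bs \<le> n" "x \<in> X"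
    then show "norm (pderivs bs (dpart b f) x) \<le> A"
      using deriv_boundD[OF *(1), of "bs @ [b]" x] *(2) by (auto simp: pderivs_append)
  qed
next
  assume *: "\<forall>x\<in>X. norm (f x) \<le> A" "\<forall>b\<in>Basis. deriv_bound X n (dpart b f) A"
  show "deriv_bound X (Suc n) f A"
    unfolding deriv_bound_def
  proof (intro allI impI ballI)
    fix bs :: "'a list" and x assume bs: "set bs \<subseteq> Basis" "length bs \<le> Suc n" "x \<in> X"
    show "norm (pderivs bs f x) \<le> A"
    proof (cases bs rule: rev_cases)
      case Nil
      then show ?thesis using * bs by simp
    next
      case (snoc cs c)
      then have "deriv_bound X n (dpart c f) A" using bs * by auto
      from deriv_boundD[OF this, of cs x] show ?thesis
        using bs by (simp add: snoc pderivs_append)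
    qed
  qed
qed

lemma deriv_bound_mono:
  "deriv_bound X n f A \<Longrightarrow> Y \<subseteq> X \<Longrightarrow> m \<le> n \<Longrightarrow> A \<le> B \<Longrightarrow> deriv_bound Y m f B"
  unfolding deriv_bound_def by (meson order_trans subsetD)

lemma deriv_bound_add:
  assumes "smooth f" "smooth g" "deriv_bound X n f A" "deriv_bound X n g B"
  shows "deriv_bound X n (\<lambda>x. f x + g x) (A + B)"
  unfolding deriv_bound_def
proof (intro allI impI ballI)
  fix bs :: "'a list" and x assume "set bs \<subseteq> Basis" "length bs \<le> n" "x \<in> X"
  then show "norm (pderivs bs (\<lambda>x. f x + g x) x) \<le> A + B"
    using assms by (auto simp: pderivs_add intro!: norm_triangle_mono deriv_boundD)
qed

lemma deriv_bound_cmult: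
  fixes f :: "'a::euclidean_space \<Rightarrow> complex"
  assumes "smooth f" "deriv_bound X n f A"
  shows "deriv_bound X n (\<lambda>x. c * f x) (norm c * A)"
  unfolding deriv_bound_def
proof (intro allI impI ballI)
  fix bs :: "'a list" and x assume "set bs \<subseteq> Basis" "length bs \<le> n" "x \<in> X"
  then show "norm (pderivs bs (\<lambda>x. c * f x) x) \<le> norm c * A"
    using assms pderivs_linear[OF bounded_linear_mult_right[of c] assms(1), of bs]
    by (auto simp: norm_mult intro!: mult_left_mono deriv_boundD)
qed

text \<open>Each use of the product rule doubles the number of terms, whence the factor
  \<open>2 ^ n\<close>.\<close>

lemma deriv_bound_mult:
  fixes f g :: "'a::euclidean_space \<Rightarrow> complex"
  assumes "smooth f" "smooth g" "deriv_bound X n f A" "deriv_bound X n g B" "0 \<le> A" "0 \<le> B"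
  shows "deriv_bound X n (\<lambda>x. f x * g x) (2 ^ n * A * B)"
  using assms(1-4)
proof (induction n arbitrary: f g)
  case 0
  then show ?case
    using assms(5,6) by (auto simp: deriv_bound_0 norm_mult intro!: mult_mono)
next
  case (Suc n)
  have "norm (f x * g x) \<le> 2 ^ Suc n * A * B" if "x \<in> X" for x
  proof -
    have "norm (f x * g x) \<le> 1 * (A * B)"
      using Suc.prems that assms(5,6) by (auto simp: deriv_bound_Suc norm_mult intro!: mult_mono)
    also have "\<dots> \<le> 2 ^ Suc n * (A * B)"
      by (rule mult_right_mono) (use assms(5,6) in \<open>auto intro: one_le_power[of 2 "Suc n", simplified]\<close>)
    finally show ?thesis by (simp add: mult.assoc)
  qed
  moreover have "deriv_bound X n (dpart b (\<lambda>x. f x * g x)) (2 ^ Suc n * A * B)" if b: "b \<in> Basis" for b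
  proof -
    have eq: "dpart b (\<lambda>x. f x * g x) = (\<lambda>x. f x * dpart b g x + dpart b f x * g x)"
      using Suc.prems by (auto simp: dpart_mult smooth_differentiable)
    have "deriv_bound X n f A" "deriv_bound X n g B"
      using Suc.prems deriv_bound_mono by (blast intro: le_SucI)+
    then have "deriv_bound X n (\<lambda>x. f x * dpart b g x + dpart b f x * g x) (2 ^ n * A * B + 2 ^ n * A * B)"
      using Suc b by (intro deriv_bound_add Suc.IH smooth_mult) (auto simp: deriv_bound_Suc smooth_dpart)
    moreover have "2 ^ n * A * B + 2 ^ n * A * B = 2 ^ Suc n * A * B" by simp
    ultimately show ?thesis by (simp only: eq)
  qed
  ultimately show ?case by (simp add: deriv_bound_Suc)
qed

lemma smooth_upto_exp: "smooth_upto n (\<lambda>x::'a::euclidean_space. exp (c * complex_of_real (x \<bullet> \<eta>)))"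
  and dpart_exp: "dpart b (\<lambda>x::'a. exp (c * complex_of_real (x \<bullet> \<eta>))) =
    (\<lambda>x. c * complex_of_real (b \<bullet> \<eta>) * exp (c * complex_of_real (x \<bullet> \<eta>)))"
proof -
  have d: "((\<lambda>x::'a. exp (c * complex_of_real (x \<bullet> \<eta>))) has_derivative
      (\<lambda>h. c * complex_of_real (h \<bullet> \<eta>) * exp (c * complex_of_real (x \<bullet> \<eta>)))) (at x)" for x
  proof -
    have "((\<lambda>x::'a. c * complex_of_real (x \<bullet> \<eta>)) has_derivative (\<lambda>h. c * complex_of_real (h \<bullet> \<eta>))) (at x)"
      by (auto intro!: derivative_eq_intros)
    from has_derivative_compose[OF this DERIV_exp[THEN has_field_derivative_imp_has_derivative]]
    show ?thesis by (simp add: mult.commute)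
  qed
  show eq: "dpart b (\<lambda>x::'a. exp (c * complex_of_real (x \<bullet> \<eta>))) =
    (\<lambda>x. c * complex_of_real (b \<bullet> \<eta>) * exp (c * complex_of_real (x \<bullet> \<eta>)))" for b
    by (rule ext) (rule dpart_eqI[OF d])
  show "smooth_upto n (\<lambda>x::'a. exp (c * complex_of_real (x \<bullet> \<eta>)))"
  proof (induction n)
    case (Suc n)
    then show ?case
      using d by (intro smooth_upto_SucI) (auto simp: eq differentiable_def intro!: smooth_upto_mult)
  qed simp
qed

lemma smooth_exp[simp]: "smooth (\<lambda>x. exp (c * complex_of_real (x \<bullet> \<eta>)))"
  by (simp add: smooth_iff_upto smooth_upto_exp)

text \<open>Every derivative brings down one factor \<open>c * (b \<bullet> \<eta>)\<close> of
  modulus at most \<open>norm \<eta>\<close>, and for imaginary \<open>c\<close> the exponential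
  itself has modulus one.\<close>

lemma deriv_bound_exp:
  fixes \<eta> :: "'a::euclidean_space"
  assumes "norm c = 1" "Re c = 0"
  shows "deriv_bound UNIV n (\<lambda>x. exp (c * complex_of_real (x \<bullet> \<eta>))) ((1 + norm \<eta>) ^ n)"
proof (induction n)
  case 0
  then show ?case using assms by (simp add: deriv_bound_0)
next
  case (Suc n)
  have "deriv_bound UNIV n (dpart b (\<lambda>x. exp (c * complex_of_real (x \<bullet> \<eta>)))) ((1 + norm \<eta>) ^ Suc n)"
    if "b \<in> Basis" for b
  proof -
    have "\<bar>b \<bullet> \<eta>\<bar> \<le> 1 + norm \<eta>"
      using Cauchy_Schwarz_ineq2[of b \<eta>] that by simp
    then have "norm (c * complex_of_real (b \<bullet> \<eta>)) * (1 + norm \<eta>) ^ n \<le> (1 + norm \<eta>) ^ Suc n"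
      by (simp add: norm_mult assms mult_right_mono)
    with deriv_bound_cmult[OF smooth_exp Suc, of "c * complex_of_real (b \<bullet> \<eta>)"]
    show ?thesis
      unfolding dpart_exp by (blast intro: deriv_bound_mono)
  qed
  then show ?case
    using assms by (auto simp: deriv_bound_Suc intro: one_le_power[of "1 + norm \<eta>" "Suc n", simplified])
qed

section \<open>Test functions and distributions\<close>

text \<open>The denominator \<open>x ^ m\<close> makes the family closed under differentiation up to
  linear combinations, so that smoothness of the classical flat function at 0 is one induction for
  all \<open>m\<close> simultaneously.\<close>

definition flat :: "nat \<Rightarrow> real \<Rightarrow> real" where
  "flat m x = (if x > 0 then exp (- (1 / x)) / x ^ m else 0)"

lemma flat_pos: "x > 0 \<Longrightarrow> flat m x > 0"
  and flat_0: "x \<le> 0 \<Longrightarrow> flat m x = 0"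
  by (auto simp: flat_def)

lemma flat_nonneg: "flat m x \<ge> 0"
  by (auto simp: flat_def)

text \<open>A quadratic bound forces the difference quotient at 0 to tend to 0. It comes from
  \<open>(1 + y / n) ^ n \<le> exp y\<close> at \<open>y = 1 / x\<close> with
  \<open>n = m + 2\<close>: \<open>m\<close> powers of \<open>x\<close> cancel the denominator and
  two remain.\<close>

lemma flat_le: "\<bar>flat m x\<bar> \<le> real (m + 2) ^ (m + 2) * x\<^sup>2"
proof (cases "x > 0")
  case True
  define n where "n = m + 2"
  have n: "n > 0" by (simp add: n_def)
  have "(1 / x / real n) ^ n \<le> (1 + 1 / x / real n) ^ n"
    using True n by (intro power_mono) auto
  also have "\<dots> \<le> exp (1 / x)"
    using True n by (intro exp_ge_one_plus_x_over_n_power_n) (auto intro: order_trans[of _ 0])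
  finally have "exp (- (1 / x)) \<le> (real n * x) ^ n"
    using True n by (simp add: exp_minus field_simps)
  then have "flat m x \<le> (real n * x) ^ n / x ^ m"
    using True by (simp add: flat_def divide_right_mono)
  also have "\<dots> = real n ^ n * x\<^sup>2"
    using True by (simp add: n_def power_mult_distrib power_add power2_eq_square)
  finally show ?thesis
    using flat_nonneg[of m x] by (simp add: n_def)
qed (simp add: flat_def)

lemma flat_has_derivative:
  "(flat m has_real_derivative (flat (m + 2) x - real m * flat (m + 1) x)) (at x)"
proof -
  consider "x > 0" | "x < 0" | "x = 0" by linarith
  then show ?thesis
  proof cases
    case 1
    have "((\<lambda>x. exp (- (1 / x)) / x ^ m) has_real_derivative
        (flat (m + 2) x - real m * flat (m + 1) x)) (at x)"
    proof (cases m)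
      case (Suc k)
      have "k = 0 \<or> x ^ k = x * x ^ (k - Suc 0)"
        by (cases k) auto
      then show ?thesis
        using 1 Suc by (auto intro!: derivative_eq_intros simp: flat_def field_simps power2_eq_square)
    qed (use 1 in \<open>auto intro!: derivative_eq_intros simp: flat_def field_simps power2_eq_square\<close>)
    then show ?thesis
      by (rule has_field_derivative_transform_within_open[of _ _ _ "{0<..}"]) (use 1 in \<open>auto simp: flat_def\<close>)
  next
    case 2
    have "((\<lambda>x. 0) has_real_derivative (flat (m + 2) x - real m * flat (m + 1) x)) (at x)"
      using 2 by (simp add: flat_def)
    then show ?thesis
      by (rule has_field_derivative_transform_within_open[of _ _ _ "{..<0}"]) (use 2 in \<open>auto simp: flat_def\<close>)
  next
    case 3
    define C where "C = real (m + 2) ^ (m + 2)"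
    have "((\<lambda>h. flat m h / h) \<longlongrightarrow> 0) (at 0)"
    proof (rule Lim_null_comparison)
      have "norm (flat m h / h) \<le> C * \<bar>h\<bar>" for h
      proof (cases "h = 0")
        case False
        have "\<bar>flat m h\<bar> \<le> C * \<bar>h\<bar> * \<bar>h\<bar>"
          using flat_le[of m h] by (simp add: C_def power2_eq_square)
        then show ?thesis using False by (simp add: divide_le_eq)
      qed simp
      then show "eventually (\<lambda>h. norm (flat m h / h) \<le> C * \<bar>h\<bar>) (at 0)" by simp
      show "((\<lambda>h. C * \<bar>h\<bar>) \<longlongrightarrow> 0) (at 0)"
        by (auto intro!: tendsto_eq_intros)
    qed
    then show ?thesis using 3 by (simp add: DERIV_def flat_def)
  qed
qed

lemma smooth_upto_diff:
  "smooth_upto n f \<Longrightarrow> smooth_upto n g \<Longrightarrow> smooth_upto n (\<lambda>x. f x - g x)"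
  using smooth_upto_add[OF _ smooth_upto_linear[OF bounded_linear_minus[OF bounded_linear_ident]], of n f g]
  by simp

lemma smooth_flat: "smooth (flat m)"
proof -
  have "smooth_upto n (flat m)" for n
  proof (induction n arbitrary: m)
    case (Suc n)
    have "dpart b (flat m) = (\<lambda>x. flat (m + 2) x - real m * flat (m + 1) x)" if "b \<in> Basis" for b
      by (rule ext, subst dpart_eqI[OF has_field_derivative_imp_has_derivative[OF flat_has_derivative]])
        (use that in simp)
    moreover have "flat m differentiable (at x)" for x
      using flat_has_derivative has_field_derivative_imp_has_derivative differentiable_def by blast
    ultimately show ?case
      using Suc by (intro smooth_upto_SucI) (auto intro!: smooth_upto_diff smooth_upto_mult)
  qed simp
  then show ?thesis by (simp add: smooth_iff_upto)
qed

lemma smooth_inner: "smooth (\<lambda>x. x \<bullet> b)"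
  by (rule smooth_bounded_linear[OF bounded_linear_inner_left])

lemma smooth_norm_sq: "smooth (\<lambda>x::'a::euclidean_space. c - (norm (x - a))\<^sup>2)"
proof -
  have "(\<lambda>x::'a. c - (norm (x - a))\<^sup>2) = (\<lambda>x. c - (\<Sum>b\<in>Basis. (x \<bullet> b - a \<bullet> b) * (x \<bullet> b - a \<bullet> b)))"
    unfolding power2_norm_eq_inner by (subst euclidean_inner) (simp add: inner_diff_left)
  then show ?thesis
    by (auto intro!: smooth_diff smooth_sum smooth_mult smooth_inner smooth_const)
qed

section \<open>Supports and closure properties of test functions\<close>

lemma tsupport_subset:
  assumes "closed C" "\<And>x. x \<notin> C \<Longrightarrow> f x = 0"
  shows "tsupport f \<subseteq> C"
  unfolding tsupport_def using assms(2) by (intro closure_minimal assms(1)) blast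

lemma not_in_tsupport: "x \<notin> tsupport f \<Longrightarrow> f x = 0"
  unfolding tsupport_def using closure_subset[of "{x. f x \<noteq> 0}"] by blast

lemma closed_tsupport[simp]: "closed (tsupport f)"
  by (simp add: tsupport_def)

lemma compact_tsupportI:
  "compact C \<Longrightarrow> (\<And>x. x \<notin> C \<Longrightarrow> f x = 0) \<Longrightarrow> compact (tsupport f)"
  using compact_Int_closed[of C "tsupport f"] tsupport_subset[of C f]
  by (simp add: compact_imp_closed inf.absorb2)

lemma test_fun_smooth: "test_fun f \<Longrightarrow> smooth f"
  by (simp add: test_fun_def)

lemma test_funI:
  "smooth f \<Longrightarrow> compact C \<Longrightarrow> (\<And>x. x \<notin> C \<Longrightarrow> f x = 0) \<Longrightarrow> test_fun f"
  unfolding test_fun_def using compact_tsupportI by blast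

lemma tsupport_mult: "tsupport (\<lambda>x. f x * g x :: complex) \<subseteq> tsupport f"
  by (rule tsupport_subset) (auto simp: not_in_tsupport)

lemma test_fun_mult: "test_fun f \<Longrightarrow> smooth g \<Longrightarrow> test_fun (\<lambda>x. f x * g x)"
  by (rule test_funI[of _ "tsupport f"]) (auto simp: test_fun_def smooth_mult not_in_tsupport)

lemma test_fun_cmult: "test_fun f \<Longrightarrow> test_fun (\<lambda>x. c * f x)"
  using test_fun_mult[of f "\<lambda>x. c"] by (simp add: mult.commute)

lemma test_fun_zero[simp]: "test_fun (\<lambda>x. 0)"
  by (rule test_funI[of _ "{}"]) auto

lemma test_fun_add: "test_fun f \<Longrightarrow> test_fun g \<Longrightarrow> test_fun (\<lambda>x. f x + g x)"
  by (rule test_funI[of _ "tsupport f \<union> tsupport g"])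
    (auto simp: test_fun_def smooth_add not_in_tsupport compact_Un)

lemma test_fun_sum: "(\<And>i. i \<in> I \<Longrightarrow> test_fun (f i)) \<Longrightarrow> test_fun (\<lambda>x. \<Sum>i\<in>I. f i x)"
  by (induction I rule: infinite_finite_induct) (auto intro!: test_fun_add)

lemma test_fun_dpart:
  assumes "test_fun f" "b \<in> Basis"
  shows "test_fun (dpart b f)"
proof (rule test_funI[of _ "tsupport f"])
  fix x assume "x \<notin> tsupport f"
  then show "dpart b f x = 0"
    using pderivs_vanish[of "- tsupport f" f x "[b]"] by (auto simp: not_in_tsupport open_Compl)
qed (use assms in \<open>auto simp: test_fun_def smooth_dpart\<close>)

lemma test_fun_bounded:
  assumes "test_fun f"
  obtains A where "0 \<le> A" "\<And>x. norm (f x) \<le> A"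
proof -
  have "compact (f ` tsupport f)"
    using assms by (intro compact_continuous_image smooth_continuous_on) (auto simp: test_fun_def)
  then obtain A where A: "\<And>x. x \<in> tsupport f \<Longrightarrow> norm (f x) \<le> A"
    using compact_imp_bounded bounded_iff by (metis imageI)
  have "norm (f x) \<le> max A 0" for x
    using A[of x] not_in_tsupport[of x f] by (cases "x \<in> tsupport f") auto
  then show ?thesis using that[of "max A 0"] by simp
qed

lemma test_fun_deriv_bound:
  "test_fun f \<Longrightarrow> \<exists>A\<ge>0. deriv_bound UNIV n f A"
proof (induction n arbitrary: f)
  case 0
  then show ?case using test_fun_bounded by (metis deriv_bound_0)
next
  case (Suc n)
  obtain A where A: "0 \<le> A" "\<And>x. norm (f x) \<le> A"
    using test_fun_bounded Suc.prems by blast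
  have "\<forall>b\<in>Basis. \<exists>B\<ge>0. deriv_bound UNIV n (dpart b f) B"
    using Suc test_fun_dpart by blast
  then obtain B where B: "\<And>b. b \<in> Basis \<Longrightarrow> 0 \<le> B b" "\<And>b. b \<in> Basis \<Longrightarrow> deriv_bound UNIV n (dpart b f) (B b)"
    by metis
  have "0 \<le> sum B Basis" using B by (simp add: sum_nonneg)
  moreover have "B b \<le> sum B Basis" if "b \<in> Basis" for b
    using that B by (intro member_le_sum) auto
  ultimately have "deriv_bound UNIV (Suc n) f (A + sum B Basis)"
    unfolding deriv_bound_Suc
    using A B by (auto intro: add_increasing2 add_increasing deriv_bound_mono[OF B(2)])
  then show ?case using A \<open>0 \<le> sum B Basis\<close> by (meson add_nonneg_nonneg)
qed

section \<open>Bumps, cutoffs and partitions\<close>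

definition bump :: "'a::euclidean_space \<Rightarrow> real \<Rightarrow> 'a \<Rightarrow> complex" where
  "bump a r x = complex_of_real (flat 0 (r\<^sup>2 - (norm (x - a))\<^sup>2))"

lemma bump_outside: "0 \<le> r \<Longrightarrow> x \<notin> cball a r \<Longrightarrow> bump a r x = 0"
  unfolding bump_def using power_mono[of r "norm (x - a)" 2]
  by (simp add: dist_norm norm_minus_commute flat_0)

lemma bump_center: "0 < r \<Longrightarrow> bump a r a \<noteq> 0"
  using flat_pos[of "r\<^sup>2" 0] by (simp add: bump_def)

lemma test_fun_bump: "0 \<le> r \<Longrightarrow> test_fun (bump a r)"
proof (rule test_funI[of _ "cball a r"])
  show "smooth (bump a r)"
    unfolding bump_def
    by (intro smooth_linear[OF bounded_linear_of_real] smooth_compose[OF smooth_flat] smooth_norm_sq)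
qed (auto simp: bump_outside)

lemma cutoff_exists:
  obtains \<rho> :: "'a::euclidean_space \<Rightarrow> complex"
  where "test_fun \<rho>" "\<And>x. norm x < R \<Longrightarrow> \<rho> x = 1"
proof -
  \<comment> \<open>Equal to 0 for \<open>t \<le> 0\<close> and to 1 for \<open>t \<ge> 1\<close>;
    the denominator is positive because \<open>t\<close> and \<open>1 - t\<close> are never both at
    most 0.\<close>
  define step where "step t = flat 0 t * inverse (flat 0 t + flat 0 (1 - t))" for t
  have pos: "flat 0 t + flat 0 (1 - t) > 0" for t
    using flat_pos[of t 0] flat_pos[of "1 - t" 0] flat_nonneg[of 0 t] flat_nonneg[of 0 "1 - t"]
    by (cases "t > 0") (auto intro: add_pos_nonneg add_nonneg_pos)
  have "smooth (\<lambda>t::real. 1 - t)"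
    by (intro smooth_diff smooth_const smooth_bounded_linear[OF bounded_linear_ident])
  from smooth_compose[OF smooth_flat this] have "smooth (\<lambda>t. inverse (flat 0 t + flat 0 (1 - t)))"
    using pos by (intro smooth_inverse smooth_add smooth_flat) (auto simp: less_imp_neq[symmetric])
  then have step: "smooth step"
    unfolding step_def by (intro smooth_mult smooth_flat)
  \<comment> \<open>The offset 1 puts the argument of \<open>step\<close> at 1 or more inside the
    ball of radius \<open>R\<close>; the squared norm keeps it smooth at the origin.\<close>
  define \<rho> :: "'a \<Rightarrow> complex" where "\<rho> x = complex_of_real (step ((R\<^sup>2 + 1) - (norm (x - 0))\<^sup>2))" for x
  have "test_fun \<rho>"
  proof (rule test_funI[of _ "cball 0 (sqrt (R\<^sup>2 + 1))"])
    show "smooth \<rho>"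
      unfolding \<rho>_def
      by (intro smooth_linear[OF bounded_linear_of_real] smooth_compose[OF step] smooth_norm_sq)
    show "\<rho> x = 0" if "x \<notin> cball 0 (sqrt (R\<^sup>2 + 1))" for x
    proof -
      have "sqrt (R\<^sup>2 + 1) ^ 2 \<le> (norm x)\<^sup>2"
        using that by (intro power_mono) auto
      then show ?thesis by (simp add: \<rho>_def step_def flat_0)
    qed
  qed simp
  moreover have "\<rho> x = 1" if "norm x < R" for x
  proof -
    have "(norm x)\<^sup>2 \<le> R\<^sup>2" using that by (intro power_mono) auto
    then show ?thesis
      using flat_pos[of "R\<^sup>2 + 1 - (norm x)\<^sup>2" 0] by (simp add: \<rho>_def step_def flat_0)
  qed
  ultimately show ?thesis using that by blast
qed

text \<open>Each \<open>\<phi> x\<close> is only known to be nonzero at its own point, and it must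
  survive as a factor because the available estimates are about it. The cofactor \<open>a j\<close>
  is therefore the conjugate of \<open>\<phi> j\<close> divided by the sum of the squared
  moduli.\<close>

lemma smooth_partition:
  fixes \<phi> :: "'a::euclidean_space \<Rightarrow> 'a \<Rightarrow> complex"
  assumes "compact K" "\<And>x. x \<in> K \<Longrightarrow> test_fun (\<phi> x)" "\<And>x. x \<in> K \<Longrightarrow> \<phi> x x \<noteq> 0"
  obtains J a where "finite J" "J \<subseteq> K" "\<And>j. j \<in> J \<Longrightarrow> test_fun (a j)"
    "\<And>x. x \<in> K \<Longrightarrow> (\<Sum>j\<in>J. \<phi> j x * a j x) = 1"
proof (cases "K = {}")
  case True
  then show ?thesis using that[of "{}"] by simp
next
  case False
  have op: "open {y. \<phi> x y \<noteq> 0}" if "x \<in> K" for x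
    using smooth_continuous_on[OF test_fun_smooth[OF assms(2)[OF that]], of UNIV]
    by (intro open_Collect_neq continuous_on_const)
  obtain J where J: "J \<subseteq> K" "finite J" "K \<subseteq> (\<Union>x\<in>J. {y. \<phi> x y \<noteq> 0})"
    using compactE_image[OF assms(1), of K "\<lambda>x. {y. \<phi> x y \<noteq> 0}"] op assms(3) by blast
  define \<Phi> where "\<Phi> y = (\<Sum>j\<in>J. Re (\<phi> j y) * Re (\<phi> j y) + Im (\<phi> j y) * Im (\<phi> j y))" for y
  have s: "smooth (\<phi> j)" if "j \<in> J" for j
    using that J assms(2) test_fun_smooth by blast
  have s\<Phi>: "smooth \<Phi>"
    unfolding \<Phi>_def
    by (intro smooth_sum smooth_add smooth_mult smooth_linear[OF bounded_linear_Re]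
        smooth_linear[OF bounded_linear_Im] s)
  have nonneg: "\<Phi> y \<ge> 0" for y
    unfolding \<Phi>_def by (intro sum_nonneg) simp
  have pos: "\<Phi> y > 0" if "y \<in> K" for y
  proof -
    obtain j where j: "j \<in> J" "\<phi> j y \<noteq> 0" using J(3) \<open>y \<in> K\<close> by blast
    have "0 < Re (\<phi> j y) * Re (\<phi> j y) + Im (\<phi> j y) * Im (\<phi> j y)"
      using j(2) by (simp add: complex_neq_0 power2_eq_square)
    then show ?thesis
      unfolding \<Phi>_def by (intro sum_pos2[OF J(2) j(1)]) auto
  qed
  obtain y0 where y0: "y0 \<in> K" "\<And>y. y \<in> K \<Longrightarrow> \<Phi> y0 \<le> \<Phi> y"
    using continuous_attains_inf[OF assms(1) False smooth_continuous_on[OF s\<Phi>]] by blast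
  define \<epsilon> where "\<epsilon> = \<Phi> y0"
  have eps: "\<epsilon> > 0" using pos y0 by (simp add: \<epsilon>_def)
  \<comment> \<open>The added term keeps the denominator positive and vanishes on \<open>K\<close>.\<close>
  define \<Psi> where "\<Psi> y = \<Phi> y + flat 0 (\<epsilon> - \<Phi> y)" for y
  have "\<Psi> y > 0" for y
    using nonneg[of y] eps flat_pos[of "\<epsilon> - \<Phi> y" 0] flat_nonneg[of 0 "\<epsilon> - \<Phi> y"]
    unfolding \<Psi>_def by (cases "\<Phi> y = 0") (auto intro: add_pos_nonneg)
  then have s\<Psi>: "smooth (\<lambda>y. inverse (\<Psi> y))"
    unfolding \<Psi>_def
    by (intro smooth_inverse smooth_add smooth_compose[OF smooth_flat] smooth_diff s\<Phi> smooth_const)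
      (auto simp: less_imp_neq[symmetric])
  define a where "a j y = cnj (\<phi> j y) * complex_of_real (inverse (\<Psi> y))" for j y
  have "test_fun (a j)" if "j \<in> J" for j
  proof (rule test_funI[of _ "tsupport (\<phi> j)"])
    show "smooth (a j)"
      unfolding a_def
      by (intro smooth_mult smooth_linear[OF bounded_linear_cnj] smooth_linear[OF bounded_linear_of_real] s s\<Psi> that)
    show "compact (tsupport (\<phi> j))"
      using that J assms(2) by (auto simp: test_fun_def)
  qed (simp add: a_def not_in_tsupport)
  moreover have "(\<Sum>j\<in>J. \<phi> j y * a j y) = 1" if "y \<in> K" for y
  proof -
    have "\<Psi> y = \<Phi> y" using y0(2)[OF that] by (simp add: \<Psi>_def \<epsilon>_def flat_0)
    have "(\<Sum>j\<in>J. \<phi> j y * a j y) = (\<Sum>j\<in>J. \<phi> j y * cnj (\<phi> j y)) * complex_of_real (inverse (\<Psi> y))"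
      by (simp add: a_def sum_distrib_right mult.assoc)
    also have "(\<Sum>j\<in>J. \<phi> j y * cnj (\<phi> j y)) = complex_of_real (\<Phi> y)"
      by (simp add: \<Phi>_def complex_mult_cnj power2_eq_square)
    finally show ?thesis
      using pos[OF that] \<open>\<Psi> y = \<Phi> y\<close> by (simp add: of_real_inverse)
  qed
  ultimately show ?thesis using that J by blast
qed

section \<open>Finite order, locality and the extended pairing\<close>

lemma distribution_add:
  "distribution w \<Longrightarrow> test_fun f \<Longrightarrow> test_fun g \<Longrightarrow> w (\<lambda>x. f x + g x) = w f + w g"
  by (simp add: distribution_def)

lemma distribution_cmult:
  "distribution w \<Longrightarrow> test_fun f \<Longrightarrow> w (\<lambda>x. c * f x) = c * w f"
  by (simp add: distribution_def)

lemma distribution_zero: "distribution w \<Longrightarrow> w (\<lambda>x. 0) = 0"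
  using distribution_cmult[of w "\<lambda>x. 0" 0] by simp

lemma distribution_sum:
  assumes "distribution w" "\<And>i. i \<in> I \<Longrightarrow> test_fun (f i)"
  shows "w (\<lambda>x. \<Sum>i\<in>I. f i x) = (\<Sum>i\<in>I. w (f i))"
  using assms(2)
  by (induction I rule: infinite_finite_induct)
    (auto simp: distribution_zero[OF assms(1)] distribution_add[OF assms(1)] test_fun_sum)

text \<open>Otherwise for each \<open>k\<close> some test function violates the bound with
  \<open>k\<close> both as order and as constant. Dividing it by its value under \<open>w\<close>
  gives a sequence that converges to 0 as test functions, while \<open>w\<close> is 1 on every
  member.\<close>

lemma distribution_finite_order:
  fixes w :: "('a::euclidean_space \<Rightarrow> complex) \<Rightarrow> complex"
  assumes "distribution w" "compact K"
  obtains M C where "0 \<le> C"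
    "\<And>f A. test_fun f \<Longrightarrow> tsupport f \<subseteq> K \<Longrightarrow> deriv_bound UNIV M f A \<Longrightarrow> norm (w f) \<le> C * A"
proof (rule ccontr)
  assume neg: "\<not> thesis"
  have "\<exists>f A. test_fun f \<and> tsupport f \<subseteq> K \<and> deriv_bound UNIV k f A \<and> norm (w f) > real k * A" for k
    using neg that[of "real k" k] by (meson not_le of_nat_0_le_iff)
  then obtain f A where f: "\<And>k. test_fun (f k)" "\<And>k. tsupport (f k) \<subseteq> K"
    "\<And>k. deriv_bound UNIV k (f k) (A k)" "\<And>k. norm (w (f k)) > real k * A k"
    by metis
  have A: "A k \<ge> 0" for k
    using deriv_boundD[OF f(3), of "[]" k 0] norm_ge_zero order_trans by (metis UNIV_I empty_set empty_subsetI le0 list.size(3))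
  have nz: "norm (w (f k)) > 0" for k
    using f(4)[of k] A[of k] by (meson le_less_trans mult_nonneg_nonneg of_nat_0_le_iff)
  define g where "g k = (\<lambda>x. inverse (w (f k)) * f k x)" for k
  have wg: "w (g k) = 1" for k
    using nz[of k] by (simp add: g_def distribution_cmult[OF assms(1)] f)
  have tg: "test_fun (g k)" for k
    unfolding g_def by (intro test_fun_cmult f)
  have bound: "norm (pderivs bs (g k) x) \<le> inverse (real k)"
    if "set bs \<subseteq> Basis" "length bs \<le> k" "0 < k" for bs k x
  proof -
    have "deriv_bound UNIV k (g k) (norm (inverse (w (f k))) * A k)"
      unfolding g_def by (intro deriv_bound_cmult f test_fun_smooth)
    then have "norm (pderivs bs (g k) x) \<le> norm (inverse (w (f k))) * A k"
      using that by (auto intro: deriv_boundD)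
    also have "\<dots> = A k / norm (w (f k))"
      by (simp add: norm_inverse divide_inverse_commute)
    also have "\<dots> \<le> inverse (real k)"
      using nz[of k] f(4)[of k] that(3) by (simp add: field_simps)
    finally show ?thesis .
  qed
  have "test_conv g (\<lambda>x. 0)"
    unfolding test_conv_def
  proof (intro conjI allI impI)
    have "tsupport (g k) \<subseteq> K" for k
      by (rule order_trans[OF tsupport_subset[OF closed_tsupport[of "f k"]] f(2)]) (simp add: g_def not_in_tsupport)
    then show "\<exists>K. compact K \<and> tsupport (\<lambda>x::'a. 0::complex) \<subseteq> K \<and> (\<forall>k. tsupport (g k) \<subseteq> K)"
      using assms(2) by (intro exI[of _ K]) (auto simp: tsupport_def)
    fix bs :: "'a list" assume bs: "set bs \<subseteq> Basis"
    show "uniform_limit UNIV (\<lambda>k. pderivs bs (g k)) (pderivs bs (\<lambda>x. 0)) sequentially"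
    proof (rule uniform_limitI)
      fix e :: real assume "e > 0"
      then have "eventually (\<lambda>k. inverse (real k) < e) sequentially"
        by (intro order_tendstoD(2)[OF lim_inverse_n])
      with eventually_gt_at_top[of "length bs"]
      show "eventually (\<lambda>k. \<forall>x\<in>UNIV. dist (pderivs bs (g k) x) (pderivs bs (\<lambda>x. 0) x) < e) sequentially"
      proof eventually_elim
        case (elim k)
        have "norm (pderivs bs (g k) x) < e" for x
          using bound[OF bs, of k x] elim by linarith
        then show ?case by simp
      qed
    qed
  qed (auto simp: tg)
  then have "(\<lambda>k. w (g k)) \<longlonglongrightarrow> w (\<lambda>x. 0)"
    using assms(1) unfolding distribution_def by blast
  then show False
    by (simp add: wg distribution_zero[OF assms(1)] LIMSEQ_const_iff)
qed

text \<open>\<open>dsupport\<close> only says that \<open>w\<close> vanishes locally off the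
  support. Compactness of \<open>tsupport f\<close> and bumps inside those null neighbourhoods cut
  \<open>f\<close> into finitely many pieces on which \<open>w\<close> is 0.\<close>

lemma distribution_vanish:
  fixes w :: "('a::euclidean_space \<Rightarrow> complex) \<Rightarrow> complex"
  assumes "distribution w" "test_fun f" "open U" "dsupport w \<subseteq> U" "\<And>x. x \<in> U \<Longrightarrow> f x = 0"
  shows "w f = 0"
proof -
  have "tsupport f \<subseteq> - U"
    using assms(3,5) by (intro tsupport_subset) auto
  have "\<exists>r>0. \<forall>g. test_fun g \<longrightarrow> tsupport g \<subseteq> cball x r \<longrightarrow> w g = 0" if "x \<in> tsupport f" for x
  proof -
    have "x \<notin> dsupport w" using that \<open>tsupport f \<subseteq> - U\<close> assms(4) by auto
    then obtain V where V: "open V" "x \<in> V" "\<And>g. test_fun g \<Longrightarrow> tsupport g \<subseteq> V \<Longrightarrow> w g = 0"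
      unfolding dsupport_def by blast
    then obtain r where "r > 0" "cball x r \<subseteq> V" by (meson open_contains_cball)
    then show ?thesis using V(3) by (meson order_trans)
  qed
  then obtain r where r: "\<And>x. x \<in> tsupport f \<Longrightarrow> r x > 0"
    "\<And>x g. x \<in> tsupport f \<Longrightarrow> test_fun g \<Longrightarrow> tsupport g \<subseteq> cball x (r x) \<Longrightarrow> w g = 0"
    by metis
  have "compact (tsupport f)"
    using assms(2) by (simp add: test_fun_def)
  moreover have "test_fun (bump x (r x))" "bump x (r x) x \<noteq> 0" if "x \<in> tsupport f" for x
    using r(1)[OF that] by (auto simp: test_fun_bump bump_center)
  ultimately obtain J a where J: "finite J" "J \<subseteq> tsupport f" "\<And>j. j \<in> J \<Longrightarrow> test_fun (a j)"
    "\<And>x. x \<in> tsupport f \<Longrightarrow> (\<Sum>j\<in>J. bump j (r j) x * a j x) = 1"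
    using smooth_partition[of "tsupport f" "\<lambda>x. bump x (r x)"] by blast
  have t: "test_fun (\<lambda>x. bump j (r j) x * (a j x * f x))" if "j \<in> J" for j
    using that J(2) r(1)[of j] assms(2)
    by (intro test_fun_mult test_fun_bump smooth_mult test_fun_smooth J(3)) auto
  have "f = (\<lambda>x. \<Sum>j\<in>J. bump j (r j) x * (a j x * f x))"
  proof
    fix x
    show "f x = (\<Sum>j\<in>J. bump j (r j) x * (a j x * f x))"
      using J(4)[of x] not_in_tsupport[of x f]
      by (cases "x \<in> tsupport f") (auto simp: mult.assoc[symmetric] sum_distrib_right[symmetric])
  qed
  then have "w f = w (\<lambda>x. \<Sum>j\<in>J. bump j (r j) x * (a j x * f x))" by simp
  also have "\<dots> = (\<Sum>j\<in>J. w (\<lambda>x. bump j (r j) x * (a j x * f x)))"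
    by (rule distribution_sum[OF assms(1) t])
  also have "\<dots> = 0"
  proof (rule sum.neutral, rule ballI)
    fix j assume j: "j \<in> J"
    then have "0 \<le> r j" using r(1)[of j] J(2) by auto
    have "tsupport (\<lambda>x. bump j (r j) x * (a j x * f x)) \<subseteq> cball j (r j)"
      by (rule tsupport_subset) (auto simp: bump_outside[OF \<open>0 \<le> r j\<close>] simp del: mem_cball)
    then show "w (\<lambda>x. bump j (r j) x * (a j x * f x)) = 0"
      using r(2) t j J by blast
  qed
  finally show ?thesis .
qed

text \<open>Resolves the choice inside \<open>ext_pair\<close>: a cutoff equal to 1 on a large ball
  shows that a choice exists, and the same \<open>cf\<close> serves every
  \<open>\<psi>\<close>.\<close>

lemma ext_pair_eq:
  fixes w :: "('a::euclidean_space \<Rightarrow> complex) \<Rightarrow> complex"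
  assumes "compact_distribution w"
  obtains cf where "test_fun cf" "\<exists>U. open U \<and> dsupport w \<subseteq> U \<and> (\<forall>x\<in>U. cf x = 1)"
    "\<And>\<psi>. ext_pair w \<psi> = w (\<lambda>x. cf x * \<psi> x)"
proof -
  let ?P = "\<lambda>cf :: 'a \<Rightarrow> complex. test_fun cf \<and> (\<exists>U. open U \<and> dsupport w \<subseteq> U \<and> (\<forall>x\<in>U. cf x = 1))"
  have "bounded (dsupport w)"
    using assms by (simp add: compact_distribution_def compact_imp_bounded)
  then obtain R where "dsupport w \<subseteq> ball 0 R"
    using bounded_subset_ballD by blast
  moreover obtain \<rho> :: "'a \<Rightarrow> complex" where "test_fun \<rho>" "\<And>x. norm x < R \<Longrightarrow> \<rho> x = 1"
    using cutoff_exists by blast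
  ultimately have "?P \<rho>" by (auto intro!: exI[of _ "ball 0 R"])
  then have "?P (SOME cf. ?P cf)" by (rule someI[where P = ?P])
  then show ?thesis
    using that[of "SOME cf. ?P cf"] unfolding ext_pair_def Let_def by blast
qed

lemma admissible_cutoff_exists:
  assumes "compact_distribution w"
  shows "\<exists>\<psi>0. admissible_cutoff v w \<psi>0"
proof -
  have "bounded ((\<lambda>x. x \<bullet> v) ` dsupport w)"
    using assms unfolding compact_distribution_def
    by (intro compact_imp_bounded compact_continuous_image continuous_intros) auto
  then obtain B where B: "\<And>x. x \<in> dsupport w \<Longrightarrow> \<bar>x \<bullet> v\<bar> \<le> B"
    by (auto simp: bounded_iff)
  \<comment> \<open>The bump of radius 1 around \<open>a\<close> ends at \<open>- B - 1\<close>,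
    strictly to the left of all values \<open>x \<bullet> v\<close> on the support.\<close>
  define a where "a = - B - 2"
  define f where "f s = flat 0 (1 - (norm (s - a))\<^sup>2)" for s :: real
  have sf: "smooth f"
    unfolding f_def by (intro smooth_compose[OF smooth_flat] smooth_norm_sq)
  have out: "f s = 0" if "s \<notin> {a - 1..a + 1}" for s
  proof -
    have "1\<^sup>2 \<le> (norm (s - a))\<^sup>2" using that by (intro power_mono) auto
    then show ?thesis by (simp add: f_def flat_0)
  qed
  define c where "c = integral {a - 1..a + 1} f"
  have "c \<noteq> 0"
  proof
    assume "c = 0"
    have nonneg: "f s \<ge> 0" for s by (simp add: f_def flat_nonneg)
    have "\<forall>s\<in>{a - 1..a + 1}. f s = 0"
      using \<open>c = 0\<close> integral_eq_0_iff[OF smooth_continuous_on[OF sf], of "a - 1" "a + 1"] nonneg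
      by (simp add: c_def)
    then have "f a = 0" by (rule bspec) simp
    then show False using flat_pos[of 1 0] by (simp add: f_def)
  qed
  have int: "integral UNIV f = c"
  proof -
    have "f = (\<lambda>s. if s \<in> {a - 1..a + 1} then f s else 0)" using out by auto
    then show ?thesis
      unfolding c_def by (metis Henstock_Kurzweil_Integration.integral_restrict_UNIV)
  qed
  have sup: "tsupport (\<lambda>s. inverse c * f s) \<subseteq> {a - 1..a + 1}"
    by (rule tsupport_subset) (auto simp: out)
  have "admissible_cutoff v w (\<lambda>s. inverse c * f s)"
    unfolding admissible_cutoff_def
  proof (intro conjI ballI)
    show "smooth (\<lambda>s. inverse c * f s)" by (intro smooth_mult sf smooth_const)
    show "compact (tsupport (\<lambda>s. inverse c * f s))"
      by (rule compact_tsupportI[of "{a - 1..a + 1}"]) (auto simp: out)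
    show "integral UNIV (\<lambda>s. inverse c * f s) = 1"
      using \<open>c \<noteq> 0\<close> by (simp add: int)
    show "s < x \<bullet> v" if "s \<in> tsupport (\<lambda>s. inverse c * f s)" "x \<in> dsupport w" for s x
    proof -
      have "s \<le> a + 1" using sup that(1) by auto
      with B[OF that(2)] show ?thesis by (auto simp: a_def)
    qed
  qed
  then show ?thesis by blast
qed

section \<open>Pointwise convergence of Fourier series\<close>

definition ek :: "int \<Rightarrow> real \<Rightarrow> complex" where
  "ek k s = cis (real_of_int k * s)"

lemma norm_ek[simp]: "norm (ek k s) = 1"
  and ek_0[simp]: "ek 0 s = 1" "ek k 0 = 1"
  by (simp_all add: ek_def)

lemma ek_add: "ek (k + l) s = ek k s * ek l s" "ek k (s + t) = ek k s * ek k t"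
  by (simp_all add: ek_def cis_mult algebra_simps)

lemma ek_conv_exp: "ek k s = exp (\<i> * complex_of_real (real_of_int k * s))"
  by (simp add: ek_def cis_conv_exp)

lemma ek_has_vector_derivative:
  "(ek k has_vector_derivative (\<i> * of_int k * ek k s)) (at s within S)"
proof -
  have "((\<lambda>s. cis (real_of_int k * s)) has_derivative (\<lambda>h. (real_of_int k * h) *\<^sub>R (\<i> * cis (real_of_int k * s)))) (at s within S)"
    by (intro derivative_intros)
  then show ?thesis
    by (simp add: ek_def[abs_def] has_vector_derivative_def scaleR_conv_of_real mult_ac)
qed

lemma continuous_on_ek[continuous_intros]:
  "continuous_on S f \<Longrightarrow> continuous_on S (\<lambda>x. ek k (f x))"
  unfolding ek_def cis_conv_exp by (intro continuous_intros)

text \<open>Not divided by \<open>k\<close>, so that \<open>k = 0\<close> is included.\<close>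

lemma by_parts_ek:
  assumes "a \<le> b" "\<And>s. (F has_vector_derivative F' s) (at s)" "continuous_on {a..b} F'"
  shows "integral {a..b} (\<lambda>s. F' s * ek k s) =
    F b * ek k b - F a * ek k a - \<i> * of_int k * integral {a..b} (\<lambda>s. F s * ek k s)"
proof -
  have cF: "continuous_on {a..b} F"
    using assms(2) by (meson continuous_at_imp_continuous_on has_vector_derivative_continuous)
  have "((\<lambda>s. F s * ek k s) has_vector_derivative (F s * (\<i> * of_int k * ek k s) + F' s * ek k s)) (at s within {a..b})" for s
    by (rule has_vector_derivative_mult[OF has_vector_derivative_at_within[OF assms(2)] ek_has_vector_derivative])
  then have "((\<lambda>s. F s * (\<i> * of_int k * ek k s) + F' s * ek k s) has_integral (F b * ek k b - F a * ek k a)) {a..b}"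
    by (intro fundamental_theorem_of_calculus assms(1))
  then have "F b * ek k b - F a * ek k a = integral {a..b} (\<lambda>s. F s * (\<i> * of_int k * ek k s) + F' s * ek k s)"
    by (simp add: integral_unique)
  also have "\<dots> = integral {a..b} (\<lambda>s. \<i> * of_int k * (F s * ek k s)) + integral {a..b} (\<lambda>s. F' s * ek k s)"
    by (subst integral_add[symmetric])
      (auto intro!: integrable_continuous_real continuous_intros cF assms(3) simp: mult_ac)
  finally show ?thesis by simp
qed

lemma integral_ek: "integral {- pi..pi} (ek k) = (if k = 0 then 2 * pi else 0)"
proof (cases "k = 0")
  case True
  then show ?thesis by (simp add: ek_def[abs_def] scaleR_conv_of_real)
next
  case False
  have "ek k pi = ek k (- pi)"
  proof -
    have "ek k pi = ek k (- pi) * ek k (2 * pi)" by (simp add: ek_add(2)[symmetric])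
    also have "ek k (2 * pi) = 1"
      using cis_multiple_2pi[of "real_of_int k"] by (simp add: ek_def mult_ac)
    finally show ?thesis by simp
  qed
  \<comment> \<open>By parts with the constant function 1: the boundary terms cancel by periodicity
    and leave \<open>k\<close> times the integral.\<close>
  then show ?thesis
    using by_parts_ek[of "- pi" pi "\<lambda>_. 1" "\<lambda>_. 0" k] False by simp
qed

lemma norm_integral_le:
  fixes f :: "real \<Rightarrow> complex"
  assumes "a \<le> b" "continuous_on {a..b} f" "\<And>s. s \<in> {a..b} \<Longrightarrow> norm (f s) \<le> B"
  shows "norm (integral {a..b} f) \<le> B * (b - a)"
  using integral_bound[OF assms(1,2)] assms(3) by blast

text \<open>Replacing \<open>g\<close> by a polynomial costs an error that is small uniformly in
  \<open>k\<close>; for the polynomial, integration by parts gains a factor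
  \<open>1 / k\<close>.\<close>

lemma riemann_lebesgue:
  fixes g :: "real \<Rightarrow> complex"
  assumes "a \<le> b" "continuous_on {a..b} g" "0 < e"
  shows "\<exists>N. \<forall>k. N \<le> \<bar>real_of_int k\<bar> \<longrightarrow> norm (integral {a..b} (\<lambda>s. g s * ek k s)) < e"
proof -
  \<comment> \<open>The summand 1 avoids a division by zero when \<open>a = b\<close>.\<close>
  define \<delta> where "\<delta> = e / (2 * (b - a + 1))"
  have \<delta>: "\<delta> > 0" using assms by (simp add: \<delta>_def)
  obtain p where p: "polynomial_function p" "\<And>s. s \<in> {a..b} \<Longrightarrow> norm (g s - p s) < \<delta>"
    using Stone_Weierstrass_polynomial_function[OF compact_Icc assms(2) \<delta>] by blast
  obtain p' where p': "polynomial_function p'" "\<And>s. (p has_vector_derivative p' s) (at s)"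
    using has_vector_derivative_polynomial_function[OF p(1)] by blast
  have cont: "continuous_on {a..b} p" "continuous_on {a..b} p'"
    using p(1) p'(1) by (auto intro: continuous_on_polymonial_function)
  have "bounded (p' ` {a..b})"
    by (intro compact_imp_bounded compact_continuous_image cont) auto
  then obtain B where B: "\<And>s. s \<in> {a..b} \<Longrightarrow> norm (p' s) \<le> B"
    unfolding bounded_iff by blast
  define C where "C = norm (p b) + norm (p a) + B * (b - a)"
  have C: "\<bar>real_of_int k\<bar> * norm (integral {a..b} (\<lambda>s. p s * ek k s)) \<le> C" for k
  proof -
    have "\<i> * of_int k * integral {a..b} (\<lambda>s. p s * ek k s) =
        p b * ek k b - p a * ek k a - integral {a..b} (\<lambda>s. p' s * ek k s)"
      using by_parts_ek[OF assms(1) p'(2) cont(2), of k] by simp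
    then have "\<bar>real_of_int k\<bar> * norm (integral {a..b} (\<lambda>s. p s * ek k s)) =
        norm (p b * ek k b - p a * ek k a - integral {a..b} (\<lambda>s. p' s * ek k s))"
      by (metis (no_types, lifting) norm_ii norm_mult norm_of_int mult_1)
    also have "\<dots> \<le> norm (p b * ek k b) + norm (p a * ek k a) + norm (integral {a..b} (\<lambda>s. p' s * ek k s))"
      by (meson add_mono norm_triangle_ineq4 order_refl order_trans)
    also have "\<dots> \<le> norm (p b * ek k b) + norm (p a * ek k a) + B * (b - a)"
      using B by (intro add_left_mono norm_integral_le assms continuous_intros cont) (simp add: norm_mult)
    also have "\<dots> = C"
      by (simp add: C_def norm_mult)
    finally show ?thesis .
  qed
  have small: "norm (integral {a..b} (\<lambda>s. (g s - p s) * ek k s)) \<le> e / 2" for k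
  proof -
    have "norm (integral {a..b} (\<lambda>s. (g s - p s) * ek k s)) \<le> \<delta> * (b - a)"
      using p(2) by (intro norm_integral_le assms continuous_intros cont) (auto simp: norm_mult intro: less_imp_le)
    also have "\<dots> \<le> \<delta> * (b - a + 1)" using \<delta> by (intro mult_left_mono) auto
    also have "\<dots> = e / 2"
    proof -
      have "b - a + 1 \<noteq> 0" using assms(1) by simp
      then show ?thesis by (simp only: \<delta>_def) (simp add: divide_simps del: right_diff_distrib left_diff_distrib)
    qed
    finally show ?thesis .
  qed
  have "norm (integral {a..b} (\<lambda>s. g s * ek k s)) < e" if k: "2 * (\<bar>C\<bar> + 1) / e \<le> \<bar>real_of_int k\<bar>" for k
  proof -
    have "0 < 2 * (\<bar>C\<bar> + 1) / e" using assms by simp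
    then have kpos: "\<bar>real_of_int k\<bar> > 0" using k by linarith
    let ?n = "norm (integral {a..b} (\<lambda>s. p s * ek k s))"
    have "?n < e / 2"
    proof (rule ccontr)
      assume "\<not> ?n < e / 2"
      then have "2 * (\<bar>C\<bar> + 1) / e * (e / 2) \<le> \<bar>real_of_int k\<bar> * ?n"
        using k assms by (intro mult_mono) auto
      then show False using C[of k] assms by simp
    qed
    moreover have split: "integral {a..b} (\<lambda>s. g s * ek k s) =
        integral {a..b} (\<lambda>s. (g s - p s) * ek k s) + integral {a..b} (\<lambda>s. p s * ek k s)"
      by (subst integral_add[symmetric])
        (auto intro!: integrable_continuous_real continuous_intros cont assms(2) simp: algebra_simps)
    ultimately show ?thesis
      unfolding split
      using small[of k] norm_triangle_ineq[of "integral {a..b} (\<lambda>s. (g s - p s) * ek k s)" "integral {a..b} (\<lambda>s. p s * ek k s)"]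
      by linarith
  qed
  then show ?thesis by blast
qed

lemma ek_eq_1_iff:
  assumes "\<bar>s\<bar> < 2 * pi" shows "ek 1 s = 1 \<longleftrightarrow> s = 0"
proof
  assume "ek 1 s = 1"
  then have "cos s = 1" by (metis Re_complex_of_real cis.sel(1) ek_def mult_1 of_int_1 of_real_1)
  then show "s = 0" using assms cos_one_2pi[of s] by (auto simp: cos_one_2pi_int abs_mult)
qed simp

lemma has_vector_derivative_tendsto:
  fixes f :: "real \<Rightarrow> complex"
  assumes "(f has_vector_derivative f') (at t)"
  shows "((\<lambda>s. (f s - f t) / of_real (s - t)) \<longlongrightarrow> f') (at t)"
proof (rule LIM_zero_cancel, rule tendsto_norm_zero_cancel)
  have lim: "((\<lambda>s. norm ((f s - f t) - (s - t) *\<^sub>R f') / norm (s - t)) \<longlongrightarrow> 0) (at t)"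
    using assms by (simp add: has_vector_derivative_def has_derivative_iff_norm)
  have eq: "norm ((f s - f t) - (s - t) *\<^sub>R f') / norm (s - t) = norm ((f s - f t) / of_real (s - t) - f')"
    if "s \<noteq> t" for s
  proof -
    have "(f s - f t) / of_real (s - t) - f' = ((f s - f t) - (s - t) *\<^sub>R f') / of_real (s - t)"
      using that by (simp add: scaleR_conv_of_real divide_simps)
    then show ?thesis by (simp only: norm_divide norm_of_real real_norm_def)
  qed
  have "\<forall>\<^sub>F s in at t. norm ((f s - f t) - (s - t) *\<^sub>R f') / norm (s - t) = norm ((f s - f t) / of_real (s - t) - f')"
    unfolding eventually_at_filter by (rule always_eventually) (use eq in blast)
  from Lim_transform_eventually[OF lim this]
  show "((\<lambda>s. norm ((f s - f t) / of_real (s - t) - f')) \<longlongrightarrow> 0) (at t)" .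
qed

text \<open>Chernoff's argument: dividing by \<open>ek 1 (s - t) - 1\<close> turns the partial sums into a telescoping sum.\<close>

lemma fourier_series_pointwise:
  fixes f :: "real \<Rightarrow> complex"
  assumes f: "continuous_on {-pi..pi} f" "(f has_vector_derivative f') (at t)" and t: "\<bar>t\<bar> < pi"
  shows "(\<lambda>n. \<Sum>k\<in>{-int n..int n}. ek k t * integral {-pi..pi} (\<lambda>s. f s * ek (-k) s) / (2 * pi)) \<longlonglongrightarrow> f t"
proof -
  \<comment> \<open>At \<open>s = t\<close> the quotient is replaced by its limit:
    \<open>ek 1 (s - t) - 1\<close> behaves like \<open>\<i> * (s - t)\<close>. This makes
    \<open>g\<close> continuous.\<close>
  define g where "g s = (if s = t then f' / \<i> else (f s - f t) / (ek 1 (s - t) - 1))" for s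
  \<comment> \<open>Here \<open>\<bar>t\<bar> < pi\<close> matters: \<open>\<bar>s - t\<bar>\<close>
    stays below a full period.\<close>
  have nz: "ek 1 (s - t) - 1 \<noteq> 0" if "s \<in> {-pi..pi}" "s \<noteq> t" for s
    using ek_eq_1_iff[of "s - t"] that t by (auto simp: abs_less_iff)
  have cont: "continuous_on {-pi..pi} g"
    unfolding continuous_on_eq_continuous_within
  proof
    fix s assume s: "s \<in> {-pi..pi}"
    show "continuous (at s within {-pi..pi}) g"
    proof (cases "s = t")
      case False
      have "continuous (at s within {-pi..pi}) (\<lambda>s. (f s - f t) / (ek 1 (s - t) - 1))"
        using nz[OF s False] f(1) s continuous_on_ek[of "{-pi..pi}" "\<lambda>s. s - t" 1,
            OF continuous_on_diff[OF continuous_on_id continuous_on_const]]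
        unfolding continuous_within
        by (intro tendsto_divide tendsto_diff tendsto_const)
          (auto simp: continuous_on_def continuous_intros)
      then show ?thesis
        by (rule continuous_transform_within[of _ _ _ "\<bar>s - t\<bar>"])
          (use s False in \<open>auto simp: g_def dist_real_def\<close>)
    next
      case True
      have "((\<lambda>s. cis (s - t)) has_derivative (\<lambda>h. h *\<^sub>R (\<i> * cis (t - t)))) (at t)"
        by (intro has_derivative_cis) (auto intro!: derivative_eq_intros)
      then have "((\<lambda>s. ek 1 (s - t)) has_vector_derivative \<i>) (at t)"
        by (simp add: ek_def has_vector_derivative_def)
      from has_vector_derivative_tendsto[OF this]
      have "((\<lambda>s. (ek 1 (s - t) - 1) / of_real (s - t)) \<longlongrightarrow> \<i>) (at t)" by simp
      with has_vector_derivative_tendsto[OF f(2)]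
      have "((\<lambda>s. (f s - f t) / of_real (s - t) / ((ek 1 (s - t) - 1) / of_real (s - t))) \<longlongrightarrow> f' / \<i>) (at t)"
        by (rule tendsto_divide) simp
      then have "(g \<longlongrightarrow> f' / \<i>) (at t)"
        by (rule Lim_transform_eventually)
          (auto simp: g_def eventually_at_filter)
      then show ?thesis
        using True tendsto_within_subset[of g _ t UNIV "{-pi..pi}"] by (simp add: continuous_within g_def)
    qed
  qed
  define G where "G k = integral {-pi..pi} (\<lambda>s. g s * ek (-k) (s - t))" for k
  have int: "(\<lambda>s. g s * ek k (s - t)) integrable_on {-pi..pi}" for k
    by (intro integrable_continuous_real continuous_intros cont)
  have eq: "(f s - f t) * ek (-k) (s - t) = g s * ek (-(k - 1)) (s - t) - g s * ek (-k) (s - t)" if "s \<in> {-pi..pi}" for s k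
  proof -
    have "f s - f t = g s * (ek 1 (s - t) - 1)"
      using nz[OF that] by (auto simp: g_def)
    moreover have "ek (- (k - 1)) (s - t) = ek 1 (s - t) * ek (-k) (s - t)"
      using ek_add(1)[of 1 "-k" "s - t"] by simp
    ultimately show ?thesis by (simp only:) (simp add: algebra_simps)
  qed
  \<comment> \<open>Orthogonality leaves the constant \<open>f t\<close> only in the term
    \<open>k = 0\<close>. For the rest, multiplication by \<open>ek 1 (s - t) - 1\<close> shifts the
    frequency by one and produces a difference of neighbouring values of \<open>G\<close>.\<close>
  have tele: "ek k t * integral {-pi..pi} (\<lambda>s. f s * ek (-k) s) = f t * (if k = 0 then 2 * pi else 0) + (G (k - 1) - G k)" for k
  proof -
    have shift: "ek k t * ek (-k) s = ek (-k) (s - t)" for s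
      using ek_add(2)[of "-k" s "-t"] by (simp add: ek_def)
    have "ek k t * integral {-pi..pi} (\<lambda>s. f s * ek (-k) s) = integral {-pi..pi} (\<lambda>s. f s * ek (-k) (s - t))"
      unfolding shift[symmetric] by (subst integral_mult_right[symmetric]) (simp add: mult_ac)
    also have "\<dots> = integral {-pi..pi} (\<lambda>s. f t * ek (-k) (s - t) + (g s * ek (-(k - 1)) (s - t) - g s * ek (-k) (s - t)))"
      by (rule integral_cong) (simp only: eq[symmetric], simp add: algebra_simps)
    also have "\<dots> = integral {-pi..pi} (\<lambda>s. f t * ek (-k) (s - t)) + (G (k - 1) - G k)"
      unfolding G_def
      by (subst integral_add) (auto intro!: integral_diff int integrable_diff integrable_continuous_real continuous_intros cont)
    also have "integral {-pi..pi} (\<lambda>s. f t * ek (-k) (s - t)) = f t * (ek k t * integral {-pi..pi} (ek (-k)))"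
      unfolding shift[symmetric] by simp
    also have "\<dots> = f t * (if k = 0 then 2 * pi else 0)"
      by (simp add: integral_ek)
    finally show ?thesis .
  qed
  have "(\<Sum>k\<in>{-int n..int n}. ek k t * integral {-pi..pi} (\<lambda>s. f s * ek (-k) s) / (2 * pi))
      = f t + (G (- int n - 1) - G (int n)) / (2 * pi)" for n
  proof (induction n)
    case 0
    then show ?case using tele[of 0] by (simp add: field_simps)
  next
    case (Suc n)
    have "{-int (Suc n)..int (Suc n)} = insert (- int (Suc n)) (insert (int (Suc n)) {-int n..int n})"
      by auto
    moreover have c: "- 1 - int n = - int n - 1" by simp
    ultimately show ?case
      using Suc by (simp add: c tele add_divide_distrib diff_divide_distrib)
  qed
  moreover have "(\<lambda>n. f t + (G (- int n - 1) - G (int n)) / (2 * pi)) \<longlonglongrightarrow> f t + (0 - 0) / (2 * pi)"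
  proof -
    \<comment> \<open>After telescoping only two values of \<open>G\<close> remain, and both tend to
      0 by the Riemann-Lebesgue lemma.\<close>
    have G0: "(\<lambda>n. G (k n)) \<longlonglongrightarrow> 0" if "\<And>n. real n \<le> \<bar>real_of_int (k n)\<bar>" for k :: "nat \<Rightarrow> int"
    proof (rule LIMSEQ_I)
      fix e :: real assume "e > 0"
      then obtain N where N: "\<And>k. N \<le> \<bar>real_of_int k\<bar> \<Longrightarrow> norm (integral {-pi..pi} (\<lambda>s. g s * ek k s)) < e"
        using riemann_lebesgue[of "-pi" pi g e] cont by auto
      obtain n0 where n0: "N \<le> real n0" using real_arch_simple by blast
      have "norm (G (k n) - 0) < e" if "n \<ge> n0" for n
      proof -
        have "N \<le> \<bar>real_of_int (- k n)\<bar>" using n0 that \<open>\<And>n. real n \<le> \<bar>real_of_int (k n)\<bar>\<close>[of n] by simp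
        from N[OF this] have "norm (integral {-pi..pi} (\<lambda>s. g s * ek (- k n) s)) < e" .
        moreover have "G (k n) = integral {-pi..pi} (\<lambda>s. g s * ek (- k n) s) * ek (- k n) (- t)"
          unfolding G_def
          using ek_add(2)[of "- k n" _ "- t"]
          by (subst integral_mult_left[symmetric]) (auto simp: mult_ac)
        ultimately show ?thesis by (simp add: norm_mult)
      qed
      then show "\<exists>no. \<forall>n\<ge>no. norm (G (k n) - 0) < e" by blast
    qed
    have "(\<lambda>n. G (- int n - 1)) \<longlonglongrightarrow> 0" "(\<lambda>n. G (int n)) \<longlonglongrightarrow> 0"
      by (rule G0, simp)+
    from tendsto_diff[OF this] show ?thesis
      by (intro tendsto_add tendsto_divide tendsto_const) auto
  qed
  ultimately show ?thesis by simp
qed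

section \<open>Fourier components in a coordinate direction\<close>

lemma smooth_frechet_derivative:
  assumes "smooth f"
  shows "frechet_derivative f (at y) v = (\<Sum>b\<in>Basis. (v \<bullet> b) *\<^sub>R dpart b f y)"
proof -
  interpret linear "frechet_derivative f (at y)"
    using smooth_has_derivative[OF assms, of y] unfolding dpart_def by (rule has_derivative_linear)
  have "frechet_derivative f (at y) v = frechet_derivative f (at y) (\<Sum>b\<in>Basis. (v \<bullet> b) *\<^sub>R b)"
    by (simp add: euclidean_representation)
  then show ?thesis by (simp add: sum scale dpart_def)
qed

text \<open>The argument \<open>T x + \<gamma> s\<close> covers two cases: \<open>T\<close> the map
  removing the \<open>b\<close> coordinate, for Fourier components, and \<open>T\<close> the
  identity, for rays. The Leibniz rule requires a continuous operator-valued derivative, hence the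
  detour through \<open>Blinfun\<close> with continuity checked direction by direction.\<close>

lemma has_derivative_param_integral:
  fixes f :: "'a::euclidean_space \<Rightarrow> complex" and T :: "'a \<Rightarrow> 'a" and a b :: real
  assumes "smooth f" "bounded_linear T" "continuous_on {a..b} \<gamma>" "continuous_on {a..b} p"
  shows "((\<lambda>x. integral {a..b} (\<lambda>s. p s * f (T x + \<gamma> s))) has_derivative
    (\<lambda>h. integral {a..b} (\<lambda>s. p s * dpart (T h) f (T x + \<gamma> s)))) (at x)"
proof -
  define D where "D x s = (\<lambda>h. p s * dpart (T h) f (T x + \<gamma> s))" for x s
  define fx where "fx x s = Blinfun (D x s)" for x s
  have der: "((\<lambda>x. p s * f (T x + \<gamma> s)) has_derivative D x s) (at x)" for x s
  proof -
    have "((\<lambda>x. T x + \<gamma> s) has_derivative T) (at x)"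
      using bounded_linear_imp_has_derivative[OF assms(2)] by (auto intro!: derivative_eq_intros)
    from has_derivative_compose[OF this smooth_has_derivative[OF assms(1)]]
    show ?thesis
      unfolding D_def by (rule has_derivative_mult_right)
  qed
  have fx: "blinfun_apply (fx x s) = D x s" for x s
    unfolding fx_def by (rule bounded_linear_Blinfun_apply[OF has_derivative_bounded_linear[OF der]])
  have cp: "continuous_on (UNIV \<times> {a..b}) (\<lambda>z. T (fst z) + \<gamma> (snd z))"
  proof (rule continuous_on_add)
    show "continuous_on (UNIV \<times> {a..b}) (\<lambda>z. T (fst z))"
      by (intro bounded_linear.continuous_on[OF assms(2)] continuous_on_fst continuous_on_id)
    show "continuous_on (UNIV \<times> {a..b}) (\<lambda>z. \<gamma> (snd z))"
      by (rule continuous_on_compose2[OF assms(3) continuous_on_snd[OF continuous_on_id]]) auto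
  qed
  have cpt: "continuous_on (UNIV \<times> {a..b}) (\<lambda>z. p (snd z))"
    by (rule continuous_on_compose2[OF assms(4) continuous_on_snd[OF continuous_on_id]]) auto
  have cd: "continuous_on (UNIV \<times> {a..b}) (\<lambda>z. dpart e f (T (fst z) + \<gamma> (snd z)))" if "e \<in> Basis" for e
    by (rule continuous_on_compose2[OF smooth_continuous_on[OF smooth_dpart[OF assms(1) that]] cp subset_UNIV])
  have cont: "continuous_on (UNIV \<times> {a..b}) (\<lambda>z. D (fst z) (snd z) i)" for i
    unfolding D_def dpart_def[of "T i"] smooth_frechet_derivative[OF assms(1)]
    by (intro continuous_on_mult cpt continuous_on_sum continuous_on_scaleR continuous_on_const cd)
  have cfx: "continuous_on (UNIV \<times> {a..b}) (\<lambda>z. fx (fst z) (snd z))"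
    by (rule continuous_on_blinfun_componentwise) (simp add: fx cont)
  have ci: "continuous_on {a..b} (\<lambda>s. fx x s)" for x
  proof -
    have "continuous_on {a..b} (\<lambda>s. (x, s))"
      by (intro continuous_on_Pair continuous_on_const continuous_on_id)
    moreover have "(\<lambda>s. (x, s)) ` {a..b} \<subseteq> UNIV \<times> {a..b}" by auto
    ultimately show ?thesis
      using continuous_on_compose2[OF cfx, of "{a..b}" "\<lambda>s. (x, s)"] by simp
  qed
  have "((\<lambda>x. integral (cbox a b) (\<lambda>s. p s * f (T x + \<gamma> s))) has_derivative
      integral (cbox a b) (fx x)) (at x within UNIV)"
  proof (rule leibniz_rule)
    show "(\<lambda>s. p s * f (T x + \<gamma> s)) integrable_on cbox a b" for x
      unfolding box_real
      by (intro integrable_continuous_real continuous_intros assms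
          continuous_on_compose2[OF smooth_continuous_on[OF assms(1)]]) auto
    show "continuous_on (UNIV \<times> cbox a b) (\<lambda>(x, t). fx x t)"
      using cfx by (simp add: case_prod_beta)
  qed (auto simp: fx der)
  moreover have "blinfun_apply (integral (cbox a b) (fx x)) h = integral {a..b} (\<lambda>s. D x s h)" for h
    using integral_linear[OF integrable_continuous_real[OF ci] blinfun.bounded_linear_left, of h x]
    unfolding box_real by (simp add: o_def fx)
  ultimately show ?thesis
    unfolding D_def box_real by (auto intro: has_derivative_eq_rhs)
qed

text \<open>A partial derivative of the integral is a linear combination of integrals of the same
  shape with partial derivatives of \<open>f\<close> inside, so the induction on the order runs over
  all smooth \<open>f\<close>.\<close>

lemma smooth_param_integral:
  fixes f :: "'a::euclidean_space \<Rightarrow> complex" and T :: "'a \<Rightarrow> 'a" and a b :: real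
  assumes "bounded_linear T" "continuous_on {a..b} \<gamma>" "continuous_on {a..b} p" "smooth f"
  shows "smooth (\<lambda>x. integral {a..b} (\<lambda>s. p s * f (T x + \<gamma> s)))"
proof -
  have "smooth_upto n (\<lambda>x. integral {a..b} (\<lambda>s. p s * f (T x + \<gamma> s)))" if "smooth f" for n f
    using that
  proof (induction n arbitrary: f)
    case (Suc n)
    note d = has_derivative_param_integral[OF Suc.prems assms(1-3)]
    have eq: "dpart c (\<lambda>x. integral {a..b} (\<lambda>s. p s * f (T x + \<gamma> s))) =
        (\<lambda>x. \<Sum>e\<in>Basis. complex_of_real (T c \<bullet> e) * integral {a..b} (\<lambda>s. p s * dpart e f (T x + \<gamma> s)))" for c
    proof
      fix x
      have int: "(\<lambda>s. p s * dpart e f (T x + \<gamma> s)) integrable_on {a..b}" if "e \<in> Basis" for e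
        by (intro integrable_continuous_real continuous_intros assms
            continuous_on_compose2[OF smooth_continuous_on[OF smooth_dpart[OF Suc.prems that]]]) auto
      have "dpart c (\<lambda>x. integral {a..b} (\<lambda>s. p s * f (T x + \<gamma> s))) x =
          integral {a..b} (\<lambda>s. p s * dpart (T c) f (T x + \<gamma> s))"
        by (rule dpart_eqI[OF d])
      also have "\<dots> = integral {a..b} (\<lambda>s. \<Sum>e\<in>Basis. complex_of_real (T c \<bullet> e) * (p s * dpart e f (T x + \<gamma> s)))"
        by (simp add: dpart_def[of "T c"] smooth_frechet_derivative[OF Suc.prems] scaleR_conv_of_real sum_distrib_left mult_ac)
      also have "\<dots> = (\<Sum>e\<in>Basis. complex_of_real (T c \<bullet> e) * integral {a..b} (\<lambda>s. p s * dpart e f (T x + \<gamma> s)))"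
        by (subst integral_sum) (auto intro!: integrable_on_mult_right int)
      finally show "dpart c (\<lambda>x. integral {a..b} (\<lambda>s. p s * f (T x + \<gamma> s))) x = \<dots>" .
    qed
    have sum: "smooth_upto n (\<lambda>x. \<Sum>e\<in>I. F e x)" if "\<And>e. e \<in> I \<Longrightarrow> smooth_upto n (F e)" for F :: "'a \<Rightarrow> 'a \<Rightarrow> complex" and I
      using that by (induction I rule: infinite_finite_induct) (auto intro!: smooth_upto_add)
    show ?case
    proof (rule smooth_upto_SucI)
      show "(\<lambda>x. integral {a..b} (\<lambda>s. p s * f (T x + \<gamma> s))) differentiable (at x)" for x
        using d differentiable_def by blast
      show "smooth_upto n (dpart c (\<lambda>x. integral {a..b} (\<lambda>s. p s * f (T x + \<gamma> s))))" for c
        unfolding eq by (intro sum smooth_upto_mult smooth_upto_const Suc.IH smooth_dpart Suc.prems)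
    qed
  qed simp
  then show ?thesis using assms(4) by (simp add: smooth_iff_upto)
qed

lemma deriv_bound_outside:
  assumes "deriv_bound K n f A" "tsupport f \<subseteq> K" "0 \<le> A"
  shows "deriv_bound UNIV n f A"
  unfolding deriv_bound_def
proof (intro allI impI ballI)
  fix bs :: "'a list" and x assume bs: "set bs \<subseteq> Basis" "length bs \<le> n"
  show "norm (pderivs bs f x) \<le> A"
  proof (cases "x \<in> tsupport f")
    case True
    then show ?thesis using deriv_boundD[OF assms(1) bs] assms(2) by blast
  next
    case False
    then have "pderivs bs f x = 0"
      by (intro pderivs_vanish[of "- tsupport f"]) (auto simp: not_in_tsupport open_Compl)
    then show ?thesis using assms(3) by simp
  qed
qed

text \<open>The expansion destroys compact support one coordinate after the other. Confinement in a
  single coordinate is what integration by parts in that coordinate needs, and it survives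
  expansions in the other coordinates.\<close>

definition slab :: "real \<Rightarrow> 'a::euclidean_space \<Rightarrow> ('a \<Rightarrow> complex) \<Rightarrow> bool" where
  "slab R b f \<longleftrightarrow> (\<forall>x. R < \<bar>x \<bullet> b\<bar> \<longrightarrow> f x = 0)"

lemma slab_pderivs: "slab R b f \<Longrightarrow> slab R b (pderivs bs f)"
  unfolding slab_def
  by (auto intro!: pderivs_vanish[of "{x. R < \<bar>x \<bullet> b\<bar>}"] open_Collect_less continuous_intros)

text \<open>The component of frequency \<open>k/r\<close> in the direction \<open>b\<close> of the Fourier series of \<open>f\<close>.\<close>

definition fproj :: "real \<Rightarrow> 'a::euclidean_space \<Rightarrow> int \<Rightarrow> ('a \<Rightarrow> complex) \<Rightarrow> 'a \<Rightarrow> complex" where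
  "fproj r b k f x = exp (\<i> * complex_of_real (x \<bullet> ((of_int k / r) *\<^sub>R b))) / (2 * pi) *
     integral {-pi..pi} (\<lambda>s. ek (-k) s * f ((x - (x \<bullet> b) *\<^sub>R b) + (r * s) *\<^sub>R b))"

lemma bounded_linear_reject: "bounded_linear (\<lambda>x::'a::euclidean_space. x - (x \<bullet> b) *\<^sub>R b)"
  by (intro bounded_linear_sub bounded_linear_ident bounded_linear_scaleR_const bounded_linear_inner_left)

lemma smooth_fproj:
  assumes "smooth f" shows "smooth (fproj r b k f)"
proof -
  have "smooth (\<lambda>x. exp (\<i> * complex_of_real (x \<bullet> ((of_int k / r) *\<^sub>R b))) * (1 / (2 * pi)))"
    by (intro smooth_mult smooth_exp smooth_const)
  moreover have "smooth (\<lambda>x. integral {-pi..pi} (\<lambda>s. ek (-k) s * f ((x - (x \<bullet> b) *\<^sub>R b) + (r * s) *\<^sub>R b)))"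
    by (intro smooth_param_integral bounded_linear_reject assms continuous_intros)
  ultimately show ?thesis
    using smooth_mult unfolding fproj_def[abs_def] by fastforce
qed

lemma dpart_smooth_0: "smooth f \<Longrightarrow> dpart 0 f x = 0"
  by (simp add: dpart_def smooth_frechet_derivative)

text \<open>Integration by parts along \<open>b\<close>; the boundary terms vanish because
  \<open>\<bar>s\<bar> = pi\<close> corresponds to a coordinate of modulus
  \<open>r * pi > R\<close>, outside the slab.\<close>

lemma fproj_dpart_self:
  fixes f :: "'a::euclidean_space \<Rightarrow> complex"
  assumes "smooth f" "slab R b f" "R < r * pi" "r > 0" "b \<in> Basis"
  shows "fproj r b k (dpart b f) = (\<lambda>x. \<i> * of_int k / r * fproj r b k f x)"
proof
  fix x
  define y where "y = x - (x \<bullet> b) *\<^sub>R b"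
  have yb: "y \<bullet> b = 0" using assms(5) by (simp add: y_def inner_diff_left)
  have van: "f (y + (r * s) *\<^sub>R b) = 0" if "\<bar>s\<bar> = pi" for s
  proof -
    have "\<bar>(y + (r * s) *\<^sub>R b) \<bullet> b\<bar> = r * pi"
      using that assms(4,5) yb by (simp add: inner_add_left abs_mult)
    then show ?thesis using assms(2,3) unfolding slab_def by metis
  qed
  have der: "((\<lambda>s. f (y + (r * s) *\<^sub>R b)) has_vector_derivative (r * dpart b f (y + (r * s) *\<^sub>R b))) (at s)" for s
  proof -
    have "((\<lambda>s. y + (r * s) *\<^sub>R b) has_derivative (\<lambda>h. (r * h) *\<^sub>R b)) (at s)"
      by (auto intro!: derivative_eq_intros)
    from has_derivative_compose[OF this smooth_has_derivative[OF assms(1)]]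
    have "((\<lambda>s. f (y + (r * s) *\<^sub>R b)) has_derivative (\<lambda>h. dpart ((r * h) *\<^sub>R b) f (y + (r * s) *\<^sub>R b))) (at s)" .
    moreover have "dpart (c *\<^sub>R b) f z = c *\<^sub>R dpart b f z" for c z
      using linear_scale[OF has_derivative_linear[OF smooth_has_derivative[OF assms(1)]]] by blast
    ultimately show ?thesis
      by (simp add: has_vector_derivative_def scaleR_conv_of_real mult_ac)
  qed
  have "integral {-pi..pi} (\<lambda>s. (r * dpart b f (y + (r * s) *\<^sub>R b)) * ek (-k) s) =
      \<i> * of_int k * integral {-pi..pi} (\<lambda>s. f (y + (r * s) *\<^sub>R b) * ek (-k) s)"
    using assms(1,5) van[of pi] van[of "- pi"]
    by (subst by_parts_ek[OF _ der])
      (auto intro!: continuous_intros continuous_on_compose2[OF smooth_continuous_on[OF smooth_dpart]])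
  moreover have "integral {-pi..pi} (\<lambda>s. (r * dpart b f (y + (r * s) *\<^sub>R b)) * ek (-k) s) =
      r * integral {-pi..pi} (\<lambda>s. ek (-k) s * dpart b f (y + (r * s) *\<^sub>R b))"
    by (subst integral_mult_right[symmetric]) (simp add: mult_ac)
  ultimately have "integral {-pi..pi} (\<lambda>s. ek (-k) s * dpart b f (y + (r * s) *\<^sub>R b)) =
      \<i> * of_int k / r * integral {-pi..pi} (\<lambda>s. ek (-k) s * f (y + (r * s) *\<^sub>R b))"
    using assms(4) by (simp add: field_simps)
  then show "fproj r b k (dpart b f) x = \<i> * of_int k / r * fproj r b k f x"
    by (simp add: fproj_def y_def mult_ac)
qed

text \<open>For \<open>c = b\<close> the integral does not depend on the coordinate along
  \<open>b\<close>, so the derivative falls on the exponential and gives the factor of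
  \<open>fproj_dpart_self\<close>. For \<open>c \<noteq> b\<close> the exponential is constant along
  \<open>c\<close> and the derivative passes under the integral.\<close>

lemma dpart_fproj:
  fixes f :: "'a::euclidean_space \<Rightarrow> complex"
  assumes "smooth f" "slab R b f" "R < r * pi" "r > 0" "b \<in> Basis" "c \<in> Basis"
  shows "dpart c (fproj r b k f) = fproj r b k (dpart c f)"
proof
  fix x
  define E where "E x = exp (\<i> * complex_of_real (x \<bullet> ((of_int k / r) *\<^sub>R b)))" for x
  define J where "J f x = integral {-pi..pi} (\<lambda>s. ek (-k) s * f ((x - (x \<bullet> b) *\<^sub>R b) + (r * s) *\<^sub>R b))" for x and f :: "'a \<Rightarrow> complex"
  have fp: "fproj r b k f = (\<lambda>x. E x * (1 / (2 * pi) * J f x))" for f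
    by (simp add: fproj_def[abs_def] E_def J_def)
  have dE: "dpart c E x = \<i> * complex_of_real (c \<bullet> ((of_int k / r) *\<^sub>R b)) * E x"
    unfolding E_def dpart_exp by simp
  have dJ: "dpart c (J f) x = integral {-pi..pi} (\<lambda>s. ek (-k) s * dpart (c - (c \<bullet> b) *\<^sub>R b) f ((x - (x \<bullet> b) *\<^sub>R b) + (r * s) *\<^sub>R b))"
    unfolding J_def
    by (rule dpart_eqI) (intro has_derivative_param_integral assms bounded_linear_reject continuous_intros)
  have sE: "smooth E" unfolding E_def by (rule smooth_exp)
  have sJ: "smooth (J f)"
    unfolding J_def by (intro smooth_param_integral bounded_linear_reject assms continuous_intros)
  have sJ': "smooth (\<lambda>x. 1 / (2 * pi) * J f x)"
    by (intro smooth_mult smooth_const sJ)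
  have dJ': "dpart c (\<lambda>x. 1 / (2 * pi) * J f x) x = 1 / (2 * pi) * dpart c (J f) x"
    by (rule dpart_linear[OF bounded_linear_mult_right smooth_differentiable[OF sJ]])
  have eq: "dpart c (fproj r b k f) x = E x * (1 / (2 * pi) * dpart c (J f) x) + dpart c E x * (1 / (2 * pi) * J f x)"
    unfolding fp dpart_mult[OF smooth_differentiable[OF sE] smooth_differentiable[OF sJ']] dJ' ..
  show "dpart c (fproj r b k f) x = fproj r b k (dpart c f) x"
  proof (cases "c = b")
    case True
    then have "dpart c (J f) x = 0"
      using dJ assms(5) by (simp add: dpart_smooth_0[OF assms(1)])
    with eq have "dpart c (fproj r b k f) x = dpart c E x * (1 / (2 * pi) * J f x)" by simp
    also have "\<dots> = \<i> * of_int k / r * fproj r b k f x"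
      unfolding dE using True assms(5) by (simp add: fp)
    also have "\<dots> = fproj r b k (dpart b f) x"
      by (simp add: fproj_dpart_self[OF assms(1-5)])
    finally show ?thesis using True by simp
  next
    case False
    then have "c \<bullet> b = 0" using assms(5,6) inner_not_same_Basis by blast
    then have "dpart c (J f) x = J (dpart c f) x" "dpart c E x = 0"
      by (simp_all add: dJ dE J_def)
    then show ?thesis
      by (simp only: eq) (simp add: fp)
  qed
qed

lemma pderivs_fproj:
  fixes f :: "'a::euclidean_space \<Rightarrow> complex"
  assumes "smooth f" "slab R b f" "R < r * pi" "r > 0" "b \<in> Basis" "set bs \<subseteq> Basis"
  shows "pderivs bs (fproj r b k f) = fproj r b k (pderivs bs f)"
  using assms(6)
proof (induction bs)
  case (Cons c cs)
  then show ?case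
    using dpart_fproj[OF smooth_pderivs[OF assms(1)] slab_pderivs[OF assms(2)] assms(3-5)] by simp
qed simp

lemma fproj_replicate:
  fixes f :: "'a::euclidean_space \<Rightarrow> complex"
  assumes "smooth f" "slab R b f" "R < r * pi" "r > 0" "b \<in> Basis"
  shows "fproj r b k (pderivs (replicate p b) f) x = (\<i> * of_int k / r) ^ p * fproj r b k f x"
proof (induction p)
  case (Suc p)
  have "set (replicate p b) \<subseteq> Basis" using assms(5) by auto
  from fproj_dpart_self[OF smooth_pderivs[OF assms(1) this] slab_pderivs[OF assms(2)] assms(3-5)] Suc
  show ?case by simp
qed simp

lemma norm_fproj_le:
  assumes "smooth f" "\<And>x. norm (f x) \<le> A"
  shows "norm (fproj r b k f x) \<le> A"
proof -
  have "norm (integral {-pi..pi} (\<lambda>s. ek (-k) s * f ((x - (x \<bullet> b) *\<^sub>R b) + (r * s) *\<^sub>R b))) \<le> A * (pi - - pi)"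
    by (intro norm_integral_le continuous_intros continuous_on_compose2[OF smooth_continuous_on[OF assms(1)]])
      (auto simp: norm_mult assms(2))
  then show ?thesis
    by (simp add: fproj_def norm_mult norm_divide field_simps)
qed

text \<open>Differentiating \<open>p\<close> times along \<open>b\<close> multiplies by a number of
  modulus \<open>(\<bar>k\<bar> / r) ^ p\<close>. The 2 comes from
  \<open>1 + \<bar>k\<bar> \<le> 2 * \<bar>k\<bar>\<close> for nonzero \<open>k\<close>;
  \<open>r \<ge> 1\<close> covers \<open>k = 0\<close>.\<close>

lemma norm_fproj_decay:
  fixes f :: "'a::euclidean_space \<Rightarrow> complex"
  assumes "smooth f" "slab R b f" "R < r * pi" "r \<ge> 1" "b \<in> Basis" "deriv_bound UNIV p f A"
  shows "norm (fproj r b k f x) \<le> (2 * r) ^ p * A / (1 + \<bar>real_of_int k\<bar>) ^ p"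
proof -
  have A: "norm (fproj r b k (pderivs (replicate j b) f) x) \<le> A" if "j \<le> p" for j
    using that assms(5)
    by (intro norm_fproj_le smooth_pderivs assms deriv_boundD[OF assms(6)]) auto
  have "norm (fproj r b k f x) \<le> A" using A[of 0] by simp
  then have A0: "A \<ge> 0" using norm_ge_zero order_trans by blast
  have Ap: "(\<bar>real_of_int k\<bar> / r) ^ p * norm (fproj r b k f x) \<le> A"
    using A[of p] assms(4) fproj_replicate[OF assms(1-3) _ assms(5), of k p x]
    by (simp add: norm_mult norm_power norm_divide)
  have "(1 + \<bar>real_of_int k\<bar>) ^ p * norm (fproj r b k f x) \<le> (2 * r) ^ p * A"
  proof (cases "k = 0")
    case True
    have "1 \<le> (2 * r) ^ p" using assms(4) by (intro one_le_power) auto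
    then show ?thesis
      using True mult_mono[of 1 "(2 * r) ^ p" "norm (fproj r b k f x)" A] \<open>norm (fproj r b k f x) \<le> A\<close> A0 by simp
  next
    case False
    then have "1 \<le> \<bar>real_of_int k\<bar>" by linarith
    then have "(1 + \<bar>real_of_int k\<bar>) ^ p \<le> (2 * \<bar>real_of_int k\<bar>) ^ p"
      by (intro power_mono) auto
    then have "(1 + \<bar>real_of_int k\<bar>) ^ p * norm (fproj r b k f x) \<le> (2 * \<bar>real_of_int k\<bar>) ^ p * norm (fproj r b k f x)"
      by (rule mult_right_mono) simp
    also have "\<dots> = (2 * r) ^ p * ((\<bar>real_of_int k\<bar> / r) ^ p * norm (fproj r b k f x))"
      using assms(4) by (simp add: power_mult_distrib power_divide)
    also have "\<dots> \<le> (2 * r) ^ p * A"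
      using assms(4) by (intro mult_left_mono Ap) auto
    finally show ?thesis .
  qed
  then show ?thesis by (simp add: field_simps)
qed

text \<open>Since \<open>fproj\<close> commutes with derivatives, \<open>p\<close> of the available
  ones buy decay in \<open>k\<close> and the other \<open>M\<close> are kept for the estimate of the
  component.\<close>

lemma deriv_bound_fproj:
  fixes f :: "'a::euclidean_space \<Rightarrow> complex"
  assumes "smooth f" "slab R b f" "R < r * pi" "r \<ge> 1" "b \<in> Basis" "deriv_bound UNIV (M + p) f A"
  shows "deriv_bound UNIV M (fproj r b k f) ((2 * r) ^ p * A / (1 + \<bar>real_of_int k\<bar>) ^ p)"
  unfolding deriv_bound_def
proof (intro allI impI ballI)
  fix bs :: "'a list" and x assume bs: "set bs \<subseteq> Basis" "length bs \<le> M"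
  have "deriv_bound UNIV p (pderivs bs f) A"
    unfolding deriv_bound_def
    using bs deriv_boundD[OF assms(6), of "_ @ bs"] by (auto simp: pderivs_append)
  from norm_fproj_decay[OF smooth_pderivs[OF assms(1) bs(1)] slab_pderivs[OF assms(2)] assms(3-5) this]
  show "norm (pderivs bs (fproj r b k f) x) \<le> (2 * r) ^ p * A / (1 + \<bar>real_of_int k\<bar>) ^ p"
    using pderivs_fproj[OF assms(1-3) _ assms(5) bs(1), of k] assms(4) by simp
qed

text \<open>On the line through \<open>x\<close> in direction \<open>b\<close>, rescaled by
  \<open>r\<close>, this is the one-dimensional series at the interior point
  \<open>(x \<bullet> b) / r\<close>.\<close>

lemma fproj_sums:
  fixes f :: "'a::euclidean_space \<Rightarrow> complex"
  assumes "smooth f" "r > 0" "\<bar>x \<bullet> b\<bar> < r * pi"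
  shows "(\<lambda>n. \<Sum>k\<in>{-int n..int n}. fproj r b k f x) \<longlonglongrightarrow> f x"
proof -
  define g where "g s = f ((x - (x \<bullet> b) *\<^sub>R b) + (r * s) *\<^sub>R b)" for s
  define t where "t = (x \<bullet> b) / r"
  have "((\<lambda>s. (x - (x \<bullet> b) *\<^sub>R b) + (r * s) *\<^sub>R b) has_vector_derivative (r *\<^sub>R b)) (at t)"
    by (auto intro!: derivative_eq_intros simp: has_vector_derivative_def mult_ac)
  then have "(\<lambda>s. (x - (x \<bullet> b) *\<^sub>R b) + (r * s) *\<^sub>R b) differentiable (at t)"
    by (rule differentiableI_vector)
  then have "(f \<circ> (\<lambda>s. (x - (x \<bullet> b) *\<^sub>R b) + (r * s) *\<^sub>R b)) differentiable (at t)"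
    by (intro differentiable_chain_at smooth_differentiable[OF assms(1)])
  then obtain g' where g': "(g has_vector_derivative g') (at t)"
    unfolding g_def o_def by (auto simp: vector_derivative_works)
  have cont: "continuous_on {-pi..pi} g"
    unfolding g_def
    by (intro continuous_intros continuous_on_compose2[OF smooth_continuous_on[OF assms(1)]]) auto
  have "\<bar>t\<bar> < pi" using assms by (simp add: t_def abs_divide pos_divide_less_eq mult.commute)
  from fourier_series_pointwise[OF cont g' this]
  have "(\<lambda>n. \<Sum>k\<in>{-int n..int n}. ek k t * integral {-pi..pi} (\<lambda>s. g s * ek (-k) s) / (2 * pi)) \<longlonglongrightarrow> g t" .
  moreover have "ek k t * integral {-pi..pi} (\<lambda>s. g s * ek (-k) s) / (2 * pi) = fproj r b k f x" for k
    by (simp add: fproj_def g_def t_def ek_conv_exp mult_ac)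
  moreover have "g t = f x" using assms(2) by (simp add: g_def t_def)
  ultimately show ?thesis by simp
qed

section \<open>Rate of convergence of the truncated expansion\<close>

lemma sum_symmetric_Suc:
  fixes F :: "int \<Rightarrow> 'b::comm_monoid_add"
  shows "(\<Sum>k\<in>{-int (Suc n)..int (Suc n)}. F k) =
    (\<Sum>k\<in>{-int n..int n}. F k) + (F (int (Suc n)) + F (- int (Suc n)))"
proof -
  have "{-int (Suc n)..int (Suc n)} = insert (- int (Suc n)) (insert (int (Suc n)) {-int n..int n})"
    by auto
  then show ?thesis by (simp add: ac_simps)
qed

lemma inverse_square_step: "1 / (2 + real n)\<^sup>2 \<le> 1 / (1 + real n) - 1 / (2 + real n)"
proof -
  have "1 / (2 + real n)\<^sup>2 \<le> 1 / ((1 + real n) * (2 + real n))"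
    by (rule frac_le) (auto simp: power2_eq_square algebra_simps intro: add_pos_nonneg)
  also have "\<dots> = 1 / (1 + real n) - 1 / (2 + real n)"
    by (simp add: divide_simps)
  finally show ?thesis .
qed

text \<open>The term \<open>k = 0\<close> gives 1 and the pairs \<open>k\<close>, \<open>-k\<close>
  telescope through \<open>inverse_square_step\<close>; the sharper bound
  \<open>3 - 2 / (1 + n)\<close> carries the induction.\<close>

lemma sum_inverse_squares: "(\<Sum>k\<in>{-int n..int n}. 1 / (1 + \<bar>real_of_int k\<bar>)\<^sup>2) \<le> 3"
proof -
  have "(\<Sum>k\<in>{-int n..int n}. 1 / (1 + \<bar>real_of_int k\<bar>)\<^sup>2) \<le> 3 - 2 * (1 / (1 + real n))"
  proof (induction n)
    case (Suc n)
    have "(\<Sum>k\<in>{-int (Suc n)..int (Suc n)}. 1 / (1 + \<bar>real_of_int k\<bar>)\<^sup>2) =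
        (\<Sum>k\<in>{-int n..int n}. 1 / (1 + \<bar>real_of_int k\<bar>)\<^sup>2) + 2 * (1 / (2 + real n)\<^sup>2)"
      unfolding sum_symmetric_Suc by simp
    moreover have "1 + real (Suc n) = 2 + real n" by simp
    ultimately show ?case
      using Suc inverse_square_step[of n] by (simp only:)
  qed simp
  also have "\<dots> \<le> 3" by simp
  finally show ?thesis .
qed

text \<open>Pointwise convergence alone has no rate. Quadratic decay of the components makes the
  block between \<open>n\<close> and \<open>n + m\<close> of order \<open>1 / n\<close>, uniformly
  in \<open>m\<close>; letting \<open>m\<close> grow brings in \<open>f x\<close>.\<close>

lemma fproj_tail:
  fixes f :: "'a::euclidean_space \<Rightarrow> complex"
  assumes "smooth f" "slab R b f" "R < r * pi" "r \<ge> 1" "b \<in> Basis" "deriv_bound UNIV 2 f A"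
    and x: "\<bar>x \<bullet> b\<bar> < r * pi"
  shows "norm (f x - (\<Sum>k\<in>{-int n..int n}. fproj r b k f x)) \<le> 2 * ((2 * r)\<^sup>2 * A) / (real n + 1)"
proof -
  define S where "S m = (\<Sum>k\<in>{-int m..int m}. fproj r b k f x)" for m
  define D where "D = (2 * r)\<^sup>2 * A"
  have D: "norm (fproj r b k f x) \<le> D * (1 / (1 + \<bar>real_of_int k\<bar>)\<^sup>2)" for k
    using norm_fproj_decay[OF assms(1-6)] by (simp add: D_def)
  have D0: "D \<ge> 0" using order_trans[OF norm_ge_zero D[of 0]] by simp
  have step: "norm (S (n + m) - S n) \<le> 2 * D * (1 / (1 + real n) - 1 / (1 + real (n + m)))" for m
  proof (induction m)
    case (Suc m)
    let ?F = "\<lambda>k. fproj r b k f x"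
    have "S (n + Suc m) - S n = (S (n + m) - S n) + (?F (int (Suc (n + m))) + ?F (- int (Suc (n + m))))"
      using sum_symmetric_Suc[of ?F "n + m"] by (simp add: S_def)
    then have "norm (S (n + Suc m) - S n) \<le> norm (S (n + m) - S n) +
        (norm (?F (int (Suc (n + m)))) + norm (?F (- int (Suc (n + m)))))"
      by (metis add_left_mono norm_triangle_ineq norm_triangle_le)
    also have "norm (?F (int (Suc (n + m)))) + norm (?F (- int (Suc (n + m)))) \<le> 2 * D * (1 / (2 + real (n + m))\<^sup>2)"
      using D[of "int (Suc (n + m))"] D[of "- int (Suc (n + m))"] by simp
    also have "\<dots> \<le> 2 * D * (1 / (1 + real (n + m)) - 1 / (2 + real (n + m)))"
      using D0 by (intro mult_left_mono inverse_square_step) auto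
    finally have "norm (S (n + Suc m) - S n) \<le> norm (S (n + m) - S n) + 2 * D * (1 / (1 + real (n + m)) - 1 / (2 + real (n + m)))"
      by simp
    also have "\<dots> \<le> 2 * D * (1 / (1 + real n) - 1 / (1 + real (n + m))) + 2 * D * (1 / (1 + real (n + m)) - 1 / (2 + real (n + m)))"
      using Suc by simp
    also have "\<dots> = 2 * D * (1 / (1 + real n) - 1 / (1 + real (n + Suc m)))"
      unfolding distrib_left[symmetric] by simp
    finally show ?case .
  qed simp
  have "norm (S (m + n) - S n) \<le> 2 * D / (real n + 1)" for m
  proof -
    have "2 * D * (1 / (1 + real n) - 1 / (1 + real (n + m))) \<le> 2 * D * (1 / (1 + real n))"
      using D0 by (intro mult_left_mono) auto
    then show ?thesis using step[of m] by (simp add: add.commute)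
  qed
  moreover have "(\<lambda>m. norm (S (m + n) - S n)) \<longlonglongrightarrow> norm (f x - S n)"
    using LIMSEQ_ignore_initial_segment[OF fproj_sums[OF assms(1) _ x], of n] assms(4)
    unfolding S_def by (intro tendsto_intros) auto
  ultimately have "norm (f x - S n) \<le> 2 * D / (real n + 1)"
    by (intro LIMSEQ_le_const2[where a = "2 * D / (real n + 1)"]) auto
  then show ?thesis by (simp add: S_def D_def)
qed

text \<open>Restricted to a strip because the partial sums are periodic along \<open>b\<close> with
  period \<open>2 * r * pi\<close>, while \<open>f\<close> vanishes far out. The strip will contain
  the support of the cutoff \<open>\<phi>\<close>.\<close>

lemma deriv_bound_fproj_tail:
  fixes f :: "'a::euclidean_space \<Rightarrow> complex"
  assumes "smooth f" "slab R b f" "R < r * pi" "r \<ge> 1" "b \<in> Basis" "deriv_bound UNIV (M + 2) f A"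
  shows "deriv_bound {x. \<bar>x \<bullet> b\<bar> < r * pi} M (\<lambda>x. f x - (\<Sum>k\<in>{-int n..int n}. fproj r b k f x))
    (2 * ((2 * r)\<^sup>2 * A) / (real n + 1))"
  unfolding deriv_bound_def
proof (intro allI impI ballI)
  fix bs :: "'a list" and x assume bs: "set bs \<subseteq> Basis" "length bs \<le> M" and x: "x \<in> {x. \<bar>x \<bullet> b\<bar> < r * pi}"
  have "deriv_bound UNIV 2 (pderivs bs f) A"
    unfolding deriv_bound_def
    using bs deriv_boundD[OF assms(6), of "_ @ bs"] by (auto simp: pderivs_append)
  from fproj_tail[OF smooth_pderivs[OF assms(1) bs(1)] slab_pderivs[OF assms(2)] assms(3-5) this, of x n] x
  have "norm (pderivs bs f x - (\<Sum>k\<in>{-int n..int n}. fproj r b k (pderivs bs f) x))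
      \<le> 2 * ((2 * r)\<^sup>2 * A) / (real n + 1)" by simp
  moreover have "pderivs bs (\<lambda>x. f x - (\<Sum>k\<in>{-int n..int n}. fproj r b k f x)) x =
      pderivs bs f x - (\<Sum>k\<in>{-int n..int n}. fproj r b k (pderivs bs f) x)"
    using assms(4)
    by (simp add: pderivs_diff pderivs_sum smooth_sum smooth_fproj assms(1) bs(1)
        pderivs_fproj[OF assms(1-3) _ assms(5) bs(1)])
  ultimately show "norm (pderivs bs (\<lambda>x. f x - (\<Sum>k\<in>{-int n..int n}. fproj r b k f x)) x)
      \<le> 2 * ((2 * r)\<^sup>2 * A) / (real n + 1)" by simp
qed

section \<open>Uniform decay in a cone\<close>

lemma distribution_finite_order_test:
  fixes w :: "('a::euclidean_space \<Rightarrow> complex) \<Rightarrow> complex"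
  assumes "distribution w" "test_fun \<phi>"
  shows "\<exists>M C. 0 \<le> C \<and> (\<forall>f A. test_fun f \<longrightarrow> tsupport f \<subseteq> tsupport \<phi> \<longrightarrow>
    deriv_bound UNIV M f A \<longrightarrow> norm (w f) \<le> C * A)"
proof -
  have "compact (tsupport \<phi>)" using assms(2) by (simp add: test_fun_def)
  from distribution_finite_order[OF assms(1) this] show ?thesis by metis
qed

lemma one_plus_le_mult:
  fixes a b c :: real
  assumes "c \<le> a + b" "0 \<le> a" "0 \<le> b"
  shows "1 + c \<le> (1 + a) * (1 + b)"
proof -
  have "(1 + a) * (1 + b) = 1 + a + b + a * b" by (simp add: algebra_simps)
  moreover have "0 \<le> a * b" using assms by simp
  ultimately show ?thesis using assms(1) by linarith
qed

definition osc :: "'a::euclidean_space \<Rightarrow> 'a \<Rightarrow> complex" where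
  "osc \<eta> x = exp (- \<i> * complex_of_real (x \<bullet> \<eta>))"

lemma smooth_osc: "smooth (osc \<eta>)"
  unfolding osc_def by (rule smooth_exp)

lemma deriv_bound_osc: "deriv_bound UNIV n (osc \<eta>) ((1 + norm \<eta>) ^ n)"
  unfolding osc_def by (rule deriv_bound_exp) auto

lemma deriv_bound_nonneg: "deriv_bound UNIV n f A \<Longrightarrow> 0 \<le> A"
  using order_trans[OF norm_ge_zero deriv_boundD[of UNIV n f A "[]" undefined]] by simp

text \<open>The vector \<open>\<kappa>\<close> collects the frequencies in the directions that have already been expanded.\<close>

definition adapted :: "real \<Rightarrow> 'a::euclidean_space set \<Rightarrow> 'a \<Rightarrow> ('a \<Rightarrow> complex) \<Rightarrow> bool" where
  "adapted R S \<kappa> g \<longleftrightarrow> smooth g \<and> (\<forall>b\<in>S. slab R b g \<and> \<kappa> \<bullet> b = 0) \<and>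
     (\<forall>b\<in>Basis - S. \<forall>x t. g (x + t *\<^sub>R b) = exp (\<i> * complex_of_real (t * (\<kappa> \<bullet> b))) * g x)"

text \<open>Moving from 0 to \<open>x\<close> along one coordinate at a time collects one phase per
  coordinate; together they form the exponential of frequency \<open>\<kappa>\<close>.\<close>

lemma adapted_empty:
  assumes "adapted R {} \<kappa> g"
  shows "g x = g 0 * exp (\<i> * complex_of_real (x \<bullet> \<kappa>))"
proof -
  have "g (\<Sum>b\<in>T. (x \<bullet> b) *\<^sub>R b) = g 0 * exp (\<i> * complex_of_real (\<Sum>b\<in>T. (x \<bullet> b) * (\<kappa> \<bullet> b)))"
    if "finite T" "T \<subseteq> Basis" for T
    using that
  proof (induction T)
    case (insert b T)
    have "g ((\<Sum>b\<in>T. (x \<bullet> b) *\<^sub>R b) + (x \<bullet> b) *\<^sub>R b) =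
        exp (\<i> * complex_of_real ((x \<bullet> b) * (\<kappa> \<bullet> b))) * g (\<Sum>b\<in>T. (x \<bullet> b) *\<^sub>R b)"
      using assms insert.prems by (simp add: adapted_def)
    then show ?case
      using insert by (simp add: add.commute exp_add distrib_left mult_ac)
  qed simp
  from this[OF finite_Basis order_refl] show ?thesis
    by (simp add: euclidean_representation euclidean_inner[of x \<kappa>])
qed

text \<open>One round of the expansion: \<open>b\<close> leaves the confined coordinates and its
  frequency \<open>k / r\<close> enters \<open>\<kappa>\<close>. Orthogonality of the basis keeps
  the remaining slabs and the earlier phases intact.\<close>

lemma adapted_fproj:
  assumes g: "adapted R (insert b S) \<kappa> g" and b: "b \<in> Basis" "b \<notin> S" and S: "S \<subseteq> Basis" and r: "r > 0"
  shows "adapted R S (\<kappa> + (of_int k / r) *\<^sub>R b) (fproj r b k g)"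
  unfolding adapted_def
proof (intro conjI ballI allI)
  show "smooth (fproj r b k g)" using g by (simp add: adapted_def smooth_fproj)
next
  fix c assume c: "c \<in> S"
  then have bc: "b \<bullet> c = 0" using b S by (metis inner_not_same_Basis subsetD)
  then show "(\<kappa> + (of_int k / r) *\<^sub>R b) \<bullet> c = 0"
    using g c by (simp add: adapted_def inner_add_left)
  have "g (x - (x \<bullet> b) *\<^sub>R b + (r * s) *\<^sub>R b) = 0" if "R < \<bar>x \<bullet> c\<bar>" for x s
    using g c that bc by (simp add: adapted_def slab_def inner_add_left inner_diff_left)
  then show "slab R c (fproj r b k g)"
    by (simp add: slab_def fproj_def)
next
  fix c x t assume c: "c \<in> Basis - S"
  show "fproj r b k g (x + t *\<^sub>R c) = exp (\<i> * complex_of_real (t * ((\<kappa> + (of_int k / r) *\<^sub>R b) \<bullet> c))) * fproj r b k g x"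
  proof (cases "c = b")
    case True
    have "\<kappa> \<bullet> b = 0" using g by (simp add: adapted_def)
    moreover have L: "x + t *\<^sub>R b - ((x + t *\<^sub>R b) \<bullet> b) *\<^sub>R b = x - (x \<bullet> b) *\<^sub>R b"
      using b by (simp add: inner_add_left scaleR_add_left)
    moreover have X: "exp (\<i> * complex_of_real ((x + t *\<^sub>R b) \<bullet> ((of_int k / r) *\<^sub>R b))) =
        exp (\<i> * complex_of_real (t * (of_int k / r))) * exp (\<i> * complex_of_real (x \<bullet> ((of_int k / r) *\<^sub>R b)))"
      using b by (simp add: exp_add[symmetric] inner_add_left algebra_simps add_divide_distrib)
    ultimately show ?thesis
      unfolding True fproj_def L X using b by (simp add: inner_add_left)
  next
    case False
    then have cb: "c \<bullet> b = 0" "b \<bullet> c = 0" using b c by (auto simp: inner_not_same_Basis)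
    have "g (x + t *\<^sub>R c - (x \<bullet> b) *\<^sub>R b + (r * s) *\<^sub>R b) =
        exp (\<i> * complex_of_real (t * (\<kappa> \<bullet> c))) * g (x - (x \<bullet> b) *\<^sub>R b + (r * s) *\<^sub>R b)" for s
    proof -
      have "g ((x - (x \<bullet> b) *\<^sub>R b + (r * s) *\<^sub>R b) + t *\<^sub>R c) =
          exp (\<i> * complex_of_real (t * (\<kappa> \<bullet> c))) * g (x - (x \<bullet> b) *\<^sub>R b + (r * s) *\<^sub>R b)"
        using g c False unfolding adapted_def by blast
      then show ?thesis by (simp add: algebra_simps)
    qed
    then have "integral {-pi..pi} (\<lambda>s. ek (-k) s * g (x + t *\<^sub>R c - (x \<bullet> b) *\<^sub>R b + (r * s) *\<^sub>R b)) =
        exp (\<i> * complex_of_real (t * (\<kappa> \<bullet> c))) *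
          integral {-pi..pi} (\<lambda>s. ek (-k) s * g (x - (x \<bullet> b) *\<^sub>R b + (r * s) *\<^sub>R b))"
      by (subst integral_mult_right[symmetric]) (simp add: mult_ac)
    then show ?thesis
      using cb by (simp add: fproj_def inner_add_left)
  qed
qed

text \<open>Expanding \<open>g\<close> into its Fourier series in one coordinate direction after the other
  reduces the estimate to the hypothesis on pure exponentials.\<close>

lemma decay_adapted:
  fixes w :: "('a::euclidean_space \<Rightarrow> complex) \<Rightarrow> complex"
  assumes w: "distribution w" and \<phi>: "test_fun \<phi>"
    and R: "\<And>b x. b \<in> Basis \<Longrightarrow> x \<in> tsupport \<phi> \<Longrightarrow> \<bar>x \<bullet> b\<bar> \<le> R"
    and W0: "\<And>\<eta>. 0 \<le> W \<eta>" and W: "\<And>\<eta> \<theta>. W (\<eta> - \<theta>) \<le> W \<eta> * (1 + norm \<theta>) ^ p"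
    and F: "\<And>\<eta>. norm (w (\<lambda>x. \<phi> x * osc \<eta> x)) \<le> C0 * W \<eta>" and C0: "0 \<le> C0"
    and S: "S \<subseteq> Basis"
  shows "\<exists>C M. 0 \<le> C \<and> (\<forall>g A \<kappa> \<eta>. adapted R S \<kappa> g \<longrightarrow> deriv_bound UNIV M g A \<longrightarrow>
    norm (w (\<lambda>x. \<phi> x * (g x * osc \<eta> x))) \<le> C * A * (1 + norm \<kappa>) ^ p * W \<eta>)"
  using finite_subset[OF S finite_Basis] S
proof (induction S)
  case empty
  have "norm (w (\<lambda>x. \<phi> x * (g x * osc \<eta> x))) \<le> C0 * A * (1 + norm \<kappa>) ^ p * W \<eta>"
    if g: "adapted R {} \<kappa> g" and A: "deriv_bound UNIV 0 g A" for g A \<kappa> \<eta>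
  proof -
    \<comment> \<open>Nothing is left to expand: the exponential merges with
      \<open>osc \<eta>\<close> into the frequency \<open>\<eta> - \<kappa>\<close>, to which
      \<open>F\<close> and then \<open>W\<close> apply.\<close>
    have "\<phi> x * (g x * osc \<eta> x) = g 0 * (\<phi> x * osc (\<eta> - \<kappa>) x)" for x
    proof -
      have "osc (\<eta> - \<kappa>) x = exp (\<i> * complex_of_real (x \<bullet> \<kappa>)) * osc \<eta> x"
        by (simp add: osc_def exp_add[symmetric] inner_diff_right algebra_simps)
      then show ?thesis
        by (simp add: adapted_empty[OF g, of x])
    qed
    then have "w (\<lambda>x. \<phi> x * (g x * osc \<eta> x)) = g 0 * w (\<lambda>x. \<phi> x * osc (\<eta> - \<kappa>) x)"
      by (simp only: distribution_cmult[OF w test_fun_mult[OF \<phi> smooth_osc]])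
    moreover have "norm (g 0) \<le> A" using A by (simp add: deriv_bound_0)
    moreover have "norm (w (\<lambda>x. \<phi> x * osc (\<eta> - \<kappa>) x)) \<le> C0 * (W \<eta> * (1 + norm \<kappa>) ^ p)"
      by (rule order_trans[OF F mult_left_mono[OF W C0]])
    ultimately have "norm (w (\<lambda>x. \<phi> x * (g x * osc \<eta> x))) \<le> A * (C0 * (W \<eta> * (1 + norm \<kappa>) ^ p))"
      by (simp only: norm_mult) (intro mult_mono order_trans[OF norm_ge_zero \<open>norm (g 0) \<le> A\<close>] norm_ge_zero)
    then show ?thesis by (simp add: mult_ac)
  qed
  with C0 show ?case by blast
next
  case (insert b S)
  then have b: "b \<in> Basis" "S \<subseteq> Basis" by auto
  obtain C M where C: "0 \<le> C" and IH: "\<And>g A \<kappa> \<eta>. adapted R S \<kappa> g \<Longrightarrow> deriv_bound UNIV M g A \<Longrightarrow>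
      norm (w (\<lambda>x. \<phi> x * (g x * osc \<eta> x))) \<le> C * A * (1 + norm \<kappa>) ^ p * W \<eta>"
    using insert.IH[OF b(2)] by blast
  obtain M1 C1 where C1: "0 \<le> C1" and ord: "\<And>f A. test_fun f \<Longrightarrow> tsupport f \<subseteq> tsupport \<phi> \<Longrightarrow>
      deriv_bound UNIV M1 f A \<Longrightarrow> norm (w f) \<le> C1 * A"
    using distribution_finite_order_test[OF w \<phi>] by blast
  \<comment> \<open>Large enough that the slab of \<open>g\<close> and the support of
    \<open>\<phi>\<close> both lie strictly inside the strip of half-width \<open>r * pi\<close>;
    \<open>r \<ge> 1\<close> also bounds the frequency \<open>\<bar>k\<bar> / r\<close> by
    \<open>\<bar>k\<bar>\<close>.\<close>
  define r where "r = max 1 R"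
  have r: "r \<ge> 1" "R < r * pi"
  proof -
    show r1: "r \<ge> 1" by (simp add: r_def)
    have "R \<le> r" by (simp add: r_def)
    also have "r < r * pi" using r1 pi_gt3 by simp
    finally show "R < r * pi" .
  qed
  \<comment> \<open>Of the \<open>p + 2\<close> powers of decay, \<open>p\<close> absorb the growth
    caused by adding \<open>k / r\<close> to the frequency, and two make the series
    summable.\<close>
  define D where "D = (2 * r) ^ (p + 2)"
  \<comment> \<open>The first bracket serves the Fourier components, the second the
    remainder.\<close>
  define M' where "M' = (M + (p + 2)) + (M1 + 2)"
  have "norm (w (\<lambda>x. \<phi> x * (g x * osc \<eta> x))) \<le> (C * D * 3) * A * (1 + norm \<kappa>) ^ p * W \<eta>"
    if g: "adapted R (insert b S) \<kappa> g" and A: "deriv_bound UNIV M' g A" for g A \<kappa> \<eta>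
  proof -
    have sg: "smooth g" and slab: "slab R b g" and \<kappa>b: "\<kappa> \<bullet> b = 0" using g by (auto simp: adapted_def)
    have A0: "0 \<le> A" by (rule deriv_bound_nonneg[OF A])
    define E where "E = A * C * D * (1 + norm \<kappa>) ^ p * W \<eta>"
    have E0: "0 \<le> E" using A0 C r W0 by (simp add: E_def D_def)
    have summand: "norm (w (\<lambda>x. \<phi> x * (fproj r b k g x * osc \<eta> x))) \<le> E * (1 / (1 + \<bar>real_of_int k\<bar>)\<^sup>2)" for k
    proof -
      have "deriv_bound UNIV M (fproj r b k g) (D * A / (1 + \<bar>real_of_int k\<bar>) ^ (p + 2))"
        unfolding D_def
        using A by (intro deriv_bound_fproj[OF sg slab r(2,1) b(1)] deriv_bound_mono[OF A]) (auto simp: M'_def)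
      moreover have "adapted R S (\<kappa> + (of_int k / r) *\<^sub>R b) (fproj r b k g)"
        using r insert.hyps by (intro adapted_fproj[OF g b(1) _ b(2)]) auto
      ultimately have "norm (w (\<lambda>x. \<phi> x * (fproj r b k g x * osc \<eta> x))) \<le>
          C * (D * A / (1 + \<bar>real_of_int k\<bar>) ^ (p + 2)) * (1 + norm (\<kappa> + (of_int k / r) *\<^sub>R b)) ^ p * W \<eta>"
        by (intro IH)
      also have "\<dots> \<le> C * (D * A / (1 + \<bar>real_of_int k\<bar>) ^ (p + 2)) * ((1 + norm \<kappa>) ^ p * (1 + \<bar>real_of_int k\<bar>) ^ p) * W \<eta>"
      proof (intro mult_right_mono mult_left_mono W0)
        have "norm (\<kappa> + (of_int k / r) *\<^sub>R b) \<le> norm \<kappa> + \<bar>real_of_int k / r\<bar>"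
          using norm_triangle_ineq[of \<kappa> "(of_int k / r) *\<^sub>R b"] b by simp
        also have "\<bar>real_of_int k / r\<bar> \<le> \<bar>real_of_int k\<bar>"
          using r by (simp add: abs_divide divide_le_eq mult_le_cancel_left1)
        finally have "1 + norm (\<kappa> + (of_int k / r) *\<^sub>R b) \<le> (1 + norm \<kappa>) * (1 + \<bar>real_of_int k\<bar>)"
          by (intro one_plus_le_mult) auto
        then show "(1 + norm (\<kappa> + (of_int k / r) *\<^sub>R b)) ^ p \<le> (1 + norm \<kappa>) ^ p * (1 + \<bar>real_of_int k\<bar>) ^ p"
          unfolding power_mult_distrib[symmetric] by (intro power_mono) auto
        show "0 \<le> C * (D * A / (1 + \<bar>real_of_int k\<bar>) ^ (p + 2))"
          using C A0 r by (simp add: D_def)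
      qed
      also have "\<dots> = E * ((1 + \<bar>real_of_int k\<bar>) ^ p / (1 + \<bar>real_of_int k\<bar>) ^ (p + 2))"
        by (simp add: E_def)
      also have "(1 + \<bar>real_of_int k\<bar>) ^ p / (1 + \<bar>real_of_int k\<bar>) ^ (p + 2) = 1 / (1 + \<bar>real_of_int k\<bar>)\<^sup>2"
        by (simp add: power_add power2_eq_square)
      finally show ?thesis .
    qed
    obtain B where B: "0 \<le> B" "deriv_bound UNIV M1 (\<lambda>x. \<phi> x * osc \<eta> x) B"
      using test_fun_deriv_bound[OF test_fun_mult[OF \<phi> smooth_osc]] by blast
    \<comment> \<open>\<open>B\<close>, and with it \<open>Q\<close>, depends on
      \<open>\<eta>\<close>. This is harmless: the remainder is divided by \<open>n + 1\<close>, and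
      \<open>n\<close> tends to infinity for fixed \<open>\<eta>\<close>.\<close>
    define Q where "Q = C1 * (2 ^ M1 * B * (2 * ((2 * r)\<^sup>2 * A)))"
    have bound: "norm (w (\<lambda>x. \<phi> x * (g x * osc \<eta> x))) \<le> 3 * E + Q * inverse (real n + 1)" for n
    proof -
      define h where "h x = g x - (\<Sum>k\<in>{-int n..int n}. fproj r b k g x)" for x
      define \<tau> where "\<tau> = 2 * ((2 * r)\<^sup>2 * A) / (real n + 1)"
      have sh: "smooth h"
        unfolding h_def by (intro smooth_diff smooth_sum smooth_fproj sg)
      have hb: "deriv_bound (tsupport \<phi>) M1 h \<tau>"
        unfolding h_def \<tau>_def
      proof (rule deriv_bound_mono[OF deriv_bound_fproj_tail[OF sg slab r(2,1) b(1)]])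
        show "deriv_bound UNIV (M1 + 2) g A" by (rule deriv_bound_mono[OF A]) (auto simp: M'_def)
        show "tsupport \<phi> \<subseteq> {x. \<bar>x \<bullet> b\<bar> < r * pi}" using R[OF b(1)] r by (auto intro: le_less_trans)
      qed auto
      have tf: "test_fun (\<lambda>x. (\<phi> x * osc \<eta> x) * h x)"
        by (intro test_fun_mult \<phi> smooth_osc sh)
      have sup: "tsupport (\<lambda>x. (\<phi> x * osc \<eta> x) * h x) \<subseteq> tsupport \<phi>"
        using tsupport_mult[of \<phi> "\<lambda>x. osc \<eta> x * h x"] by (simp add: mult.assoc)
      have c0: "0 \<le> \<tau>" using A0 by (simp add: \<tau>_def)
      have "deriv_bound (tsupport \<phi>) M1 (\<lambda>x. (\<phi> x * osc \<eta> x) * h x) (2 ^ M1 * B * \<tau>)"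
        by (intro deriv_bound_mult hb sh B c0 deriv_bound_mono[OF B(2)] test_fun_smooth test_fun_mult \<phi> smooth_osc) auto
      then have "deriv_bound UNIV M1 (\<lambda>x. (\<phi> x * osc \<eta> x) * h x) (2 ^ M1 * B * \<tau>)"
        using B(1) c0 by (intro deriv_bound_outside[OF _ sup]) auto
      then have "norm (w (\<lambda>x. (\<phi> x * osc \<eta> x) * h x)) \<le> C1 * (2 ^ M1 * B * \<tau>)"
        by (rule ord[OF tf sup])
      also have "\<dots> = Q * inverse (real n + 1)" by (simp add: Q_def \<tau>_def divide_inverse)
      finally have rem: "norm (w (\<lambda>x. (\<phi> x * osc \<eta> x) * h x)) \<le> Q * inverse (real n + 1)" .
      have tk: "test_fun (\<lambda>x. \<phi> x * (fproj r b k g x * osc \<eta> x))" for k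
        by (intro test_fun_mult \<phi> smooth_mult smooth_osc smooth_fproj sg)
      have "(\<lambda>x. \<phi> x * (g x * osc \<eta> x)) =
          (\<lambda>x. (\<phi> x * osc \<eta> x) * h x + (\<Sum>k\<in>{-int n..int n}. \<phi> x * (fproj r b k g x * osc \<eta> x)))"
        by (simp add: h_def sum_distrib_left[symmetric] sum_distrib_right[symmetric] algebra_simps)
      then have "w (\<lambda>x. \<phi> x * (g x * osc \<eta> x)) = w (\<lambda>x. (\<phi> x * osc \<eta> x) * h x) +
          (\<Sum>k\<in>{-int n..int n}. w (\<lambda>x. \<phi> x * (fproj r b k g x * osc \<eta> x)))"
        by (simp only: distribution_add[OF w tf test_fun_sum[OF tk]] distribution_sum[OF w tk])
      then have "norm (w (\<lambda>x. \<phi> x * (g x * osc \<eta> x))) \<le> norm (w (\<lambda>x. (\<phi> x * osc \<eta> x) * h x)) +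
          (\<Sum>k\<in>{-int n..int n}. norm (w (\<lambda>x. \<phi> x * (fproj r b k g x * osc \<eta> x))))"
        by (simp only:) (intro norm_triangle_mono norm_sum order_refl)
      also have "\<dots> \<le> Q * inverse (real n + 1) + (\<Sum>k\<in>{-int n..int n}. E * (1 / (1 + \<bar>real_of_int k\<bar>)\<^sup>2))"
        by (intro add_mono rem sum_mono summand)
      also have "(\<Sum>k\<in>{-int n..int n}. E * (1 / (1 + \<bar>real_of_int k\<bar>)\<^sup>2)) \<le> E * 3"
        unfolding sum_distrib_left[symmetric] by (intro mult_left_mono sum_inverse_squares E0)
      finally show ?thesis by simp
    qed
    have "(\<lambda>n. 3 * E + Q * inverse (real n + 1)) \<longlonglongrightarrow> 3 * E + Q * 0"
      using LIMSEQ_inverse_real_of_nat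
      by (intro tendsto_intros) (simp add: add.commute)
    then have "norm (w (\<lambda>x. \<phi> x * (g x * osc \<eta> x))) \<le> 3 * E + Q * 0"
      using bound by (intro LIMSEQ_le_const) auto
    then show ?thesis by (simp add: E_def mult_ac)
  qed
  moreover have "0 \<le> C * D * 3" using C r by (simp add: D_def)
  ultimately show ?case by blast
qed

text \<open>The starting point of the expansion: a test function supported in \<open>K\<close> is
  confined in all coordinates and carries no frequency yet, so \<open>\<kappa> = 0\<close>.\<close>

lemma decay_mult:
  fixes w :: "('a::euclidean_space \<Rightarrow> complex) \<Rightarrow> complex"
  assumes w: "distribution w" and \<phi>: "test_fun \<phi>" and K: "compact K"
    and W0: "\<And>\<eta>. 0 \<le> W \<eta>" and W: "\<And>\<eta> \<theta>. W (\<eta> - \<theta>) \<le> W \<eta> * (1 + norm \<theta>) ^ p"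
    and F: "\<And>\<eta>. norm (w (\<lambda>x. \<phi> x * osc \<eta> x)) \<le> C0 * W \<eta>" and C0: "0 \<le> C0"
  shows "\<exists>C M. 0 \<le> C \<and> (\<forall>g A \<eta>. test_fun g \<longrightarrow> tsupport g \<subseteq> K \<longrightarrow> deriv_bound UNIV M g A \<longrightarrow>
    norm (w (\<lambda>x. \<phi> x * (g x * osc \<eta> x))) \<le> C * A * W \<eta>)"
proof -
  have "bounded (K \<union> tsupport \<phi>)"
    using \<phi> K by (auto simp: test_fun_def compact_imp_bounded)
  then obtain R where R: "\<And>x. x \<in> K \<union> tsupport \<phi> \<Longrightarrow> norm x \<le> R"
    unfolding bounded_iff by blast
  have Rb: "\<bar>x \<bullet> b\<bar> \<le> R" if "x \<in> K \<union> tsupport \<phi>" "b \<in> Basis" for x b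
    using Basis_le_norm[OF that(2), of x] R[OF that(1)] by simp
  obtain C M where C: "0 \<le> C" "\<And>g A \<kappa> \<eta>. adapted R Basis \<kappa> g \<Longrightarrow> deriv_bound UNIV M g A \<Longrightarrow>
      norm (w (\<lambda>x. \<phi> x * (g x * osc \<eta> x))) \<le> C * A * (1 + norm \<kappa>) ^ p * W \<eta>"
    using decay_adapted[OF w \<phi> _ W0 W F C0 order_refl, of R] Rb by blast
  have "adapted R Basis 0 g" if "test_fun g" "tsupport g \<subseteq> K" for g
  proof -
    have "g x = 0" if "R < \<bar>x \<bullet> b\<bar>" "b \<in> Basis" for x b
      using Rb[of x b] that \<open>tsupport g \<subseteq> K\<close> not_in_tsupport[of x g] by force
    then show ?thesis using that(1) by (simp add: adapted_def slab_def test_fun_smooth)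
  qed
  then show ?thesis
    using C(2)[where \<kappa> = 0] C(1) by (intro exI[of _ C] exI[of _ M]) simp
qed

text \<open>\<open>M\<close> and \<open>C\<close> depend neither on \<open>g\<close> nor on
  \<open>\<eta>\<close>; linearity in \<open>A\<close> expresses uniformity over bounded families of
  test functions.\<close>

definition decay_bound ::
    "(('a::euclidean_space \<Rightarrow> complex) \<Rightarrow> complex) \<Rightarrow> ('a \<Rightarrow> complex) \<Rightarrow> 'a set \<Rightarrow> 'a set \<Rightarrow> nat \<Rightarrow> nat \<Rightarrow> real \<Rightarrow> bool"
  where "decay_bound w \<phi> \<Gamma> K N M C \<longleftrightarrow> 0 \<le> C \<and>
    (\<forall>g A. \<forall>\<eta>\<in>\<Gamma>. test_fun g \<longrightarrow> tsupport g \<subseteq> K \<longrightarrow> deriv_bound UNIV M g A \<longrightarrow>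
      norm (w (\<lambda>x. \<phi> x * (g x * osc \<eta> x))) \<le> C * A * (1 + norm \<eta>) powr (- real N))"

lemma decay_boundD:
  assumes "decay_bound w \<phi> \<Gamma> K N M C" "test_fun g" "tsupport g \<subseteq> K" "deriv_bound UNIV M g A" "\<eta> \<in> \<Gamma>"
  shows "norm (w (\<lambda>x. \<phi> x * (g x * osc \<eta> x))) \<le> C * A * (1 + norm \<eta>) powr (- real N)"
  using assms unfolding decay_bound_def by blast

text \<open>Decay of one localised Fourier transform survives multiplication by \<open>g\<close> at
  the price of a smaller cone, which is the same for all \<open>K\<close> and \<open>N\<close>. The
  room between the two cones pays for the frequency shifts that leave
  \<open>\<Gamma>0\<close>.\<close>

lemma conic_decay:
  fixes w :: "('a::euclidean_space \<Rightarrow> complex) \<Rightarrow> complex"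
  assumes w: "distribution w" and \<phi>: "test_fun \<phi>" and \<Gamma>0: "open_conic_nbhd \<Gamma>0 \<eta>0" and nz: "\<eta>0 \<noteq> 0"
    and dec: "\<forall>N::nat. \<exists>C. \<forall>\<eta>\<in>\<Gamma>0. norm (loc_fourier w \<phi> \<eta>) \<le> C * (1 + norm \<eta>) powr (- real N)"
  shows "\<exists>\<Gamma>. open_conic_nbhd \<Gamma> \<eta>0 \<and> (\<forall>K N. compact K \<longrightarrow> (\<exists>M C. decay_bound w \<phi> \<Gamma> K N M C))"
proof -
  obtain e where e: "e > 0" "ball \<eta>0 e \<subseteq> \<Gamma>0"
    using \<Gamma>0 unfolding open_conic_nbhd_def by (meson open_contains_ball)
  \<comment> \<open>Points closer than \<open>2 * \<epsilon>\<close> to \<open>\<eta>0\<close> then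
    lie in \<open>\<Gamma>0\<close> and differ from 0; both facts enter the lower bound for
    \<open>d\<close>.\<close>
  define \<epsilon> where "\<epsilon> = min (e / 2) (norm \<eta>0 / 2)"
  have \<epsilon>: "\<epsilon> > 0" "2 * \<epsilon> \<le> e" "2 * \<epsilon> \<le> norm \<eta>0" using e nz by (auto simp: \<epsilon>_def)
  define \<Gamma> where "\<Gamma> = (\<Union>t\<in>{0<..}. (\<lambda>\<zeta>. t *\<^sub>R \<zeta>) ` ball \<eta>0 \<epsilon>)"
  have \<Gamma>: "open_conic_nbhd \<Gamma> \<eta>0"
    unfolding open_conic_nbhd_def
  proof (intro conjI ballI allI impI)
    show "open \<Gamma>" unfolding \<Gamma>_def by (intro open_UN ballI open_scaling) auto
    have "1 *\<^sub>R \<eta>0 \<in> (\<lambda>\<zeta>. 1 *\<^sub>R \<zeta>) ` ball \<eta>0 \<epsilon>" using \<epsilon> by (intro imageI) simp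
    then show "\<eta>0 \<in> \<Gamma>" unfolding \<Gamma>_def by (intro UN_I[of 1]) auto
    fix \<eta> and t :: real assume "\<eta> \<in> \<Gamma>" "t > 0"
    then obtain s \<zeta> where "s > 0" "\<zeta> \<in> ball \<eta>0 \<epsilon>" "\<eta> = s *\<^sub>R \<zeta>" by (auto simp: \<Gamma>_def)
    then show "t *\<^sub>R \<eta> \<in> \<Gamma>" unfolding \<Gamma>_def using \<open>t > 0\<close> by (intro UN_I[of "t * s"]) auto
  qed
  \<comment> \<open>Adding 0 makes \<open>Z\<close> nonempty even if \<open>\<Gamma>0\<close> is the
    whole space, and gives \<open>d \<eta> \<le> norm \<eta>\<close>.\<close>
  define Z where "Z = insert 0 (- \<Gamma>0)"
  define d where "d \<eta> = infdist \<eta> Z" for \<eta>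
  have d0: "0 \<le> d \<eta>" for \<eta> by (simp add: d_def infdist_nonneg)
  have d_le: "d \<eta> \<le> norm \<eta>" for \<eta>
    using infdist_le[of 0 Z \<eta>] by (simp add: d_def Z_def)
  have d_tri: "d \<eta> \<le> d (\<eta> - \<theta>) + norm \<theta>" for \<eta> \<theta>
    using infdist_triangle[of \<eta> Z "\<eta> - \<theta>"] by (simp add: d_def dist_norm)
  have d_out: "d \<eta> = 0" if "\<eta> \<notin> \<Gamma>0" for \<eta>
    using that by (simp add: d_def Z_def)
  \<comment> \<open>For \<open>\<eta> = t *\<^sub>R \<zeta>\<close> with \<open>\<zeta>\<close> in
    the ball, scaling gives \<open>d \<eta> \<ge> t * \<epsilon>\<close>, while
    \<open>norm \<eta> \<le> t * (norm \<eta>0 + \<epsilon>)\<close>.\<close>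
  define c where "c = \<epsilon> / (norm \<eta>0 + \<epsilon>)"
  have c: "0 < c" "c \<le> 1" using \<epsilon> by (auto simp: c_def add_nonneg_pos divide_le_eq)
  have d_ge: "c * norm \<eta> \<le> d \<eta>" if \<eta>: "\<eta> \<in> \<Gamma>" for \<eta>
  proof -
    obtain t \<zeta> where t: "t > 0" "\<zeta> \<in> ball \<eta>0 \<epsilon>" "\<eta> = t *\<^sub>R \<zeta>"
      using \<eta> by (auto simp: \<Gamma>_def)
    have "t * \<epsilon> \<le> dist \<eta> z" if z: "z \<in> Z" for z
    proof (rule ccontr)
      assume "\<not> t * \<epsilon> \<le> dist \<eta> z"
      moreover have "dist \<eta> z = t * dist \<zeta> (inverse t *\<^sub>R z)"
      proof -
        have "\<eta> - z = t *\<^sub>R (\<zeta> - inverse t *\<^sub>R z)" using t by (simp add: scaleR_diff_right)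
        then show ?thesis using t by (simp add: dist_norm)
      qed
      ultimately have close: "dist \<zeta> (inverse t *\<^sub>R z) < \<epsilon>" using t by simp
      then have near: "dist \<eta>0 (inverse t *\<^sub>R z) < 2 * \<epsilon>"
        using t(2) dist_triangle[of \<eta>0 "inverse t *\<^sub>R z" \<zeta>] by simp
      then have "inverse t *\<^sub>R z \<in> \<Gamma>0" using e \<epsilon> by auto
      then have "t *\<^sub>R (inverse t *\<^sub>R z) \<in> \<Gamma>0" using \<Gamma>0 t unfolding open_conic_nbhd_def by blast
      then have "z \<in> \<Gamma>0" using t by simp
      moreover have "z \<noteq> 0" using near \<epsilon> by auto
      ultimately show False using z by (simp add: Z_def)
    qed
    moreover have "Z \<noteq> {}" by (simp add: Z_def)
    ultimately have "t * \<epsilon> \<le> d \<eta>"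
      unfolding d_def by (simp add: infdist_notempty cINF_greatest)
    moreover have "c * norm \<eta> \<le> t * \<epsilon>"
    proof -
      have "norm \<zeta> \<le> norm \<eta>0 + \<epsilon>"
        using t(2) norm_triangle_ineq2[of \<zeta> \<eta>0] by (simp add: dist_norm norm_minus_commute)
      then have "c * norm \<zeta> \<le> c * (norm \<eta>0 + \<epsilon>)" using c by (intro mult_left_mono) auto
      also have "\<dots> = \<epsilon>" using \<epsilon> by (simp add: c_def add_nonneg_pos less_imp_neq[symmetric])
      finally have "c * norm \<zeta> \<le> \<epsilon>" .
      from mult_left_mono[OF this, of t] t show ?thesis by (simp add: mult_ac)
    qed
    ultimately show ?thesis by simp
  qed
  obtain m C1 where C1: "0 \<le> C1" and ord: "\<And>f A. test_fun f \<Longrightarrow> tsupport f \<subseteq> tsupport \<phi> \<Longrightarrow>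
      deriv_bound UNIV m f A \<Longrightarrow> norm (w f) \<le> C1 * A"
    using distribution_finite_order_test[OF w \<phi>] by blast
  obtain B where B: "0 \<le> B" "deriv_bound UNIV m \<phi> B" using test_fun_deriv_bound[OF \<phi>] by blast
  have poly: "norm (w (\<lambda>x. \<phi> x * osc \<eta> x)) \<le> (C1 * (2 ^ m * B)) * (1 + norm \<eta>) ^ m" for \<eta>
  proof -
    have "norm (w (\<lambda>x. \<phi> x * osc \<eta> x)) \<le> C1 * (2 ^ m * B * (1 + norm \<eta>) ^ m)"
      using B by (intro ord test_fun_mult \<phi> smooth_osc tsupport_mult deriv_bound_mult deriv_bound_osc test_fun_smooth) auto
    then show ?thesis by (simp add: mult_ac)
  qed
  have "\<exists>M C. decay_bound w \<phi> \<Gamma> K N M C"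
    if K: "compact K" for K and N :: nat
  proof -
    \<comment> \<open>The extra \<open>m\<close> powers cancel the growth in the numerator of
      \<open>W\<close>, so that order \<open>N\<close> is left on \<open>\<Gamma>\<close>.\<close>
    define q where "q = N + m"
    define W where "W \<eta> = (1 + norm \<eta>) ^ m / (1 + d \<eta>) ^ q" for \<eta>
    have W0: "0 \<le> W \<eta>" for \<eta> using d0[of \<eta>] by (simp add: W_def)
    have WW: "W (\<eta> - \<theta>) \<le> W \<eta> * (1 + norm \<theta>) ^ (m + q)" for \<eta> \<theta>
    proof -
      have "1 + norm (\<eta> - \<theta>) \<le> (1 + norm \<eta>) * (1 + norm \<theta>)"
        by (intro one_plus_le_mult norm_triangle_ineq4) auto
      then have 1: "(1 + norm (\<eta> - \<theta>)) ^ m \<le> (1 + norm \<eta>) ^ m * (1 + norm \<theta>) ^ m"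
        unfolding power_mult_distrib[symmetric] by (intro power_mono) auto
      have "1 + d \<eta> \<le> (1 + d (\<eta> - \<theta>)) * (1 + norm \<theta>)"
        by (intro one_plus_le_mult d_tri d0) auto
      then have 2: "(1 + d \<eta>) ^ q \<le> (1 + d (\<eta> - \<theta>)) ^ q * (1 + norm \<theta>) ^ q"
        unfolding power_mult_distrib[symmetric] using d0[of \<eta>] by (intro power_mono) auto
      have pos: "0 < (1 + d \<eta>) ^ q" "0 < (1 + d (\<eta> - \<theta>)) ^ q"
        using d0[of \<eta>] d0[of "\<eta> - \<theta>"] by auto
      have "(1 + norm (\<eta> - \<theta>)) ^ m * (1 + d \<eta>) ^ q \<le>
          ((1 + norm \<eta>) ^ m * (1 + norm \<theta>) ^ m) * ((1 + d (\<eta> - \<theta>)) ^ q * (1 + norm \<theta>) ^ q)"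
        using d0[of \<eta>] by (intro mult_mono 1 2) auto
      then show ?thesis
        using pos by (simp add: W_def divide_le_eq pos_le_divide_eq power_add mult_ac)
    qed
    obtain Cq where Cq: "\<And>\<eta>. \<eta> \<in> \<Gamma>0 \<Longrightarrow> norm (loc_fourier w \<phi> \<eta>) \<le> Cq * (1 + norm \<eta>) powr (- real q)"
      using dec by blast
    \<comment> \<open>In the cone the rapid decay is stronger than \<open>W\<close> because
      \<open>d \<eta> \<le> norm \<eta>\<close>; off the cone \<open>d\<close> vanishes and
      \<open>W\<close> is exactly the growth from finite order.\<close>
    have F: "norm (w (\<lambda>x. \<phi> x * osc \<eta> x)) \<le> (C1 * (2 ^ m * B) + \<bar>Cq\<bar>) * W \<eta>" for \<eta>
    proof (cases "\<eta> \<in> \<Gamma>0")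
      case True
      have "norm (w (\<lambda>x. \<phi> x * osc \<eta> x)) \<le> Cq * (1 + norm \<eta>) powr (- real q)"
        using Cq[OF True] by (simp add: loc_fourier_def osc_def)
      also have "(1 + norm \<eta>) powr (- real q) = 1 / (1 + norm \<eta>) ^ q"
        by (simp add: powr_minus powr_realpow add_pos_nonneg divide_inverse)
      also have "Cq * (1 / (1 + norm \<eta>) ^ q) \<le> \<bar>Cq\<bar> * (1 / (1 + d \<eta>) ^ q)"
        using d_le[of \<eta>] d0[of \<eta>] by (intro mult_mono frac_le power_mono) auto
      also have "\<dots> \<le> (C1 * (2 ^ m * B) + \<bar>Cq\<bar>) * W \<eta>"
        unfolding W_def using C1 B d0[of \<eta>]
        by (intro mult_mono divide_right_mono one_le_power) auto
      finally show ?thesis .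
    next
      case False
      have "norm (w (\<lambda>x. \<phi> x * osc \<eta> x)) \<le> (C1 * (2 ^ m * B)) * W \<eta>"
        using poly[of \<eta>] by (simp add: W_def d_out[OF False])
      also have "\<dots> \<le> (C1 * (2 ^ m * B) + \<bar>Cq\<bar>) * W \<eta>"
        using W0 by (intro mult_right_mono) auto
      finally show ?thesis .
    qed
    have "0 \<le> C1 * (2 ^ m * B) + \<bar>Cq\<bar>" using C1 B by simp
    then obtain C M where C: "0 \<le> C" "\<And>g A \<eta>. test_fun g \<Longrightarrow> tsupport g \<subseteq> K \<Longrightarrow> deriv_bound UNIV M g A \<Longrightarrow>
        norm (w (\<lambda>x. \<phi> x * (g x * osc \<eta> x))) \<le> C * A * W \<eta>"
      using decay_mult[OF w \<phi> K W0 WW F] by blast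
    have W\<Gamma>: "W \<eta> \<le> (1 / c ^ q) * (1 + norm \<eta>) powr (- real N)" if "\<eta> \<in> \<Gamma>" for \<eta>
    proof -
      have "c * (1 + norm \<eta>) \<le> 1 + d \<eta>"
        using d_ge[OF that] c by (simp add: distrib_left)
      then have "(c * (1 + norm \<eta>)) ^ q \<le> (1 + d \<eta>) ^ q"
        using c by (intro power_mono) auto
      then have "W \<eta> \<le> (1 + norm \<eta>) ^ m / (c * (1 + norm \<eta>)) ^ q"
        unfolding W_def using c by (intro divide_left_mono) (auto intro!: mult_pos_pos add_pos_nonneg zero_less_power d0)
      also have "\<dots> = (1 / c ^ q) * (1 / (1 + norm \<eta>) ^ N)"
      proof -
        have "1 + norm \<eta> \<noteq> 0" using norm_ge_zero[of \<eta>] by linarith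
        then show ?thesis by (simp add: q_def power_add power_mult_distrib)
      qed
      also have "1 / (1 + norm \<eta>) ^ N = (1 + norm \<eta>) powr (- real N)"
        by (simp add: powr_minus powr_realpow add_pos_nonneg divide_inverse)
      finally show ?thesis .
    qed
    have "norm (w (\<lambda>x. \<phi> x * (g x * osc \<eta> x))) \<le> (C * (1 / c ^ q)) * A * (1 + norm \<eta>) powr (- real N)"
      if g: "test_fun g" "tsupport g \<subseteq> K" "deriv_bound UNIV M g A" "\<eta> \<in> \<Gamma>" for g A \<eta>
    proof -
      have "norm (w (\<lambda>x. \<phi> x * (g x * osc \<eta> x))) \<le> C * A * W \<eta>" by (rule C(2)[OF g(1-3)])
      also have "\<dots> \<le> C * A * ((1 / c ^ q) * (1 + norm \<eta>) powr (- real N))"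
        using C(1) deriv_bound_nonneg[OF g(3)] by (intro mult_left_mono W\<Gamma> g) auto
      finally show ?thesis by (simp add: mult_ac)
    qed
    moreover have "0 \<le> C * (1 / c ^ q)" using C(1) c by simp
    ultimately have "decay_bound w \<phi> \<Gamma> K N M (C * (1 / c ^ q))" unfolding decay_bound_def by blast
    then show ?thesis by blast
  qed
  with \<Gamma> show ?thesis by blast
qed

text \<open>Every point supplies its own cutoff and cone. Compactness of \<open>K\<close> leaves
  finitely many, whose cones still intersect in a conic neighbourhood; the cofactors
  \<open>a j\<close> are absorbed into the arbitrary factor \<open>g\<close>.\<close>

lemma global_decay:
  fixes w :: "('a::euclidean_space \<Rightarrow> complex) \<Rightarrow> complex"
  assumes w: "distribution w" and nz: "\<eta>0 \<noteq> 0" and K: "compact K"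
    and WF: "wavefront w \<inter> (UNIV \<times> {\<eta>0}) = {}"
  shows "\<exists>\<Gamma>. open_conic_nbhd \<Gamma> \<eta>0 \<and> (\<forall>N. \<exists>M C. decay_bound w (\<lambda>x. 1) \<Gamma> K N M C)"
proof -
  have "\<exists>\<phi> \<Gamma>. test_fun \<phi> \<and> \<phi> x \<noteq> 0 \<and> open_conic_nbhd \<Gamma> \<eta>0 \<and>
      (\<forall>K N. compact K \<longrightarrow> (\<exists>M C. decay_bound w \<phi> \<Gamma> K N M C))" for x
  proof -
    have "(x, \<eta>0) \<notin> wavefront w" using WF by blast
    then obtain \<phi> \<Gamma>0 where "test_fun \<phi>" "\<phi> x \<noteq> 0" "open_conic_nbhd \<Gamma>0 \<eta>0"
      "\<forall>N::nat. \<exists>C. \<forall>\<eta>\<in>\<Gamma>0. norm (loc_fourier w \<phi> \<eta>) \<le> C * (1 + norm \<eta>) powr (- real N)"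
      using nz unfolding wavefront_def by auto
    with conic_decay[OF w this(1,3) nz this(4)] show ?thesis by blast
  qed
  then obtain \<phi> \<Gamma> where \<phi>: "\<And>x. test_fun (\<phi> x)" "\<And>x. \<phi> x x \<noteq> 0" and \<Gamma>: "\<And>x. open_conic_nbhd (\<Gamma> x) \<eta>0"
    and dec: "\<And>x K N. compact K \<Longrightarrow> \<exists>M C. decay_bound w (\<phi> x) (\<Gamma> x) K N M C"
    by metis
  obtain J a where J: "finite J" "J \<subseteq> K" "\<And>j. j \<in> J \<Longrightarrow> test_fun (a j)"
    "\<And>x. x \<in> K \<Longrightarrow> (\<Sum>j\<in>J. \<phi> j x * a j x) = 1"
    using smooth_partition[OF K, of \<phi>] \<phi> by blast
  show ?thesis
  proof (intro exI[of _ "\<Inter>j\<in>J. \<Gamma> j"] conjI allI)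
    show "open_conic_nbhd (\<Inter>j\<in>J. \<Gamma> j) \<eta>0"
      using \<Gamma> J(1) by (auto simp: open_conic_nbhd_def intro!: open_INT)
    fix N :: nat
    obtain C M where C: "\<And>j. decay_bound w (\<phi> j) (\<Gamma> j) K N (M j) (C j)"
      using dec[OF K, of _ N] by metis
    then have C0: "0 \<le> C j" for j by (simp add: decay_bound_def)
    have "\<forall>j\<in>J. \<exists>B\<ge>0. deriv_bound UNIV (M j) (a j) B" using test_fun_deriv_bound J(3) by blast
    then obtain B where B: "\<And>j. j \<in> J \<Longrightarrow> 0 \<le> B j" "\<And>j. j \<in> J \<Longrightarrow> deriv_bound UNIV (M j) (a j) (B j)"
      by metis
    have "norm (w (\<lambda>x. g x * osc \<eta> x)) \<le> (\<Sum>j\<in>J. C j * (2 ^ M j * B j)) * A * (1 + norm \<eta>) powr (- real N)"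
      if g: "test_fun g" "tsupport g \<subseteq> K" "deriv_bound UNIV (sum M J) g A" "\<eta> \<in> (\<Inter>j\<in>J. \<Gamma> j)" for g A \<eta>
    proof -
      have A0: "0 \<le> A" by (rule deriv_bound_nonneg[OF g(3)])
      have tg: "test_fun (\<lambda>x. g x * a j x)" if "j \<in> J" for j
        by (intro test_fun_mult g test_fun_smooth J(3) that)
      have t: "test_fun (\<lambda>x. \<phi> j x * (g x * a j x * osc \<eta> x))" if "j \<in> J" for j
        by (intro test_fun_mult[OF \<phi>(1)] smooth_mult smooth_osc test_fun_smooth g J(3) that)
      have "g x * osc \<eta> x = (\<Sum>j\<in>J. \<phi> j x * (g x * a j x * osc \<eta> x))" for x
      proof (cases "x \<in> K")
        case True
        have "(\<Sum>j\<in>J. \<phi> j x * (g x * a j x * osc \<eta> x)) = (\<Sum>j\<in>J. \<phi> j x * a j x) * (g x * osc \<eta> x)"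
          unfolding sum_distrib_right by (simp add: mult_ac)
        then show ?thesis by (simp add: J(4)[OF True])
      next
        case False
        then have "g x = 0" using g(2) not_in_tsupport by blast
        then show ?thesis by simp
      qed
      then have "w (\<lambda>x. g x * osc \<eta> x) = w (\<lambda>x. \<Sum>j\<in>J. \<phi> j x * (g x * a j x * osc \<eta> x))" by simp
      also have "\<dots> = (\<Sum>j\<in>J. w (\<lambda>x. \<phi> j x * (g x * a j x * osc \<eta> x)))"
        by (rule distribution_sum[OF w t])
      finally have "norm (w (\<lambda>x. g x * osc \<eta> x)) \<le> (\<Sum>j\<in>J. norm (w (\<lambda>x. \<phi> j x * (g x * a j x * osc \<eta> x))))"
        by (simp add: norm_sum)
      also have "\<dots> \<le> (\<Sum>j\<in>J. C j * (2 ^ M j * A * B j) * (1 + norm \<eta>) powr (- real N))"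
      proof (rule sum_mono)
        fix j assume j: "j \<in> J"
        have "M j \<le> sum M J" using j J(1) by (intro member_le_sum) auto
        then have "deriv_bound UNIV (M j) g A" by (intro deriv_bound_mono[OF g(3)]) auto
        then have "deriv_bound UNIV (M j) (\<lambda>x. g x * a j x) (2 ^ M j * A * B j)"
          using j by (intro deriv_bound_mult test_fun_smooth g J(3) B A0)
        moreover have "tsupport (\<lambda>x. g x * a j x) \<subseteq> K" using tsupport_mult g(2) by blast
        ultimately show "norm (w (\<lambda>x. \<phi> j x * (g x * a j x * osc \<eta> x))) \<le>
            C j * (2 ^ M j * A * B j) * (1 + norm \<eta>) powr (- real N)"
          using decay_boundD[OF C tg[OF j]] g(4) j by blast
      qed
      also have "\<dots> = (\<Sum>j\<in>J. C j * (2 ^ M j * B j)) * A * (1 + norm \<eta>) powr (- real N)"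
        unfolding sum_distrib_right by (simp add: mult_ac)
      finally show ?thesis .
    qed
    moreover have "0 \<le> (\<Sum>j\<in>J. C j * (2 ^ M j * B j))"
      using C0 B(1) by (intro sum_nonneg mult_nonneg_nonneg) auto
    \<comment> \<open>The sum of the orders \<open>M j\<close> serves as a common order because it
      dominates each of them.\<close>
    ultimately have "decay_bound w (\<lambda>x. 1) (\<Inter>j\<in>J. \<Gamma> j) K N (sum M J) (\<Sum>j\<in>J. C j * (2 ^ M j * B j))"
      unfolding decay_bound_def by simp
    then show "\<exists>M C. decay_bound w (\<lambda>x. 1) (\<Inter>j\<in>J. \<Gamma> j) K N M C" by blast
  qed
qed

section \<open>The directional antiderivative\<close>

text \<open>Trades half lines with a moving end point for a fixed interval with a shifted integrand,
  to which differentiation under the integral applies. From a point of modulus at most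
  \<open>B\<close>, the length \<open>2 * B\<close> covers what is left of the support on either
  side.\<close>

lemma integral_half_line:
  fixes k :: "real \<Rightarrow> complex"
  assumes k: "\<And>s. B < \<bar>s\<bar> \<Longrightarrow> k s = 0" and cont: "continuous_on UNIV k" and t: "\<bar>t\<bar> \<le> B"
  shows integral_atMost_eq: "integral {..t} k = integral {0..2*B} (\<lambda>s. k (t - s))"
    and integral_UNIV_split:
      "integral UNIV k = integral {0..2*B} (\<lambda>s. k (t - s)) + integral {0..2*B} (\<lambda>s. k (t + s))"
    and integral_UNIV_eq: "integral UNIV k = integral {-B..B} k"
proof -
  have "integral {-(2*B)..-0} (\<lambda>s. (k \<circ> (+) t) (- (- s))) = integral {0..2*B} (\<lambda>s. (k \<circ> (+) t) (- s))"
    using Henstock_Kurzweil_Integration.integral_reflect_real[of "2*B" 0 "\<lambda>s. (k \<circ> (+) t) (- s)"] by simp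
  then have left: "integral {0..2*B} (\<lambda>s. k (t - s)) = integral {t - 2*B..t} k"
    using integral_shift_Icc_real[of "-(2*B)" 0 k t] by (simp add: o_def)
  have right: "integral {0..2*B} (\<lambda>s. k (t + s)) = integral {t..t + 2*B} k"
    using integral_shift_Icc_real[of 0 "2*B" k t] by (simp add: o_def add.commute)
  have restrict: "integral S k = integral T k" if "\<And>s. \<bar>s\<bar> \<le> B \<Longrightarrow> s \<in> S \<longleftrightarrow> s \<in> T" for S T
  proof -
    have "(\<lambda>s. if s \<in> S then k s else 0) = (\<lambda>s. if s \<in> T then k s else 0)"
    proof
      fix s show "(if s \<in> S then k s else 0) = (if s \<in> T then k s else 0)"
        using that[of s] k[of s] by (cases "\<bar>s\<bar> \<le> B") auto
    qed
    then show ?thesis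
      by (metis Henstock_Kurzweil_Integration.integral_restrict_UNIV)
  qed
  show "integral {..t} k = integral {0..2*B} (\<lambda>s. k (t - s))"
    unfolding left using t by (intro restrict) auto
  show "integral UNIV k = integral {-B..B} k"
    by (intro restrict) auto
  have "integral UNIV k = integral {t - 2*B..t + 2*B} k"
    using t by (intro restrict) auto
  also have "\<dots> = integral {t - 2*B..t} k + integral {t..t + 2*B} k"
    using t by (intro Henstock_Kurzweil_Integration.integral_combine[symmetric] integrable_continuous_real
        continuous_on_subset[OF cont]) auto
  finally show "integral UNIV k = integral {0..2*B} (\<lambda>s. k (t - s)) + integral {0..2*B} (\<lambda>s. k (t + s))"
    unfolding left right .
qed

definition ray_int :: "'a::euclidean_space \<Rightarrow> real \<Rightarrow> ('a \<Rightarrow> complex) \<Rightarrow> 'a \<Rightarrow> complex" where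
  "ray_int v c f x = integral {0..c} (\<lambda>s. f (x + s *\<^sub>R v))"

lemma smooth_ray_int: "smooth f \<Longrightarrow> smooth (ray_int v c f)"
  using smooth_param_integral[of "\<lambda>x. x" 0 c "\<lambda>s. s *\<^sub>R v" "\<lambda>s. 1" f]
  by (simp add: ray_int_def[abs_def] bounded_linear_ident continuous_intros)

text \<open>\<open>P\<close> is a smooth substitute on the whole space for the antiderivative on the
  ball. To the right of \<open>\<psi>\<close> its mass one is used up, so the backward integral
  minus the full line integral is minus the forward ray.\<close>

lemma dir_antideriv_fun_ray:
  fixes v :: "'a::euclidean_space"
  assumes v: "norm v = 1" and f: "smooth f" "\<And>x. B < norm x \<Longrightarrow> f x = 0"
    and \<psi>: "smooth \<psi>" "\<And>s. B < \<bar>s\<bar> \<Longrightarrow> \<psi> s = 0" "integral UNIV \<psi> = 1"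
  obtains P where "smooth P" "\<And>x. norm x \<le> B \<Longrightarrow> dir_antideriv_fun v \<psi> f x = P x"
    "\<And>x. norm x \<le> B \<Longrightarrow> (\<And>s. x \<bullet> v \<le> s \<Longrightarrow> \<psi> s = 0) \<Longrightarrow> P x = - ray_int v (2 * B) f x"
proof -
  have vv: "v \<bullet> v = 1" using v by (simp add: dot_square_norm)
  \<comment> \<open>For \<open>norm x \<le> B\<close>, \<open>X\<close> is the X-ray transform at
    the projection of \<open>x\<close> and \<open>\<Psi>\<close> is the primitive of
    \<open>\<psi>\<close> at \<open>x \<bullet> v\<close>; both are smooth everywhere.\<close>
  define X where "X x = integral {-B..B} (\<lambda>s. 1 * f ((x - (x \<bullet> v) *\<^sub>R v) + s *\<^sub>R v))" for x
  define \<Psi> where "\<Psi> x = ray_int (- v) (2 * B) (\<lambda>x. complex_of_real (\<psi> (x \<bullet> v))) x" for x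
  define P where "P x = ray_int (- v) (2 * B) f x - X x * \<Psi> x" for x
  have sX: "smooth X"
    unfolding X_def by (intro smooth_param_integral bounded_linear_reject f continuous_intros)
  have s\<Psi>: "smooth \<Psi>"
    unfolding \<Psi>_def by (intro smooth_ray_int smooth_linear[OF bounded_linear_of_real] smooth_compose[OF \<psi>(1)] smooth_inner)
  have "smooth P"
    unfolding P_def by (intro smooth_diff smooth_mult smooth_ray_int f sX s\<Psi>)
  moreover have "dir_antideriv_fun v \<psi> f x = P x \<and> ((\<forall>s. x \<bullet> v \<le> s \<longrightarrow> \<psi> s = 0) \<longrightarrow> P x = - ray_int v (2 * B) f x)"
    if x: "norm x \<le> B" for x
  proof -
    define t where "t = x \<bullet> v"
    define u where "u = x - t *\<^sub>R v"
    have t: "\<bar>t\<bar> \<le> B" using Cauchy_Schwarz_ineq2[of x v] v x by (simp add: t_def)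
    have uv: "u \<bullet> v = 0" by (simp add: u_def t_def inner_diff_left vv)
    define k where "k s = f (u + s *\<^sub>R v)" for s
    have k0: "k s = 0" if "B < \<bar>s\<bar>" for s
    proof -
      have "\<bar>s\<bar> = \<bar>(u + s *\<^sub>R v) \<bullet> v\<bar>" by (simp add: inner_add_left uv vv)
      also have "\<dots> \<le> norm (u + s *\<^sub>R v)" using Cauchy_Schwarz_ineq2[of "u + s *\<^sub>R v" v] v by simp
      finally show ?thesis unfolding k_def using that by (intro f(2)) simp
    qed
    have kc: "continuous_on UNIV k"
      unfolding k_def by (intro continuous_on_compose2[OF smooth_continuous_on[OF f(1)]] continuous_intros) auto
    define p where "p s = complex_of_real (\<psi> s)" for s
    have p0: "p s = 0" if "B < \<bar>s\<bar>" for s using \<psi>(2)[OF that] by (simp add: p_def)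
    have pc: "continuous_on UNIV p"
      unfolding p_def by (intro continuous_intros smooth_continuous_on \<psi>)
    \<comment> \<open>\<open>integral\<close> is 0 for a non-integrable function, so the value 1
      already yields integrability.\<close>
    have "(\<psi> has_integral 1) UNIV"
      using \<psi>(3) by (metis has_integral_integral not_integrable_integral zero_neq_one)
    from has_integral_of_real[OF this, where 'b = complex] have p1: "integral UNIV p = 1"
      unfolding p_def by (simp add: integral_unique)
    have Xx: "X x = integral UNIV k"
      using integral_UNIV_eq[OF k0 kc t] by (simp add: X_def k_def[abs_def] u_def t_def)
    then have xr: "xray v f u = X x" by (simp add: xray_def k_def[abs_def])
    have kl: "ray_int (- v) (2 * B) f x = integral {0..2*B} (\<lambda>s. k (t - s))"
      by (simp add: ray_int_def k_def u_def algebra_simps)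
    have kr: "ray_int v (2 * B) f x = integral {0..2*B} (\<lambda>s. k (t + s))"
      by (simp add: ray_int_def k_def u_def algebra_simps)
    have pl: "\<Psi> x = integral {0..2*B} (\<lambda>s. p (t - s))"
      by (simp add: \<Psi>_def ray_int_def p_def t_def inner_diff_left vv)
    have "dir_antideriv_fun v \<psi> f x = integral {..t} (\<lambda>s. k s - X x * p s)"
      by (simp add: dir_antideriv_fun_def Let_def t_def[symmetric] u_def[symmetric] xr k_def p_def)
    also have "\<dots> = integral {0..2*B} (\<lambda>s. k (t - s) - X x * p (t - s))"
      by (intro integral_atMost_eq t continuous_intros kc pc) (simp add: k0 p0)
    also have "\<dots> = integral {0..2*B} (\<lambda>s. k (t - s)) - X x * integral {0..2*B} (\<lambda>s. p (t - s))"
      by (subst integral_diff)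
        (auto intro!: integrable_continuous_real continuous_intros
          continuous_on_compose2[OF kc] continuous_on_compose2[OF pc])
    finally have 1: "dir_antideriv_fun v \<psi> f x = P x" by (simp add: P_def kl pl)
    have "P x = - ray_int v (2 * B) f x" if right: "\<forall>s. x \<bullet> v \<le> s \<longrightarrow> \<psi> s = 0"
    proof -
      have "integral {0..2*B} (\<lambda>s. p (t + s)) = integral {0..2*B} (\<lambda>s. 0)"
        using right by (intro integral_cong) (simp add: p_def t_def)
      then have "\<Psi> x = 1"
        using integral_UNIV_split[OF p0 pc t] p1 pl by simp
      then show ?thesis
        using integral_UNIV_split[OF k0 kc t] by (simp add: P_def Xx kl kr)
    qed
    with 1 show ?thesis by blast
  qed
  ultimately show ?thesis using that by blast
qed

lemma ray_int_osc:
  "ray_int v c (\<lambda>x. \<phi> x * osc \<eta> x) x =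
    integral {0..c} (\<lambda>s. osc \<eta> (s *\<^sub>R v) * \<phi> (x + s *\<^sub>R v)) * osc \<eta> x"
proof -
  have "osc \<eta> (x + s *\<^sub>R v) = osc \<eta> (s *\<^sub>R v) * osc \<eta> x" for s
    by (simp add: osc_def exp_add[symmetric] inner_add_left algebra_simps)
  then show ?thesis
    unfolding ray_int_def by (subst integral_mult_left[symmetric]) (simp add: mult_ac)
qed

text \<open>The phase \<open>osc \<eta> (s *\<^sub>R v)\<close> has modulus one and no
  \<open>x\<close> in it, so all derivatives fall on \<open>\<phi>\<close> and the bound is free of
  \<open>\<eta>\<close>.\<close>

lemma osc_ray_bound:
  fixes \<phi> :: "'a::euclidean_space \<Rightarrow> complex" and v :: 'a
  assumes "smooth \<phi>" "0 \<le> c" "deriv_bound UNIV M \<phi> A"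
  defines "H \<equiv> \<lambda>\<eta> x. integral {0..c} (\<lambda>s. osc \<eta> (s *\<^sub>R v) * \<phi> (x + s *\<^sub>R v))"
  shows "smooth (H \<eta>)" "deriv_bound UNIV M (H \<eta>) (A * c)"
proof -
  have co: "continuous_on S (\<lambda>s. osc \<eta> (s *\<^sub>R v))" for S
    by (intro continuous_on_compose2[OF smooth_continuous_on[OF smooth_osc]] continuous_intros) auto
  have cv: "continuous_on S (\<lambda>s. s *\<^sub>R v)" for S by (intro continuous_intros)
  show "smooth (H \<eta>)"
    unfolding H_def by (rule smooth_param_integral[OF bounded_linear_ident cv co assms(1)])
  have eq: "pderivs bs (H \<eta>) = (\<lambda>x. integral {0..c} (\<lambda>s. osc \<eta> (s *\<^sub>R v) * pderivs bs \<phi> (x + s *\<^sub>R v)))"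
    if "set bs \<subseteq> Basis" for bs
    using that
  proof (induction bs)
    case (Cons b bs)
    then have "set bs \<subseteq> Basis" and IH: "pderivs bs (H \<eta>) =
        (\<lambda>x. integral {0..c} (\<lambda>s. osc \<eta> (s *\<^sub>R v) * pderivs bs \<phi> (x + s *\<^sub>R v)))"
      by auto
    from has_derivative_param_integral[OF smooth_pderivs[OF assms(1) this(1)] bounded_linear_ident cv co]
    show ?case unfolding pderivs_Cons IH by (intro ext dpart_eqI)
  qed (simp add: H_def)
  show "deriv_bound UNIV M (H \<eta>) (A * c)"
    unfolding deriv_bound_def
  proof (intro allI impI ballI)
    fix bs :: "'a list" and x assume bs: "set bs \<subseteq> Basis" "length bs \<le> M"
    have "norm (integral {0..c} (\<lambda>s. osc \<eta> (s *\<^sub>R v) * pderivs bs \<phi> (x + s *\<^sub>R v))) \<le> A * (c - 0)"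
    proof (rule norm_integral_le[OF assms(2)])
      show "continuous_on {0..c} (\<lambda>s. osc \<eta> (s *\<^sub>R v) * pderivs bs \<phi> (x + s *\<^sub>R v))"
        by (intro continuous_on_mult co continuous_on_compose2[OF smooth_continuous_on[OF smooth_pderivs[OF assms(1) bs(1)]]]
            continuous_intros) auto
      show "norm (osc \<eta> (s *\<^sub>R v) * pderivs bs \<phi> (x + s *\<^sub>R v)) \<le> A" for s
        using deriv_boundD[OF assms(3) bs] by (simp add: norm_mult osc_def)
    qed
    then show "norm (pderivs bs (H \<eta>) x) \<le> A * c" by (simp add: eq[OF bs(1)])
  qed
qed

text \<open>\<open>c\<close> and \<open>cf\<close> are fixed before \<open>\<eta>\<close>, so the
  factors in front of \<open>osc \<eta>\<close> are all supported in \<open>tsupport cf\<close> and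
  can be bounded uniformly.\<close>

lemma loc_fourier_dir_antideriv:
  fixes v :: "'a::euclidean_space"
  assumes v: "norm v = 1" and w: "compact_distribution w" and \<phi>: "test_fun \<phi>"
  obtains c cf where "0 \<le> c" "test_fun cf" "\<And>\<eta>. loc_fourier (dir_antideriv v w) \<phi> \<eta> =
    w (\<lambda>x. cf x * integral {0..c} (\<lambda>s. osc \<eta> (s *\<^sub>R v) * \<phi> (x + s *\<^sub>R v)) * osc \<eta> x)"
proof -
  have dw: "distribution w" using w by (simp add: compact_distribution_def)
  define \<psi> where "\<psi> = (SOME \<psi>0. admissible_cutoff v w \<psi>0)"
  have adm: "admissible_cutoff v w \<psi>"
    unfolding \<psi>_def by (rule someI_ex[OF admissible_cutoff_exists[OF w]])
  then have s\<psi>: "smooth \<psi>" and c\<psi>: "compact (tsupport \<psi>)" and i\<psi>: "integral UNIV \<psi> = 1"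
    by (auto simp: admissible_cutoff_def)
  obtain cf U where cf: "test_fun cf" and U: "open U" "dsupport w \<subseteq> U" "\<And>x. x \<in> U \<Longrightarrow> cf x = 1"
    and ext: "\<And>g. ext_pair w g = w (\<lambda>x. cf x * g x)"
    using ext_pair_eq[OF w] by metis
  have "bounded (tsupport \<phi> \<union> tsupport cf)"
    using \<phi> cf by (auto simp: test_fun_def compact_imp_bounded)
  then obtain B1 where B1: "\<And>x. x \<in> tsupport \<phi> \<union> tsupport cf \<Longrightarrow> norm x \<le> B1"
    unfolding bounded_iff by blast
  obtain B2 where B2: "\<And>s. s \<in> tsupport \<psi> \<Longrightarrow> norm s \<le> B2"
    using compact_imp_bounded[OF c\<psi>] unfolding bounded_iff by blast
  \<comment> \<open>One radius for the supports of \<open>\<phi>\<close>, \<open>cf\<close> and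
    \<open>\<psi>\<close>; outside this ball \<open>cf\<close> vanishes, so only values inside it
    count.\<close>
  define B where "B = max 0 (max B1 B2)"
  have B: "0 \<le> B" "B1 \<le> B" "B2 \<le> B" by (auto simp: B_def)
  have \<psi>0: "\<psi> s = 0" if "B < \<bar>s\<bar>" for s
    using B2[of s] that B not_in_tsupport[of s \<psi>] by force
  have cf0: "cf x = 0" if "\<not> norm x \<le> B" for x
    using B1[of x] that B not_in_tsupport[of x cf] by force
  have "tsupport \<psi> \<noteq> {}"
  proof
    assume "tsupport \<psi> = {}"
    then have "\<psi> = (\<lambda>s. 0)" using not_in_tsupport[of _ \<psi>] by auto
    then show False using i\<psi> by simp
  qed
  then obtain \<sigma> where \<sigma>: "\<sigma> \<in> tsupport \<psi>" "\<And>s. s \<in> tsupport \<psi> \<Longrightarrow> s \<le> \<sigma>"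
    using compact_attains_sup[OF c\<psi>] by blast
  \<comment> \<open>The support of \<open>\<psi>\<close> attains its maximum
    \<open>\<sigma>\<close>, so admissibility makes this open half-space a neighbourhood of the
    support of \<open>w\<close>.\<close>
  define V where "V = {x::'a. \<sigma> < x \<bullet> v}"
  have V: "open V" "dsupport w \<subseteq> V"
    using adm \<sigma>(1) by (auto simp: V_def admissible_cutoff_def intro!: open_Collect_less continuous_intros)
  have right: "\<psi> s = 0" if "x \<in> V" "x \<bullet> v \<le> s" for x s
    using that \<sigma>(2)[of s] not_in_tsupport[of s \<psi>] by (force simp: V_def)
  have "loc_fourier (dir_antideriv v w) \<phi> \<eta> =
    w (\<lambda>x. cf x * integral {0..2*B} (\<lambda>s. osc \<eta> (s *\<^sub>R v) * \<phi> (x + s *\<^sub>R v)) * osc \<eta> x)" for \<eta>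
  proof -
    define f where "f x = \<phi> x * osc \<eta> x" for x
    have tf: "test_fun f" unfolding f_def by (intro test_fun_mult \<phi> smooth_osc)
    have f0: "f x = 0" if "B < norm x" for x
      using B1[of x] that B not_in_tsupport[of x \<phi>] by (force simp: f_def)
    obtain P where P: "smooth P" "\<And>x. norm x \<le> B \<Longrightarrow> dir_antideriv_fun v \<psi> f x = P x"
      "\<And>x. norm x \<le> B \<Longrightarrow> (\<And>s. x \<bullet> v \<le> s \<Longrightarrow> \<psi> s = 0) \<Longrightarrow> P x = - ray_int v (2 * B) f x"
      using dir_antideriv_fun_ray[OF v test_fun_smooth[OF tf] f0 s\<psi> \<psi>0 i\<psi>] by blast
    have tP: "test_fun (\<lambda>x. cf x * P x)" by (intro test_fun_mult cf P)
    have tR: "test_fun (\<lambda>x. cf x * ray_int v (2 * B) f x)"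
      by (intro test_fun_mult cf smooth_ray_int test_fun_smooth tf)
    have "cf x * dir_antideriv_fun v \<psi> f x = cf x * P x" for x
      using P(2)[of x] cf0[of x] by (cases "norm x \<le> B") auto
    then have eq: "(\<lambda>x. cf x * dir_antideriv_fun v \<psi> f x) = (\<lambda>x. cf x * P x)" by blast
    have "loc_fourier (dir_antideriv v w) \<phi> \<eta> = dir_antideriv v w f"
      unfolding loc_fourier_def f_def[abs_def] osc_def ..
    also have "\<dots> = - w (\<lambda>x. cf x * P x)"
      unfolding dir_antideriv_def ext \<psi>_def[symmetric] eq ..
    finally have "loc_fourier (dir_antideriv v w) \<phi> \<eta> = - w (\<lambda>x. cf x * P x)" .
    \<comment> \<open>\<open>P\<close> equals minus the ray integral on \<open>V\<close> wherever
      \<open>cf\<close> is nonzero, which is enough since \<open>V\<close> contains the support of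
      \<open>w\<close>. The resulting minus sign cancels the one in
      \<open>dir_antideriv\<close>.\<close>
    moreover have "w (\<lambda>x. cf x * P x + cf x * ray_int v (2 * B) f x) = 0"
    proof (rule distribution_vanish[OF dw test_fun_add[OF tP tR] V])
      fix x assume "x \<in> V"
      then show "cf x * P x + cf x * ray_int v (2 * B) f x = 0"
        using P(3)[of x] right[of x] cf0[of x] by (cases "norm x \<le> B") auto
    qed
    ultimately have "loc_fourier (dir_antideriv v w) \<phi> \<eta> = w (\<lambda>x. cf x * ray_int v (2 * B) f x)"
      by (simp add: distribution_add[OF dw tP tR] add_eq_0_iff)
    then show ?thesis
      unfolding f_def[abs_def] ray_int_osc by (simp add: mult.assoc)
  qed
  with cf B(1) show ?thesis by (intro that[of "2 * B" cf]) auto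
qed

theorem theorem1p8:
  fixes v \<eta>0 :: "'a::euclidean_space"
    and w :: "('a \<Rightarrow> complex) \<Rightarrow> complex"
  assumes "norm v = 1"
    and "compact_distribution w"
    and "\<eta>0 \<bullet> v = 0"
    and "wavefront w \<inter> (UNIV \<times> {\<eta>0}) = {}"
  shows "wavefront (dir_antideriv v w) \<inter> (UNIV \<times> {\<eta>0}) = {}"
proof (cases "\<eta>0 = 0")
  case True
  \<comment> \<open>\<open>wavefront\<close> contains no zero covector by definition.\<close>
  then show ?thesis by (auto simp: wavefront_def)
next
  case False
  have dw: "distribution w" using assms(2) by (simp add: compact_distribution_def)
  have "(x0, \<eta>0) \<notin> wavefront (dir_antideriv v w)" for x0
  proof -
    \<comment> \<open>Any test function nonzero at \<open>x0\<close> would do. The pairing involves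
      \<open>w\<close> along whole rays ending in the bump, so the hypothesis is used at all points
      of \<open>tsupport cf\<close> and not only near \<open>x0\<close>.\<close>
    define \<phi> :: "'a \<Rightarrow> complex" where "\<phi> = bump x0 1"
    have \<phi>: "test_fun \<phi>" "\<phi> x0 \<noteq> 0" by (simp_all add: \<phi>_def test_fun_bump bump_center)
    obtain c cf where c: "0 \<le> c" and cf: "test_fun cf" and u: "\<And>\<eta>. loc_fourier (dir_antideriv v w) \<phi> \<eta> =
        w (\<lambda>x. cf x * integral {0..c} (\<lambda>s. osc \<eta> (s *\<^sub>R v) * \<phi> (x + s *\<^sub>R v)) * osc \<eta> x)"
      using loc_fourier_dir_antideriv[OF assms(1,2) \<phi>(1)] by blast
    define H where "H \<eta> x = integral {0..c} (\<lambda>s. osc \<eta> (s *\<^sub>R v) * \<phi> (x + s *\<^sub>R v))" for \<eta> x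
    have "compact (tsupport cf)" using cf by (simp add: test_fun_def)
    from global_decay[OF dw False this assms(4)]
    obtain \<Gamma> where \<Gamma>: "open_conic_nbhd \<Gamma> \<eta>0"
      and dec: "\<And>N. \<exists>M C. decay_bound w (\<lambda>x. 1) \<Gamma> (tsupport cf) N M C" by blast
    have "\<exists>D. \<forall>\<eta>\<in>\<Gamma>. norm (loc_fourier (dir_antideriv v w) \<phi> \<eta>) \<le> D * (1 + norm \<eta>) powr (- real N)" for N :: nat
    proof -
      obtain M C where MC: "decay_bound w (\<lambda>x. 1) \<Gamma> (tsupport cf) N M C" using dec by blast
      obtain A where A: "0 \<le> A" "deriv_bound UNIV M \<phi> A" using test_fun_deriv_bound[OF \<phi>(1)] by blast
      obtain A' where A': "0 \<le> A'" "deriv_bound UNIV M cf A'" using test_fun_deriv_bound[OF cf] by blast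
      have "norm (loc_fourier (dir_antideriv v w) \<phi> \<eta>) \<le> (C * (2 ^ M * A' * (A * c))) * (1 + norm \<eta>) powr (- real N)"
        if "\<eta> \<in> \<Gamma>" for \<eta>
      proof -
        have H: "smooth (H \<eta>)" "deriv_bound UNIV M (H \<eta>) (A * c)"
          unfolding H_def[abs_def] by (rule osc_ray_bound[OF test_fun_smooth[OF \<phi>(1)] c A(2)])+
        have "test_fun (\<lambda>x. cf x * H \<eta> x)" by (intro test_fun_mult cf H)
        moreover have "deriv_bound UNIV M (\<lambda>x. cf x * H \<eta> x) (2 ^ M * A' * (A * c))"
          using A A' c by (intro deriv_bound_mult H test_fun_smooth cf) auto
        ultimately show ?thesis
          using decay_boundD[OF MC _ tsupport_mult _ that] by (simp add: u H_def)
      qed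
      then show ?thesis by blast
    qed
    with \<phi> \<Gamma> show ?thesis by (auto simp: wavefront_def)
  qed
  then show ?thesis by auto
qed

end
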